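(* Let $n$ be an odd number, $h_n:=(n-1)/2$, and let $\alpha\in\mathbb N$ with $1\le\alpha\le h_n-1$. Let $U\subset\mathbb R^{n+1}$ be a bounded slice Cauchy domain and, for $I\in\mathbb S$, set $ds_I=ds(-I)$. (i) If $f$ is a left slice hyperholomorphic function on a set that contains $\overline U$, then the left axially holomorphic Cliffordian function $\breve f_0(x)=\Delta_{n+1}^\alpha f(x)$, of order $(h_n-\alpha,1)$, has the integral representation $$\breve f_0(x)=\frac1{2\pi}\int_{\partial(U\cap\mathbb C_I)}\mathcal K_\alpha^L(s,x)\,ds_I\,f(s),\qquad x\in U.$$ (ii) If $f$ is a right slice hyperholomorphic function on a set that contains $\overline U$, then the right axially holomorphic Cliffordian function $\breve f_0(x)=\Delta_{n+1}^\alpha f(x)$, of order $(h_n-\alpha,1)$, has the integral representation $$\breve f_0(x)=\frac1{2\pi}\int_{\partial(U\cap\mathbb C_I)}f(s)\,ds_I\,\mathcal K_\alpha^R(s,x),\qquad x\in U.$$ Moreover, these integrals depend neither on $U$ nor on the imaginary unit $I\in\mathbb S$, nor on the kernel of $\Delta_{n+1}^\alpha$ (i.e. replacing $f$ by another left, resp. right, slice hyperholomorphic function with the same image under $\Delta_{n+1}^\alpha$ does not change them).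
   Context: $\mathbb R_n$ is the real Clifford algebra generated by $e_1,\dots,e_n$ with $e_ie_j+e_je_i=-2\delta_{ij}$. A point $(x_0,\dots,x_n)\in\mathbb R^{n+1}$ is identified with the paravector $x=x_0+\underline x$, $\underline x=\sum_{j=1}^n x_je_j$; $\overline x=x_0-\underline x$, $|x|^2=\sum_{j=0}^nx_j^2$. $\mathbb S$ is the set of $\underline x$ with $|\underline x|=1$; for $I\in\mathbb S$, $\mathbb C_I=\mathbb R+I\mathbb R$. $[x]=\{x_0+I|\underline x|: I\in\mathbb S\}$. An open $U\subset\mathbb R^{n+1}$ is axially symmetric if $[x]\subset U$ for all $x\in U$; it is a slice Cauchy domain if it is axially symmetric and, for every $I\in\mathbb S$, $\partial(U\cap\mathbb C_I)$ is a finite union of non-intersecting piecewise continuously differentiable Jordan curves in $\mathbb C_I$ (positively oriented). For $U$ axially symmetric open let $\mathcal U=\{(u,v)\in\mathbb R^2: u+\mathbb S v\subset U\}$. $f:U\to\mathbb R_n$ is left (resp. right) slice hyperholomorphic if $f(u+Iv)=a(u,v)+I\,b(u,v)$ (resp. $a(u,v)+b(u,v)I$) for all $I\in\mathbb S$, $(u,v)\in\mathcal U$, with differentiable $a,b:\mathcal U\to\mathbb R_n$ satisfying $a(u,-v)=a(u,v)$, $b(u,-v)=-b(u,v)$ and $\partial_ua=\partial_vb$, $\partial_va=-\partial_ub$. $\Delta_{n+1}=\sum_{j=0}^n\partial_{x_j}^2$; $Dg=\partial_{x_0}g+\sum_ie_i\partial_{x_i}g$, $gD=\partial_{x_0}g+\sum_i\partial_{x_i}g\,e_i$.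 A function $g$ of class $\mathcal C^{2k+1}$ is left (resp. right) axially holomorphic Cliffordian of order $(k,1)$ if $\Delta_{n+1}^kDg=0$ (resp. $\Delta_{n+1}^k(gD)=0$) and $g(x)=A(x_0,|\underline x|)+\frac{\underline x}{|\underline x|}B(x_0,|\underline x|)$ (resp. $A+B\frac{\underline x}{|\underline x|}$) with $\mathbb R_n$-valued $A$ even and $B$ odd in the second variable. Kernels: for $s\notin[x]$, $\mathcal Q_{c,s}(x)=s^2-2x_0s+|x|^2$, $\mathcal K_\alpha^L(s,x)=k_\alpha(s-\overline x)\mathcal Q_{c,s}(x)^{-\alpha-1}$, $\mathcal K_\alpha^R(s,x)=k_\alpha\mathcal Q_{c,s}(x)^{-\alpha-1}(s-\overline x)$, with $k_\alpha=4^\alpha\alpha!\,(-h_n)_\alpha$, $(-h_n)_\alpha=(-1)^\alpha\frac{h_n!}{(h_n-\alpha)!}$. *)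

theory Defs
  imports "HOL-Complex_Analysis.Winding_Numbers"
begin

section \<open>The real Clifford algebra\<close>

text \<open>
  The generators of \<open>\<real>\<^sub>n\<close> are indexed by a finite linearly ordered type \<open>'n\<close> with
  \<open>CARD('n) = n\<close>.  An element is given by its coefficients with respect to the basis
  \<open>e\<^sub>A = e\<^sub>i\<^sub>1 \<dots> e\<^sub>i\<^sub>k\<close>, where \<open>A = {i\<^sub>1 < \<dots> < i\<^sub>k}\<close> is a set of indices.
\<close>

typedef ('n::"{finite,linorder}") clifford = "UNIV :: (real ^ 'n set) set"
  morphisms cvec Cl by simp

setup_lifting type_definition_clifford

lemma clifford_eqI: "(\<And>A. cvec x $ A = cvec y $ A) \<Longrightarrow> x = y"
  by (metis cvec_inject vec_eq_iff)

instantiation clifford :: ("{finite,linorder}") real_vector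
begin
lift_definition zero_clifford :: "'a clifford" is 0 .
lift_definition plus_clifford :: "'a clifford \<Rightarrow> 'a clifford \<Rightarrow> 'a clifford" is "(+)" .
lift_definition minus_clifford :: "'a clifford \<Rightarrow> 'a clifford \<Rightarrow> 'a clifford" is "(-)" .
lift_definition uminus_clifford :: "'a clifford \<Rightarrow> 'a clifford" is uminus .
lift_definition scaleR_clifford :: "real \<Rightarrow> 'a clifford \<Rightarrow> 'a clifford" is scaleR .
instance by standard (transfer; simp add: algebra_simps)+
end

instantiation clifford :: ("{finite,linorder}") real_inner
begin
lift_definition inner_clifford :: "'a clifford \<Rightarrow> 'a clifford \<Rightarrow> real" is inner .
lift_definition norm_clifford :: "'a clifford \<Rightarrow> real" is norm .
lift_definition sgn_clifford :: "'a clifford \<Rightarrow> 'a clifford" is sgn .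
lift_definition dist_clifford :: "'a clifford \<Rightarrow> 'a clifford \<Rightarrow> real" is dist .
definition uniformity_clifford :: "('a clifford \<times> 'a clifford) filter" where
  "uniformity_clifford = (INF e\<in>{0 <..}. principal {(x, y). dist x y < e})"
definition open_clifford :: "'a clifford set \<Rightarrow> bool" where
  "open_clifford U \<longleftrightarrow> (\<forall>x\<in>U. \<forall>\<^sub>F (x', y) in uniformity. x' = x \<longrightarrow> y \<in> U)"
instance
proof
  fix x y z :: "'a clifford" and r :: real and U :: "'a clifford set"
  show "dist x y = norm (x - y)" by transfer (rule dist_norm)
  show "sgn x = inverse (norm x) *\<^sub>R x" by transfer (rule sgn_div_norm)
  show "uniformity = (INF e\<in>{0 <..}. principal {(x, y :: 'a clifford). dist x y < e})"
    by (rule uniformity_clifford_def)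
  show "open U \<longleftrightarrow> (\<forall>x\<in>U. \<forall>\<^sub>F (x', y) in uniformity. x' = x \<longrightarrow> y \<in> U)"
    by (rule open_clifford_def)
  show "inner x y = inner y x" by transfer (rule inner_commute)
  show "inner (x + y) z = inner x z + inner y z" by transfer (rule inner_add_left)
  show "inner (r *\<^sub>R x) y = r * inner x y" by transfer (rule inner_scaleR_left)
  show "0 \<le> inner x x" by transfer (rule inner_ge_zero)
  show "inner x x = 0 \<longleftrightarrow> x = 0" by transfer (rule inner_eq_zero_iff)
  show "norm x = sqrt (inner x x)" by transfer (rule norm_eq_sqrt_inner)
qed
end

instantiation clifford :: ("{finite,linorder}") euclidean_space
begin
definition Basis_clifford :: "'a clifford set" where "Basis_clifford = Cl ` Basis"
instance
proof
  show "(Basis :: 'a clifford set) \<noteq> {}" "finite (Basis :: 'a clifford set)"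
    by (simp_all add: Basis_clifford_def)
  show "inner u v = (if u = v then 1 else 0)" if "u \<in> Basis" "v \<in> Basis" for u v :: "'a clifford"
    using that by (auto simp: Basis_clifford_def inner_clifford.rep_eq Cl_inverse Cl_inject inner_Basis)
  show "(\<forall>u\<in>Basis. inner x u = 0) \<longleftrightarrow> x = 0" for x :: "'a clifford"
    by (simp add: Basis_clifford_def inner_clifford.rep_eq Cl_inverse euclidean_all_zero_iff
        zero_clifford.rep_eq flip: cvec_inject)
qed
end

text \<open>
  \<open>e\<^sub>A e\<^sub>B = reorder_sign A B \<cdot> e\<^bsub>A \<triangle> B\<^esub>\<close>: sorting contributes one factor \<open>-1\<close> for every pair
  \<open>j < i\<close> with \<open>i \<in> A\<close>, \<open>j \<in> B\<close>, and \<open>e\<^sub>i\<^sup>2 = -1\<close> contributes one for every \<open>i = j\<close>.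
\<close>

definition reorder_sign :: "'n::{finite,linorder} set \<Rightarrow> 'n set \<Rightarrow> real" where
  "reorder_sign A B = (\<Prod>i\<in>A. \<Prod>j\<in>B. if j \<le> i then -1 else 1)"

lemma prod_sym_diff:
  fixes f :: "'n::finite \<Rightarrow> real"
  assumes "\<And>i. f i * f i = 1"
  shows "prod f (sym_diff A B) = prod f A * prod f B"
proof -
  have 1: "prod f A = prod f (A - B) * prod f (A \<inter> B)" for A B
    by (metis Int_Diff_disjoint Int_Diff_Un finite_class.finite prod.union_disjoint mult.commute)
  have 2: "prod f (A \<inter> B) * prod f (A \<inter> B) = 1"
    by (simp add: assms flip: prod.distrib)
  have "prod f (sym_diff A B) = prod f (A - B) * prod f (B - A)"
    by (subst prod.union_disjoint) auto
  also have "\<dots> = prod f (A - B) * prod f (B - A) * (prod f (A \<inter> B) * prod f (A \<inter> B))"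
    by (simp add: 2)
  also have "\<dots> = prod f A * prod f B"
    using 1[of A B] 1[of B A] by (simp add: Int_commute mult_ac)
  finally show ?thesis .
qed

lemma reorder_sign_left:
  "reorder_sign (sym_diff A B) C = reorder_sign A C * reorder_sign B C"
  unfolding reorder_sign_def
  by (rule prod_sym_diff) (auto simp flip: prod.distrib intro!: prod.neutral)

lemma reorder_sign_right:
  "reorder_sign A (sym_diff B C) = reorder_sign A B * reorder_sign A C"
  unfolding reorder_sign_def
  by (subst prod_sym_diff) (auto simp: prod.distrib)

lemma reorder_sign_square: "reorder_sign A B * reorder_sign A B = 1"
  unfolding reorder_sign_def by (auto simp flip: prod.distrib intro!: prod.neutral)

lemma sym_diff_cancel [simp]: "sym_diff A (sym_diff A B) = B"
  by auto

instantiation clifford :: ("{finite,linorder}") real_algebra_1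
begin
definition one_clifford :: "'a clifford" where
  "one_clifford = Cl (\<chi> A. if A = {} then 1 else 0)"
definition times_clifford :: "'a clifford \<Rightarrow> 'a clifford \<Rightarrow> 'a clifford" where
  "a * b = Cl (\<chi> C. \<Sum>A\<in>UNIV. reorder_sign A (sym_diff A C) * cvec a $ A * cvec b $ sym_diff A C)"
instance
proof
  fix a b c :: "'a clifford" and r :: real
  have T: "cvec (x * y) $ C =
      (\<Sum>A\<in>UNIV. reorder_sign A (sym_diff A C) * cvec x $ A * cvec y $ sym_diff A C)"
    for x y :: "'a clifford" and C
    by (simp add: times_clifford_def Cl_inverse)
  show "a * b * c = a * (b * c)"
  proof (rule clifford_eqI)
    fix D
    have "cvec (a * b * c) $ D = (\<Sum>C\<in>UNIV. \<Sum>A\<in>UNIV. reorder_sign C (sym_diff C D) *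
        reorder_sign A (sym_diff A C) * cvec a $ A * cvec b $ sym_diff A C * cvec c $ sym_diff C D)"
      by (simp add: T sum_distrib_left sum_distrib_right mult_ac)
    also have "\<dots> = (\<Sum>A\<in>UNIV. \<Sum>C\<in>UNIV. reorder_sign C (sym_diff C D) *
        reorder_sign A (sym_diff A C) * cvec a $ A * cvec b $ sym_diff A C * cvec c $ sym_diff C D)"
      by (rule sum.swap)
    also have "\<dots> = (\<Sum>A\<in>UNIV. \<Sum>B\<in>UNIV. reorder_sign A (sym_diff A D) *
        reorder_sign B (sym_diff B (sym_diff A D)) * cvec a $ A * cvec b $ B *
        cvec c $ sym_diff B (sym_diff A D))"
    proof (rule sum.cong[OF refl])
      fix A :: "'a set"
      show "(\<Sum>C\<in>UNIV. reorder_sign C (sym_diff C D) *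
          reorder_sign A (sym_diff A C) * cvec a $ A * cvec b $ sym_diff A C * cvec c $ sym_diff C D) =
        (\<Sum>B\<in>UNIV. reorder_sign A (sym_diff A D) *
          reorder_sign B (sym_diff B (sym_diff A D)) * cvec a $ A * cvec b $ B *
          cvec c $ sym_diff B (sym_diff A D))"
      proof (rule sum.reindex_bij_witness[of _ "sym_diff A" "sym_diff A"])
        fix C
        have *: "sym_diff (sym_diff A C) (sym_diff A D) = sym_diff C D" by auto
        have "reorder_sign C E * reorder_sign A (sym_diff A C) =
            reorder_sign A (sym_diff A (sym_diff C E)) * reorder_sign (sym_diff A C) E" for E
          using reorder_sign_square[of A A] reorder_sign_square[of A E]
          by (simp add: reorder_sign_left reorder_sign_right mult_ac)
        from this[of "sym_diff C D"]
        show "reorder_sign A (sym_diff A D) *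
            reorder_sign (sym_diff A C) (sym_diff (sym_diff A C) (sym_diff A D)) * cvec a $ A *
            cvec b $ sym_diff A C * cvec c $ sym_diff (sym_diff A C) (sym_diff A D) =
          reorder_sign C (sym_diff C D) *
            reorder_sign A (sym_diff A C) * cvec a $ A * cvec b $ sym_diff A C * cvec c $ sym_diff C D"
          unfolding * by (simp add: mult_ac)
      qed simp_all
    qed
    also have "\<dots> = cvec (a * (b * c)) $ D"
      by (simp add: T sum_distrib_left sum_distrib_right mult_ac)
    finally show "cvec (a * b * c) $ D = cvec (a * (b * c)) $ D" .
  qed
  have O: "cvec (1 :: 'a clifford) $ A = (if A = {} then 1 else 0)" for A
    by (simp add: one_clifford_def Cl_inverse)
  have E: "reorder_sign {} C = 1" "reorder_sign C {} = 1" for C :: "'a set"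
    by (simp_all add: reorder_sign_def)
  show "1 * a = a"
  proof (rule clifford_eqI)
    fix C
    have "cvec (1 * a) $ C = (\<Sum>A\<in>(UNIV :: 'a set set). if A = {} then cvec a $ C else 0)"
      unfolding T O by (rule sum.cong) (auto simp: E)
    then show "cvec (1 * a) $ C = cvec a $ C" by simp
  qed
  show "a * 1 = a"
  proof (rule clifford_eqI)
    fix C
    have "cvec (a * 1) $ C = (\<Sum>A\<in>UNIV. if A = C then cvec a $ C else 0)"
      unfolding T O by (rule sum.cong) (auto simp: E)
    then show "cvec (a * 1) $ C = cvec a $ C" by simp
  qed
  show "(a + b) * c = a * c + b * c" "a * (b + c) = a * b + a * c"
    by (rule clifford_eqI; simp add: T plus_clifford.rep_eq algebra_simps sum.distrib)+
  show "(r *\<^sub>R a) * b = r *\<^sub>R (a * b)" "a * (r *\<^sub>R b) = r *\<^sub>R (a * b)"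
    by (rule clifford_eqI; simp add: T scaleR_clifford.rep_eq sum_distrib_left mult_ac)+
  show "(0 :: 'a clifford) \<noteq> 1"
    using O[of "{}"] by (metis zero_clifford.rep_eq zero_index zero_neq_one)
qed
end

definition gen :: "'n::{finite,linorder} \<Rightarrow> 'n clifford" where
  "gen i = Cl (axis {i} 1)"

lemma clifford_relations:
  fixes i j :: "'n::{finite,linorder}"
  shows "gen i * gen j + gen j * gen i = (if i = j then -2 else 0)"
proof -
  have P: "gen i * gen j = reorder_sign {i} {j} *\<^sub>R Cl (axis (sym_diff {i} {j}) 1)" for i j :: 'n
  proof (rule clifford_eqI)
    fix C
    have "cvec (gen i * gen j) $ C = (\<Sum>A\<in>UNIV. if A = {i} then
        (if sym_diff {i} C = {j} then reorder_sign {i} {j} else 0) else 0)"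
      unfolding times_clifford_def gen_def axis_def
      unfolding Cl_inverse[OF UNIV_I] vec_lambda_beta
    proof (rule sum.cong[OF refl])
      fix A
      show "reorder_sign A (sym_diff A C) * (if A = {i} then 1 else 0) *
          (if sym_diff A C = {j} then 1 else 0) =
        (if A = {i} then if sym_diff {i} C = {j} then reorder_sign {i} {j} else 0 else 0)"
      proof (cases "A = {i}")
        case True
        show ?thesis unfolding True
          by (cases "sym_diff {i} C = {j}")
            (simp_all only: if_True if_False simp_thms mult_1_right mult_zero_right)
      qed (simp only: if_False mult_zero_right mult_zero_left)
    qed
    also have "\<dots> = (if sym_diff {i} C = {j} then reorder_sign {i} {j} else 0)"
      by (simp only: sum.delta finite_class.finite UNIV_I if_True)
    also have "\<dots> = (if C = sym_diff {i} {j} then reorder_sign {i} {j} else 0)"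
      by (rule if_cong) (blast, simp_all only:)
    also have "\<dots> = cvec (reorder_sign {i} {j} *\<^sub>R Cl (axis (sym_diff {i} {j}) 1)) $ C"
      unfolding scaleR_clifford.rep_eq Cl_inverse[OF UNIV_I] vector_scaleR_component axis_def
        vec_lambda_beta
      by (cases "C = sym_diff {i} {j}")
        (simp_all only: if_True if_False simp_thms real_scaleR_def mult_1_right mult_zero_right)
    finally show "cvec (gen i * gen j) $ C =
        cvec (reorder_sign {i} {j} *\<^sub>R Cl (axis (sym_diff {i} {j}) 1)) $ C"
      by (simp add: scaleR_clifford.rep_eq Cl_inverse axis_def)
  qed
  have one: "Cl (axis {} 1) = (1 :: 'n clifford)"
    unfolding one_clifford_def axis_def by (simp only:)
  show ?thesis
    by (cases i j rule: linorder_cases)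
      (auto simp: P one reorder_sign_def insert_commute)
qed

text \<open>The two-sided inverse; unspecified for non-invertible elements.\<close>

definition cl_inverse :: "'n::{finite,linorder} clifford \<Rightarrow> 'n clifford" where
  "cl_inverse a = (THE b. a * b = 1 \<and> b * a = 1)"


section \<open>Paravectors and slices\<close>

text \<open>
  A point of \<open>\<real>\<^bsup>n+1\<^esup>\<close> is a pair \<open>(x\<^sub>0, (x\<^sub>1, \<dots>, x\<^sub>n))\<close>.  The sphere \<open>\<S>\<close> of imaginary units is
  \<open>{I :: real ^ 'n. norm I = 1}\<close>, and the plane \<open>\<C>\<^sub>I\<close> is parametrised by \<open>complex\<close> through
  \<open>slice I\<close>, which sends the complex unit to \<open>I\<close>.
\<close>

type_synonym 'n point = "real \<times> (real ^ 'n)"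

definition paravector :: "'n::{finite,linorder} point \<Rightarrow> 'n clifford" where
  "paravector x = of_real (fst x) + (\<Sum>j\<in>UNIV. (snd x $ j) *\<^sub>R gen j)"

abbreviation vector_part :: "real ^ ('n::{finite,linorder}) \<Rightarrow> 'n clifford" where
  "vector_part v \<equiv> paravector (0, v)"

definition conj_point :: "'n::finite point \<Rightarrow> 'n point" where
  "conj_point x = (fst x, - snd x)"

definition slice :: "real ^ ('n::finite) \<Rightarrow> complex \<Rightarrow> 'n point" where
  "slice I z = (Re z, Im z *\<^sub>R I)"

definition sphere_of :: "'n::finite point \<Rightarrow> 'n point set" where
  "sphere_of x = {(fst x, norm (snd x) *\<^sub>R I) | I. norm I = 1}"

definition axially_symmetric :: "'n::finite point set \<Rightarrow> bool" where
  "axially_symmetric U \<longleftrightarrow> (\<forall>x\<in>U. sphere_of x \<subseteq> U)"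

text \<open>
  A finite set \<open>G\<close> of disjoint piecewise continuously differentiable Jordan curves forming the
  boundary of \<open>S\<close>.  Positive orientation of the boundary as a whole (outer curves counterclockwise,
  curves around holes clockwise) is the usual condition on cycles: total winding number \<open>1\<close>
  about the points of \<open>S\<close> and \<open>0\<close> about the exterior points.
\<close>

definition positive_boundary :: "complex set \<Rightarrow> (real \<Rightarrow> complex) set \<Rightarrow> bool" where
  "positive_boundary S G \<longleftrightarrow>
     finite G \<and>
     (\<forall>g\<in>G. valid_path g \<and> simple_path g \<and> pathfinish g = pathstart g) \<and>
     pairwise (\<lambda>g h. path_image g \<inter> path_image h = {}) G \<and>
     (\<Union>g\<in>G. path_image g) = frontier S \<and>
     (\<forall>z\<in>S. (\<Sum>g\<in>G. winding_number g z) = 1) \<and>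
     (\<forall>z. z \<notin> closure S \<longrightarrow> (\<Sum>g\<in>G. winding_number g z) = 0)"

definition slice_Cauchy_domain :: "'n::finite point set \<Rightarrow> bool" where
  "slice_Cauchy_domain U \<longleftrightarrow>
     open U \<and> axially_symmetric U \<and>
     (\<forall>I. norm I = 1 \<longrightarrow> (\<exists>G. positive_boundary (slice I -` U) G))"


section \<open>Slice hyperholomorphic functions\<close>

definition profile :: "'n::finite point set \<Rightarrow> (real \<times> real) set" where
  "profile U = {(u, v). \<forall>I :: real ^ 'n. norm I = 1 \<longrightarrow> (u, v *\<^sub>R I) \<in> U}"

definition directional_derivative ::
    "'a::real_normed_vector \<Rightarrow> ('a \<Rightarrow> 'b::real_normed_vector) \<Rightarrow> 'a \<Rightarrow> 'b" where
  "directional_derivative d f x = vector_derivative (\<lambda>t. f (x + t *\<^sub>R d)) (at 0)"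

definition even_odd_on ::
    "(real \<times> real) set \<Rightarrow> (real \<times> real \<Rightarrow> 'b::real_vector) \<Rightarrow> (real \<times> real \<Rightarrow> 'b) \<Rightarrow> bool" where
  "even_odd_on P a b \<longleftrightarrow> (\<forall>(u, v)\<in>P. a (u, - v) = a (u, v) \<and> b (u, - v) = - b (u, v))"

definition Cauchy_Riemann_on ::
    "(real \<times> real) set \<Rightarrow> (real \<times> real \<Rightarrow> 'b::real_normed_vector) \<Rightarrow> (real \<times> real \<Rightarrow> 'b) \<Rightarrow> bool" where
  "Cauchy_Riemann_on P a b \<longleftrightarrow> (\<forall>p\<in>P.
     a differentiable (at p) \<and> b differentiable (at p) \<and>
     directional_derivative (1, 0) a p = directional_derivative (0, 1) b p \<and>
     directional_derivative (0, 1) a p = - directional_derivative (1, 0) b p)"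

definition left_slice_hyperholomorphic ::
    "'n::{finite,linorder} point set \<Rightarrow> ('n point \<Rightarrow> 'n clifford) \<Rightarrow> bool" where
  "left_slice_hyperholomorphic U f \<longleftrightarrow> (\<exists>a b.
     even_odd_on (profile U) a b \<and> Cauchy_Riemann_on (profile U) a b \<and>
     (\<forall>I u v. norm I = 1 \<longrightarrow> (u, v) \<in> profile U \<longrightarrow>
        f (u, v *\<^sub>R I) = a (u, v) + vector_part I * b (u, v)))"

definition right_slice_hyperholomorphic ::
    "'n::{finite,linorder} point set \<Rightarrow> ('n point \<Rightarrow> 'n clifford) \<Rightarrow> bool" where
  "right_slice_hyperholomorphic U f \<longleftrightarrow> (\<exists>a b.
     even_odd_on (profile U) a b \<and> Cauchy_Riemann_on (profile U) a b \<and>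
     (\<forall>I u v. norm I = 1 \<longrightarrow> (u, v) \<in> profile U \<longrightarrow>
        f (u, v *\<^sub>R I) = a (u, v) + b (u, v) * vector_part I))"


section \<open>Axially holomorphic Cliffordian functions\<close>

text \<open>\<open>Basis\<close> of \<open>\<real> \<times> \<real>\<^sup>n\<close> is the standard basis, so these are the partial derivatives.\<close>

definition laplacian ::
    "('a::euclidean_space \<Rightarrow> 'b::real_normed_vector) \<Rightarrow> 'a \<Rightarrow> 'b" where
  "laplacian f x = (\<Sum>d\<in>Basis. directional_derivative d (directional_derivative d f) x)"

definition dirac_left ::
    "('n point \<Rightarrow> 'n clifford) \<Rightarrow> 'n point \<Rightarrow> 'n::{finite,linorder} clifford" where
  "dirac_left g x = directional_derivative (1, 0) g x +
     (\<Sum>i\<in>UNIV. gen i * directional_derivative (0, axis i 1) g x)"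

definition dirac_right ::
    "('n point \<Rightarrow> 'n clifford) \<Rightarrow> 'n point \<Rightarrow> 'n::{finite,linorder} clifford" where
  "dirac_right g x = directional_derivative (1, 0) g x +
     (\<Sum>i\<in>UNIV. directional_derivative (0, axis i 1) g x * gen i)"

fun class_C :: "nat \<Rightarrow> 'a::euclidean_space set \<Rightarrow> ('a \<Rightarrow> 'b::real_normed_vector) \<Rightarrow> bool" where
  "class_C 0 U g \<longleftrightarrow> continuous_on U g"
| "class_C (Suc m) U g \<longleftrightarrow> (\<forall>x\<in>U. g differentiable (at x)) \<and>
     (\<forall>d\<in>Basis. class_C m U (directional_derivative d g))"

text \<open>
  On the real axis the quotient \<open>x / |x|\<close> of the vector part evaluates to \<open>0\<close> here; this is
  harmless because an odd \<open>B\<close> vanishes there.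
\<close>

definition left_axially_holomorphic_Cliffordian ::
    "nat \<Rightarrow> 'n::{finite,linorder} point set \<Rightarrow> ('n point \<Rightarrow> 'n clifford) \<Rightarrow> bool" where
  "left_axially_holomorphic_Cliffordian k U g \<longleftrightarrow>
     class_C (2 * k + 1) U g \<and>
     (\<forall>x\<in>U. (laplacian ^^ k) (dirac_left g) x = 0) \<and>
     (\<exists>A B. even_odd_on (profile U) A B \<and>
       (\<forall>x\<in>U. g x = A (fst x, norm (snd x)) +
          vector_part (snd x /\<^sub>R norm (snd x)) * B (fst x, norm (snd x))))"

definition right_axially_holomorphic_Cliffordian ::
    "nat \<Rightarrow> 'n::{finite,linorder} point set \<Rightarrow> ('n point \<Rightarrow> 'n clifford) \<Rightarrow> bool" where
  "right_axially_holomorphic_Cliffordian k U g \<longleftrightarrow>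
     class_C (2 * k + 1) U g \<and>
     (\<forall>x\<in>U. (laplacian ^^ k) (dirac_right g) x = 0) \<and>
     (\<exists>A B. even_odd_on (profile U) A B \<and>
       (\<forall>x\<in>U. g x = A (fst x, norm (snd x)) +
          B (fst x, norm (snd x)) * vector_part (snd x /\<^sub>R norm (snd x))))"


section \<open>Kernels and integrals\<close>

definition sce_exponent :: "'n itself \<Rightarrow> nat" where
  "sce_exponent _ = (CARD('n) - 1) div 2"

definition kernel_const :: "nat \<Rightarrow> nat \<Rightarrow> real" where
  "kernel_const h \<alpha> = 4 ^ \<alpha> * fact \<alpha> * pochhammer (- real h) \<alpha>"

lemma pochhammer_minus_fact:
  assumes "\<alpha> \<le> h"
  shows "pochhammer (- real h) \<alpha> = (-1) ^ \<alpha> * (fact h / fact (h - \<alpha>))"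
proof -
  have "pochhammer (- real h) \<alpha> * fact (h - \<alpha>) = (-1) ^ \<alpha> * fact h"
    using assms
  proof (induction \<alpha>)
    case (Suc a)
    then obtain d where d: "h = Suc a + d" using le_Suc_ex by blast
    have "pochhammer (- real h) (Suc a) * fact (h - Suc a) =
        - (pochhammer (- real h) a * fact (h - a))"
      by (simp add: d pochhammer_Suc algebra_simps)
    then show ?case using Suc by simp
  qed simp
  then show ?thesis by (simp add: field_simps)
qed

definition Q_c :: "'n::{finite,linorder} point \<Rightarrow> 'n point \<Rightarrow> 'n clifford" where
  "Q_c s x = (paravector s)\<^sup>2 - (2 * fst x) *\<^sub>R paravector s + of_real ((norm x)\<^sup>2)"

definition kernel_left :: "nat \<Rightarrow> 'n::{finite,linorder} point \<Rightarrow> 'n point \<Rightarrow> 'n clifford" where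
  "kernel_left \<alpha> s x = kernel_const (sce_exponent TYPE('n)) \<alpha> *\<^sub>R
     ((paravector s - paravector (conj_point x)) * cl_inverse (Q_c s x) ^ (\<alpha> + 1))"

definition kernel_right :: "nat \<Rightarrow> 'n::{finite,linorder} point \<Rightarrow> 'n point \<Rightarrow> 'n clifford" where
  "kernel_right \<alpha> s x = kernel_const (sce_exponent TYPE('n)) \<alpha> *\<^sub>R
     (cl_inverse (Q_c s x) ^ (\<alpha> + 1) * (paravector s - paravector (conj_point x)))"

text \<open>\<open>ds_I I g t\<close> is the coefficient of \<open>dt\<close> in \<open>ds\<^sub>I = ds (-I)\<close> along the curve \<open>s = slice I (g t)\<close>.\<close>

definition ds_I :: "real ^ ('n::{finite,linorder}) \<Rightarrow> (real \<Rightarrow> complex) \<Rightarrow> real \<Rightarrow> 'n clifford" where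
  "ds_I I g t = paravector (slice I (vector_derivative g (at t within {0..1}))) * (- vector_part I)"

definition left_integral ::
    "nat \<Rightarrow> real ^ ('n::{finite,linorder}) \<Rightarrow> (real \<Rightarrow> complex) set \<Rightarrow>
      ('n point \<Rightarrow> 'n clifford) \<Rightarrow> 'n point \<Rightarrow> 'n clifford" where
  "left_integral \<alpha> I G f x = (\<Sum>g\<in>G. integral {0..1}
     (\<lambda>t. kernel_left \<alpha> (slice I (g t)) x * ds_I I g t * f (slice I (g t))))"

definition right_integral ::
    "nat \<Rightarrow> real ^ ('n::{finite,linorder}) \<Rightarrow> (real \<Rightarrow> complex) set \<Rightarrow>
      ('n point \<Rightarrow> 'n clifford) \<Rightarrow> 'n point \<Rightarrow> 'n clifford" where
  "right_integral \<alpha> I G f x = (\<Sum>g\<in>G. integral {0..1}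
     (\<lambda>t. f (slice I (g t)) * ds_I I g t * kernel_right \<alpha> (slice I (g t)) x))"

end

theory Submission
  imports Defs "HOL-Complex_Analysis.Cauchy_Integral_Formula"
begin

text \<open>
  With respect to the standard basis \<open>e\<close> of the Clifford algebra, \<open>a + I b\<close> splits into scalar
  holomorphic functions \<open>\<phi>\<^sub>e\<close> with \<open>\<phi>\<^sub>e(cnj z) = cnj \<phi>\<^sub>e(z)\<close>.  Cauchy's formula for a cycle about
  \<open>x\<^sub>0 \<plusminus> i|\<^bold>x|\<close> (\<open>\<^bold>x\<close> the vector part) writes \<open>2\<pi> f(x)\<close> as a sum of terms \<open>P J\<^sub>1 + \<^bold>x P H\<^sub>1\<close>, where
  \<open>P w = (-I w) e\<close> and, with \<open>Q = (s - x\<^sub>0)\<^sup>2 + |\<^bold>x|\<^sup>2\<close>,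
  \<open>H\<^sub>k = \<integral> \<phi>\<^sub>e Q\<^bsup>-k\<^esup> ds\<close> and \<open>J\<^sub>k = \<integral> \<phi>\<^sub>e (s - x\<^sub>0) Q\<^bsup>-k\<^esup> ds\<close>.  The system
  \<open>\<partial>\<^sub>0 H\<^sub>k = 2k J\<^bsub>k+1\<^esub>\<close>, \<open>\<partial>\<^sub>j H\<^sub>k = -2k x\<^sub>j H\<^bsub>k+1\<^esub>\<close>,
  \<open>\<partial>\<^sub>0 J\<^sub>k = (2k-1) H\<^sub>k - 2k |\<^bold>x|\<^sup>2 H\<^bsub>k+1\<^esub>\<close>, \<open>\<partial>\<^sub>j J\<^sub>k = -2k x\<^sub>j J\<^bsub>k+1\<^esub>\<close>
  gives smoothness, shows that \<open>\<Delta>\<close> multiplies \<open>P J\<^sub>k + \<^bold>x P H\<^sub>k\<close> by \<open>2k(2k-1-n)\<close> and raises \<open>k\<close> by one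
  (whence \<open>k\<^sub>\<alpha>\<close>), that \<open>D\<close> maps it to a multiple of \<open>P H\<^sub>k\<close>, and that \<open>\<Delta> H\<^sub>k = 2k(2k+1-n) H\<^bsub>k+1\<^esub>\<close>,
  a factor that vanishes at \<open>k = h\<^sub>n\<close>.  The left and right cases differ only by the order of multiplication.
\<close>

section \<open>Cauchy's theorem for cycles\<close>

text \<open>A slice of \<open>U\<close> may be disconnected and its boundary may have several
  curves, so Cauchy's formula is needed for a finite set of loops with prescribed total winding
  numbers. The formula enters only at \<open>k = 1\<close>, through the partial fractions of
  \<open>(s - x_0) / Q\<close> and \<open>|x| / Q\<close> at the zeros of \<open>Q\<close>. The
  symmetry of the components makes both integrals real multiples of \<open>2 pi i\<close>, and the
  factor \<open>-I\<close> of \<open>ds_I\<close> turns these into real multiples of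
  \<open>e\<close>. So \<open>I\<close> disappears, although \<open>x\<close> need not lie in the
  plane of \<open>I\<close>. Only differentiability of \<open>a\<close> and \<open>b\<close> is
  assumed, so all higher regularity of \<open>f\<close> is read off from the integrals. The same
  computation is used with two kinds of cycles: the boundary of a slice of \<open>U\<close> gives
  the integral formula; small circles about the points of a sphere in one slice give smoothness, the
  differential equation and the axial form on all of \<open>V\<close>, of which \<open>U\<close>
  covers in general only a part. Independence of \<open>U\<close>, of \<open>I\<close> and of the
  kernel then needs no deformation of curves: each integral equals \<open>2 pi\<close> times a power
  of the Laplacian of \<open>f\<close>.\<close>

lemma closed_paths_joinable:
  assumes "open C" "connected C" "finite G" "G \<noteq> {}"
    and "\<And>g. g \<in> G \<Longrightarrow> valid_path g \<and> pathfinish g = pathstart g \<and> path_image g \<subseteq> C"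
  shows "\<exists>\<gamma>. valid_path \<gamma> \<and> pathfinish \<gamma> = pathstart \<gamma> \<and> path_image \<gamma> \<subseteq> C \<and>
    (\<forall>f. f holomorphic_on C \<longrightarrow> contour_integral \<gamma> f = (\<Sum>g\<in>G. contour_integral g f))"
  using assms(3,4,5)
proof (induction G rule: finite_ne_induct)
  case (singleton g)
  then show ?case by (intro exI[of _ g]) auto
next
  case (insert g F)
  then obtain \<gamma> where \<gamma>: "valid_path \<gamma>" "pathfinish \<gamma> = pathstart \<gamma>" "path_image \<gamma> \<subseteq> C"
    "\<And>f. f holomorphic_on C \<Longrightarrow> contour_integral \<gamma> f = (\<Sum>g\<in>F. contour_integral g f)"
    by (metis insertCI)
  have g: "valid_path g" "pathfinish g = pathstart g" "path_image g \<subseteq> C"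
    using insert.prems by auto
  have "pathstart \<gamma> \<in> C" "pathstart g \<in> C" using \<gamma> g by blast+
  then obtain p where p: "polynomial_function p" "path_image p \<subseteq> C"
      "pathstart p = pathstart \<gamma>" "pathfinish p = pathstart g"
    using connected_open_polynomial_connected[OF \<open>open C\<close> \<open>connected C\<close>] by metis
  have vp: "valid_path p" using p valid_path_polynomial_function by blast
  \<comment> \<open>The connecting path \<open>p\<close> is run forth and back, so it contributes
    nothing to the integral of a function holomorphic on \<open>C\<close>.\<close>
  let ?\<gamma> = "\<gamma> +++ (p +++ (g +++ reversepath p))"
  have int: "f contour_integrable_on q" if "f holomorphic_on C" "valid_path q" "path_image q \<subseteq> C" for f q
    using contour_integrable_holomorphic_simple that \<open>open C\<close> by blast
  have "contour_integral ?\<gamma> f = (\<Sum>g\<in>insert g F. contour_integral g f)" if f: "f holomorphic_on C" for f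
    using insert.hyps \<gamma> g p vp f int[OF f, of p] int[OF f, of g] int[OF f, of \<gamma>]
    by (simp add: contour_integrable_reversepath contour_integral_reversepath)
  moreover have "valid_path ?\<gamma>" "pathfinish ?\<gamma> = pathstart ?\<gamma>" "path_image ?\<gamma> \<subseteq> C"
    using \<gamma> g p vp by (auto simp: path_image_join)
  ultimately show ?case by blast
qed

definition cycle_integral :: "(real \<Rightarrow> complex) set \<Rightarrow> (complex \<Rightarrow> complex) \<Rightarrow> complex" where
  "cycle_integral G f = (\<Sum>g\<in>G. contour_integral g f)"

definition cycle_in :: "complex set \<Rightarrow> (real \<Rightarrow> complex) set \<Rightarrow> bool" where
  "cycle_in \<Omega> G \<longleftrightarrow> finite G \<and>
    (\<forall>g\<in>G. valid_path g \<and> pathfinish g = pathstart g \<and> path_image g \<subseteq> \<Omega>)"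

lemma winding_sum_locally_constant:
  assumes "finite G" "\<And>g. g \<in> G \<Longrightarrow> path g \<and> pathfinish g = pathstart g \<and> z \<notin> path_image g"
  shows "\<forall>\<^sub>F w in nhds z. (\<Sum>g\<in>G. winding_number g w) = (\<Sum>g\<in>G. winding_number g z)"
proof -
  have "\<forall>\<^sub>F w in nhds z. winding_number g w = winding_number g z" if "g \<in> G" for g
  proof -
    have "open {w. w \<notin> path_image g \<and> winding_number g w = winding_number g z}"
      using assms that by (intro open_winding_number_levelsets) auto
    moreover have "z \<in> {w. w \<notin> path_image g \<and> winding_number g w = winding_number g z}"
      using assms(2)[OF that] by simp
    ultimately have "\<forall>\<^sub>F w in nhds z. w \<in> {w. w \<notin> path_image g \<and> winding_number g w = winding_number g z}"
      by (rule eventually_nhds_in_open)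
    then show ?thesis
      by eventually_elim simp
  qed
  then have "\<forall>\<^sub>F w in nhds z. \<forall>g\<in>G. winding_number g w = winding_number g z"
    using \<open>finite G\<close> by (simp add: eventually_ball_finite)
  then show ?thesis
    by eventually_elim simp
qed

text \<open>
  Off the component \<open>C\<close> the winding number of the loops in \<open>C\<close>, and on \<open>C\<close> minus that of
  the other loops, together form a locally constant function on the plane: at boundary points of
  \<open>C\<close>, which lie outside \<open>\<Omega>\<close>, the two add up to zero.
\<close>

lemma winding_sum_component:
  assumes "open \<Omega>" "cycle_in \<Omega> G" "C \<in> components \<Omega>"
    and zero: "\<And>z. z \<notin> \<Omega> \<Longrightarrow> (\<Sum>g\<in>G. winding_number g z) = 0"
    and "w \<notin> C"
  shows "(\<Sum>g\<in>{g\<in>G. path_image g \<subseteq> C}. winding_number g w) = 0"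
proof -
  define G1 where "G1 = {g\<in>G. path_image g \<subseteq> C}"
  define G2 where "G2 = G - G1"
  have fin: "finite G" "finite G1" "finite G2" and GU: "G = G1 \<union> G2" "G1 \<inter> G2 = {}"
    using assms(2) by (auto simp: cycle_in_def G1_def G2_def)
  have C: "open C" "C \<subseteq> \<Omega>" "connected C"
    using assms(1,3) open_components in_components_subset in_components_connected by blast+
  have loops: "path g \<and> pathfinish g = pathstart g \<and> path_image g \<subseteq> \<Omega>" if "g \<in> G" for g
    using assms(2) that valid_path_imp_path by (auto simp: cycle_in_def)
  have G2: "path_image g \<inter> C = {}" if "g \<in> G2" for g
  proof (rule ccontr)
    assume "path_image g \<inter> C \<noteq> {}"
    moreover have "connected (path_image g)" "path_image g \<subseteq> \<Omega>"
      using loops that by (auto simp: G2_def intro: connected_path_image)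
    ultimately have "path_image g \<subseteq> C"
      using components_maximal[OF assms(3)] by blast
    then show False using that by (auto simp: G1_def G2_def)
  qed
  define n1 where "n1 z = (\<Sum>g\<in>G1. winding_number g z)" for z
  define n2 where "n2 z = (\<Sum>g\<in>G2. winding_number g z)" for z
  have n12: "n1 z + n2 z = (\<Sum>g\<in>G. winding_number g z)" for z
    unfolding n1_def n2_def GU(1) using fin GU(2) by (simp add: sum.union_disjoint)
  have ev1: "\<forall>\<^sub>F w in nhds z. n1 w = n1 z" if "z \<notin> C" for z
    unfolding n1_def using that fin loops
    by (intro winding_sum_locally_constant) (auto simp: G1_def)
  have ev2: "\<forall>\<^sub>F w in nhds z. n2 w = n2 z" if "z \<in> C \<or> z \<notin> \<Omega>" for z
    unfolding n2_def using that fin loops G2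
    by (intro winding_sum_locally_constant) (auto simp: G2_def)
  define m where "m z = (if z \<in> C then - n2 z else n1 z)" for z
  have ev: "\<forall>\<^sub>F w in nhds z. m w = m z" for z
  proof (cases "z \<in> C")
    case True
    then have "\<forall>\<^sub>F w in nhds z. w \<in> C" using C by (intro eventually_nhds_in_open) auto
    moreover have "\<forall>\<^sub>F w in nhds z. n2 w = n2 z" using ev2 True by blast
    ultimately show ?thesis
      by eventually_elim (use True in \<open>simp add: m_def\<close>)
  next
    case False
    show ?thesis
    proof (cases "z \<in> \<Omega>")
      case True
      \<comment> \<open>A different component of \<open>\<Omega>\<close> is an open neighbourhood of
        \<open>z\<close> that misses \<open>C\<close>, so \<open>m\<close> is \<open>n1\<close> near
        \<open>z\<close>.\<close>
      let ?D = "connected_component_set \<Omega> z"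
      have D: "open ?D" "z \<in> ?D" "?D \<in> components \<Omega>"
        using True \<open>open \<Omega>\<close> by (auto simp: open_connected_component componentsI)
      then have "?D \<inter> C = {}"
        using assms(3) False components_nonoverlap by blast
      then have "\<forall>\<^sub>F w in nhds z. w \<notin> C"
        using eventually_nhds_in_open[OF D(1,2)] by (auto elim!: eventually_mono)
      with ev1[OF False] show ?thesis
        by eventually_elim (use False in \<open>simp add: m_def\<close>)
    next
      case zO: False
      have "n1 z = - n2 z" using n12[of z] zero[OF zO] by (simp add: eq_neg_iff_add_eq_0)
      have "\<forall>\<^sub>F w in nhds z. n2 w = n2 z" using ev2 zO by blast
      with ev1[OF False] show ?thesis
        by eventually_elim (use False \<open>n1 z = - n2 z\<close> in \<open>auto simp only: m_def if_False minus_minus split: if_split\<close>)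
    qed
  qed
  have "m constant_on UNIV"
  proof (rule locally_constant_imp_constant[OF connected_UNIV])
    fix z :: complex
    from ev[of z] obtain S where "open S" "z \<in> S" "\<forall>w\<in>S. m w = m z"
      unfolding eventually_nhds by (elim exE conjE)
    then show "\<exists>T. openin (top_of_set UNIV) T \<and> z \<in> T \<and> (\<forall>w\<in>T. m w = m z)"
      by (metis open_openin subtopology_UNIV)
  qed
  then have c: "m z = m w" for z w unfolding constant_on_def by (metis UNIV_I)
  have "bounded (\<Union>g\<in>G. path_image g)"
    using fin loops by (auto intro!: bounded_UN simp: bounded_path_image)
  then obtain B where B: "B > 0" "(\<Union>g\<in>G. path_image g) \<subseteq> cball 0 B"
    unfolding bounded_pos by (metis mem_cball_0 subsetI)
  \<comment> \<open>Far from all curves every winding number vanishes, which fixes the constant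
    value of \<open>m\<close> as zero whether or not \<open>z0\<close> lies in
    \<open>C\<close>.\<close>
  define z0 where "z0 = complex_of_real (B + 1)"
  have "winding_number g z0 = 0" if "g \<in> G" for g
    using loops[OF that] B that by (intro winding_number_zero_outside[of _ "cball 0 B"]) (auto simp: z0_def)
  then have "m z0 = 0" by (simp add: m_def n1_def n2_def G1_def G2_def)
  then have "m w = 0" using c[of w z0] by simp
  then show ?thesis using assms(5) by (simp add: m_def n1_def G1_def)
qed

text \<open>Loops in different components of \<open>\<Omega>\<close> cannot be joined inside
  \<open>\<Omega>\<close>, so components are treated one at a time: the loops in the component of a
  chosen one are merged into a single closed path, \<open>winding_sum_component\<close> shows that
  its winding numbers vanish off that component, and \<open>Cauchy_theorem_global\<close> applies.
  Induction on the number of loops disposes of the rest.\<close>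

theorem Cauchy_theorem_cycle:
  assumes "open \<Omega>" "f holomorphic_on \<Omega>" "cycle_in \<Omega> G"
    and "\<And>z. z \<notin> \<Omega> \<Longrightarrow> (\<Sum>g\<in>G. winding_number g z) = 0"
  shows "cycle_integral G f = 0"
  using assms(3,4)
proof (induction "card G" arbitrary: G rule: less_induct)
  case less
  have fin: "finite G" using less.prems by (simp add: cycle_in_def)
  show ?case
  proof (cases "G = {}")
    case True
    then show ?thesis by (simp add: cycle_integral_def)
  next
    case False
    then obtain g0 where g0: "g0 \<in> G" by blast
    define C where "C = connected_component_set \<Omega> (pathstart g0)"
    have g0': "path g0" "path_image g0 \<subseteq> \<Omega>" "pathstart g0 \<in> \<Omega>"
      using less.prems(1) g0 valid_path_imp_path by (auto simp: cycle_in_def)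
    then have C: "C \<in> components \<Omega>" unfolding C_def by (simp add: componentsI)
    have C': "open C" "C \<subseteq> \<Omega>" "connected C"
      using C assms(1) open_components in_components_subset in_components_connected by blast+
    have "path_image g0 \<subseteq> C"
      unfolding C_def using g0' by (intro connected_component_maximal) (auto intro: connected_path_image)
    define G1 where "G1 = {g\<in>G. path_image g \<subseteq> C}"
    have G1: "G1 \<noteq> {}" "finite G1" "G1 \<subseteq> G" and valid: "\<And>g. g \<in> G1 \<Longrightarrow> valid_path g \<and> pathfinish g = pathstart g \<and> path_image g \<subseteq> C"
      using g0 \<open>path_image g0 \<subseteq> C\<close> fin less.prems(1) by (auto simp: G1_def cycle_in_def)
    obtain \<gamma> where \<gamma>: "valid_path \<gamma>" "pathfinish \<gamma> = pathstart \<gamma>" "path_image \<gamma> \<subseteq> C"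
      "\<And>f. f holomorphic_on C \<Longrightarrow> contour_integral \<gamma> f = (\<Sum>g\<in>G1. contour_integral g f)"
      using closed_paths_joinable[OF C'(1,3) G1(2,1) valid] by blast
    have sum0: "(\<Sum>g\<in>G1. winding_number g w) = 0" if "w \<notin> C" for w
      unfolding G1_def by (rule winding_sum_component[OF assms(1) less.prems(1) C less.prems(2) that])
    have "winding_number \<gamma> w = 0" if w: "w \<notin> C" for w
    proof -
      have hol: "(\<lambda>z. 1 / (z - w)) holomorphic_on C" using w by (auto intro!: holomorphic_intros)
      have "winding_number \<gamma> w = 1 / (2 * pi * \<i>) * contour_integral \<gamma> (\<lambda>z. 1 / (z - w))"
        using \<gamma> w by (intro winding_number_valid_path) auto
      also have "\<dots> = (\<Sum>g\<in>G1. 1 / (2 * pi * \<i>) * contour_integral g (\<lambda>z. 1 / (z - w)))"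
        using \<gamma>(4)[OF hol] by (simp add: sum_distrib_left)
      also have "\<dots> = (\<Sum>g\<in>G1. winding_number g w)"
        using valid w by (intro sum.cong refl winding_number_valid_path[symmetric]) auto
      finally show ?thesis using sum0[OF w] by simp
    qed
    then have "(f has_contour_integral 0) \<gamma>"
      using \<gamma> C' assms(2) by (intro Cauchy_theorem_global[of C]) (auto intro: holomorphic_on_subset)
    then have 1: "(\<Sum>g\<in>G1. contour_integral g f) = 0"
      using \<gamma>(4) assms(2) C'(2) contour_integral_unique holomorphic_on_subset by metis
    have "card (G - G1) < card G"
      using G1 fin by (metis Diff_disjoint Diff_subset inf.absorb_iff2 inf_commute psubsetI psubset_card_mono)
    moreover have "cycle_in \<Omega> (G - G1)" using less.prems(1) by (auto simp: cycle_in_def)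
    \<comment> \<open>The removed loops have total winding number zero off \<open>C\<close>, so the
      remaining family inherits the hypothesis.\<close>
    moreover have "(\<Sum>g\<in>G - G1. winding_number g z) = 0" if "z \<notin> \<Omega>" for z
    proof -
      have "z \<notin> C" using that C'(2) by blast
      then show ?thesis
        using sum0[of z] less.prems(2)[OF that] fin G1 by (simp add: sum_diff)
    qed
    ultimately have "cycle_integral (G - G1) f = 0" using less.hyps by blast
    with 1 show ?thesis
      using sum.subset_diff[OF G1(3) fin, of "\<lambda>g. contour_integral g f"] by (simp add: cycle_integral_def)
  qed
qed

text \<open>The difference quotient \<open>d\<close> of \<open>f\<close> at \<open>z\<close>,
  completed by \<open>deriv f z\<close>, is holomorphic, so its integral over the cycle vanishes;
  what remains of \<open>f w / (w - z)\<close> is the constant \<open>f z\<close> times the kernel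
  of the winding number.\<close>

theorem Cauchy_integral_formula_cycle:
  assumes "open \<Omega>" "f holomorphic_on \<Omega>" "cycle_in \<Omega> G"
    and zero: "\<And>z. z \<notin> \<Omega> \<Longrightarrow> (\<Sum>g\<in>G. winding_number g z) = 0"
    and z: "z \<in> \<Omega>" "\<And>g. g \<in> G \<Longrightarrow> z \<notin> path_image g"
  shows "cycle_integral G (\<lambda>w. f w / (w - z)) = 2 * pi * \<i> * (\<Sum>g\<in>G. winding_number g z) * f z"
proof -
  define d where "d w = (if w = z then deriv f z else (f w - f z) / (w - z))" for w
  have hol: "d holomorphic_on \<Omega>"
    unfolding d_def using pole_lemma_open[OF assms(2,1), of z] by simp
  have 0: "cycle_integral G d = 0"
    by (rule Cauchy_theorem_cycle[OF assms(1) hol assms(3) zero])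
  have "contour_integral g (\<lambda>w. f w / (w - z)) =
      contour_integral g d + 2 * pi * \<i> * winding_number g z * f z" if g: "g \<in> G" for g
  proof -
    have g': "valid_path g" "path_image g \<subseteq> \<Omega>" "z \<notin> path_image g"
      using g assms(3) z by (auto simp: cycle_in_def)
    have "((\<lambda>w. 1 / (w - z)) has_contour_integral 2 * pi * \<i> * winding_number g z) g"
      by (rule has_contour_integral_winding_number) (use g' in auto)
    from has_contour_integral_rmul[OF this, of "f z"]
    have 1: "((\<lambda>w. f z / (w - z)) has_contour_integral 2 * pi * \<i> * winding_number g z * f z) g"
      by simp
    have "d contour_integrable_on g"
      using contour_integrable_holomorphic_simple[OF hol assms(1)] g' by blast
    then have "(d has_contour_integral contour_integral g d) g"
      by (rule has_contour_integral_integral)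
    from has_contour_integral_add[OF this 1]
    have "((\<lambda>w. f w / (w - z)) has_contour_integral
        contour_integral g d + 2 * pi * \<i> * winding_number g z * f z) g"
      by (rule has_contour_integral_eq) (use g' in \<open>auto simp: d_def diff_divide_distrib\<close>)
    then show ?thesis by (rule contour_integral_unique)
  qed
  then show ?thesis
    using 0 by (simp add: cycle_integral_def sum.distrib sum_distrib_left sum_distrib_right)
qed

section \<open>Cauchy-type integrals with kernel powers of \<open>Q\<^sub>c\<close>\<close>

text \<open>Differentiation under the integral sign. On a compact tube about the path the partial
  derivatives are uniformly continuous, so the linearization error of the integrand is small
  uniformly in \<open>s\<close>. Holomorphy in \<open>s\<close> gives integrability and bounds the
  integral by a constant times the supremum over an open neighbourhood of the path.\<close>

lemma has_derivative_contour_integral: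
  fixes F :: "complex \<Rightarrow> 'a::euclidean_space \<Rightarrow> complex"
  assumes g: "valid_path g" and D: "open D" and x: "\<And>s. s \<in> path_image g \<Longrightarrow> (s, x) \<in> D"
    and holF: "\<And>y. (\<lambda>s. F s y) holomorphic_on {s. (s, y) \<in> D}"
    and holF': "\<And>h. (\<lambda>s. F' s x h) holomorphic_on {s. (s, x) \<in> D}"
    and deriv: "\<And>s y. (s, y) \<in> D \<Longrightarrow> (F s has_derivative F' s y) (at y)"
    and cont: "\<And>b. b \<in> Basis \<Longrightarrow> continuous_on D (\<lambda>(s, y). F' s y b)"
  shows "((\<lambda>y. contour_integral g (\<lambda>s. F s y)) has_derivative
    (\<lambda>h. contour_integral g (\<lambda>s. F' s x h))) (at x)"
proof -
  let ?\<Gamma> = "path_image g"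
  have comp: "compact ?\<Gamma>" using g by (rule compact_valid_path_image)
  have "compact (?\<Gamma> \<times> {x})" "?\<Gamma> \<times> {x} \<subseteq> D"
    using comp x by (auto intro: compact_Times)
  then obtain \<epsilon> where \<epsilon>: "\<epsilon> > 0" "(\<Union>p\<in>?\<Gamma> \<times> {x}. cball p \<epsilon>) \<subseteq> D"
    using compact_subset_open_imp_cball_epsilon_subset[OF _ D] by metis
  \<comment> \<open>Half of \<open>\<epsilon>\<close>, so that moving \<open>s\<close> and
    \<open>x\<close> by at most \<open>r\<close> each stays inside \<open>D\<close>.\<close>
  define r where "r = \<epsilon> / 2"
  have r: "r > 0" using \<epsilon> by (simp add: r_def)
  \<comment> \<open>\<open>S\<close> is open, as the bound on contour integrals requires;
    \<open>T\<close> is a compact set containing it, on which uniform continuity is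
    available.\<close>
  define T where "T = (\<Union>s\<in>?\<Gamma>. \<Union>k\<in>cball 0 r. {s + k})"
  define S where "S = (\<Union>s\<in>?\<Gamma>. ball s r)"
  have "compact T"
    unfolding T_def using compact_sums'[OF comp compact_cball[of 0 r]] by (simp add: UNION_singleton_eq_range image_def Setcompr_eq_image)
  have "open S" "?\<Gamma> \<subseteq> S" using r by (auto simp: S_def)
  have "S \<subseteq> T"
  proof
    fix w assume "w \<in> S"
    then obtain s where s: "s \<in> ?\<Gamma>" "dist s w < r" by (auto simp: S_def)
    then show "w \<in> T"
      unfolding T_def by (intro UN_I[of s] UN_I[of "w - s"]) (auto simp: dist_norm norm_minus_commute)
  qed
  have TD: "T \<times> cball x r \<subseteq> D"
  proof clarify
    fix w y assume "w \<in> T" and y: "y \<in> cball x r"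
    then obtain s k where s: "s \<in> ?\<Gamma>" "norm k \<le> r" "w = s + k" by (auto simp: T_def)
    have "dist (s, x) (w, y) \<le> dist s w + dist x y"
      by (simp add: dist_Pair_Pair sqrt_sum_squares_le_sum)
    also have "\<dots> \<le> \<epsilon>" using s y by (simp add: dist_norm r_def)
    finally show "(w, y) \<in> D" using \<epsilon> s by force
  qed
  have SD: "S \<subseteq> {s. (s, y) \<in> D}" if "y \<in> cball x r" for y
    using TD \<open>S \<subseteq> T\<close> that by blast
  have xr: "x \<in> cball x r" using r by simp
  obtain L where L: "L > 0"
    "\<And>f B. f holomorphic_on S \<Longrightarrow> (\<And>z. z \<in> S \<Longrightarrow> norm (f z) \<le> B) \<Longrightarrow> norm (contour_integral g f) \<le> L * B"
    using contour_integral_bound_exists[OF \<open>open S\<close> g \<open>?\<Gamma> \<subseteq> S\<close>] by blast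
  have int: "f contour_integrable_on g" if "f holomorphic_on S" for f
    using contour_integrable_holomorphic_simple[OF that \<open>open S\<close> g \<open>?\<Gamma> \<subseteq> S\<close>] .
  have holS: "(\<lambda>s. F s y) holomorphic_on S" if "y \<in> cball x r" for y
    using holF SD[OF that] by (rule holomorphic_on_subset)
  have holS': "(\<lambda>s. F' s x h) holomorphic_on S" for h
    using holF' SD[OF xr] by (rule holomorphic_on_subset)
  have lin: "linear (F' s y)" if "(s, y) \<in> D" for s y
    using deriv[OF that] by (rule has_derivative_linear)
  have xD: "(s, x) \<in> D" if "s \<in> S" for s using SD[OF xr] that by blast
  have "linear (\<lambda>h. contour_integral g (\<lambda>s. F' s x h))"
  proof (rule linearI)
    fix h k :: 'a and c :: real
    have "contour_integral g (\<lambda>s. F' s x (h + k)) = contour_integral g (\<lambda>s. F' s x h + F' s x k)"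
      using xD \<open>?\<Gamma> \<subseteq> S\<close> by (intro contour_integral_cong refl) (auto intro!: linear_add lin)
    also have "\<dots> = contour_integral g (\<lambda>s. F' s x h) + contour_integral g (\<lambda>s. F' s x k)"
      by (intro contour_integral_add int holS')
    finally show "contour_integral g (\<lambda>s. F' s x (h + k)) =
      contour_integral g (\<lambda>s. F' s x h) + contour_integral g (\<lambda>s. F' s x k)" .
    have "contour_integral g (\<lambda>s. F' s x (c *\<^sub>R h)) = contour_integral g (\<lambda>s. of_real c * F' s x h)"
      using xD \<open>?\<Gamma> \<subseteq> S\<close>
      by (intro contour_integral_cong refl) (auto simp: linear_cmul[OF lin] scaleR_conv_of_real)
    also have "\<dots> = of_real c * contour_integral g (\<lambda>s. F' s x h)"
      by (intro contour_integral_lmul int holS')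
    finally show "contour_integral g (\<lambda>s. F' s x (c *\<^sub>R h)) = c *\<^sub>R contour_integral g (\<lambda>s. F' s x h)"
      by (simp add: scaleR_conv_of_real)
  qed
  then have bl: "bounded_linear (\<lambda>h. contour_integral g (\<lambda>s. F' s x h))"
    by (simp add: linear_conv_bounded_linear)
  show ?thesis
    unfolding has_derivative_at_alt
  proof (intro conjI bl allI impI)
    fix e :: real assume "e > 0"
    \<comment> \<open>\<open>L\<close> comes from the bound on the contour integral, the dimension
      from estimating a linear map by its values on the basis vectors.\<close>
    define e' where "e' = e / (L * (real DIM('a)))"
    have e': "e' > 0" using \<open>e > 0\<close> L by (simp add: e'_def)
    have "\<exists>d>0. \<forall>s\<in>T. \<forall>y\<in>cball x r. dist y x < d \<longrightarrow> norm (F' s y b - F' s x b) \<le> e'" if b: "b \<in> Basis" for b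
    proof -
      have "uniformly_continuous_on (T \<times> cball x r) (\<lambda>(s, y). F' s y b)"
        using cont[OF b] TD \<open>compact T\<close>
        by (intro compact_uniformly_continuous) (auto intro: continuous_on_subset compact_Times)
      then obtain d where d: "d > 0" "\<And>p q. p \<in> T \<times> cball x r \<Longrightarrow> q \<in> T \<times> cball x r \<Longrightarrow> dist q p < d \<Longrightarrow>
          dist ((\<lambda>(s, y). F' s y b) q) ((\<lambda>(s, y). F' s y b) p) < e'"
        unfolding uniformly_continuous_on_def using e' by metis
      show ?thesis
      proof (intro exI[of _ d] conjI ballI impI d(1))
        fix s y assume "s \<in> T" "y \<in> cball x r" "dist y x < d"
        with d(2)[of "(s, x)" "(s, y)"] xr show "norm (F' s y b - F' s x b) \<le> e'"
          by (simp add: dist_Pair_Pair dist_norm)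
      qed
    qed
    then obtain d where d: "\<And>b. b \<in> Basis \<Longrightarrow> d b > 0"
      "\<And>b s y. b \<in> Basis \<Longrightarrow> s \<in> T \<Longrightarrow> y \<in> cball x r \<Longrightarrow> dist y x < d b \<Longrightarrow> norm (F' s y b - F' s x b) \<le> e'"
      by metis
    define d0 where "d0 = min r (Min (d ` Basis))"
    have d0: "d0 > 0" "d0 \<le> r" "\<And>b. b \<in> Basis \<Longrightarrow> d0 \<le> d b"
      using r d(1) by (auto simp: d0_def intro!: min.coboundedI2)
    show "\<exists>d>0. \<forall>y. norm (y - x) < d \<longrightarrow>
      norm (contour_integral g (\<lambda>s. F s y) - contour_integral g (\<lambda>s. F s x) -
        contour_integral g (\<lambda>s. F' s x (y - x))) \<le> e * norm (y - x)"
    proof (intro exI[of _ d0] conjI allI impI d0(1))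
      fix y assume y: "norm (y - x) < d0"
      have ycb: "y \<in> cball x r" using y d0(2) by (simp add: dist_norm norm_minus_commute)
      have bd: "norm (F s y - F s x - F' s x (y - x)) \<le> norm (y - x) * (real DIM('a) * e')" if s: "s \<in> S" for s
      proof (rule differentiable_bound_linearization[where S = "ball x d0"])
        fix z assume z: "z \<in> ball x d0"
        have zc: "z \<in> cball x r" and sT: "s \<in> T" using z d0(2) s \<open>S \<subseteq> T\<close> by auto
        then have zD: "(s, z) \<in> D" using TD by blast
        show "(F s has_derivative F' s z) (at z within ball x d0)"
          using deriv[OF zD] by (rule has_derivative_at_withinI)
        have "linear (\<lambda>h. F' s z h - F' s x h)"
          by (intro linear_compose_sub lin zD xD s)
        then have lin': "linear (F' s z - F' s x)" by (simp add: fun_diff_def)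
        show "onorm (F' s z - F' s x) \<le> real DIM('a) * e'"
        proof (rule onorm_le)
          fix h
          have "(F' s z - F' s x) h = (F' s z - F' s x) (\<Sum>b\<in>Basis. (h \<bullet> b) *\<^sub>R b)"
            by (simp only: euclidean_representation)
          also have "\<dots> = (\<Sum>b\<in>Basis. (h \<bullet> b) *\<^sub>R (F' s z - F' s x) b)"
            by (simp only: linear_sum[OF lin'] linear_cmul[OF lin'])
          finally have "norm ((F' s z - F' s x) h) = norm (\<Sum>b\<in>Basis. (h \<bullet> b) *\<^sub>R (F' s z - F' s x) b)"
            by (rule arg_cong)
          also have "\<dots> \<le> (\<Sum>b\<in>(Basis::'a set). norm h * e')"
          proof (rule sum_norm_le)
            fix b :: 'a assume b: "b \<in> Basis"
            have "dist z x < d b" using z d0(3)[OF b] by (simp add: dist_commute)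
            then have "norm (F' s z b - F' s x b) \<le> e'" using d(2)[OF b sT zc] by blast
            then show "norm ((h \<bullet> b) *\<^sub>R (F' s z - F' s x) b) \<le> norm h * e'"
              using Basis_le_norm[OF b, of h] by (auto intro!: mult_mono)
          qed
          finally show "norm ((F' s z - F' s x) h) \<le> real DIM('a) * e' * norm h"
            by (simp add: mult_ac)
        qed
      next
        fix t :: real assume "t \<in> {0..1}"
        then have "norm (t *\<^sub>R (y - x)) \<le> norm (y - x)" by (simp add: mult_left_le_one_le)
        then show "x + t *\<^sub>R (y - x) \<in> ball x d0" using y by (simp add: dist_norm)
      qed (use d0 in auto)
      have "contour_integral g (\<lambda>s. F s y) - contour_integral g (\<lambda>s. F s x) -
          contour_integral g (\<lambda>s. F' s x (y - x)) =
        contour_integral g (\<lambda>s. F s y - F s x - F' s x (y - x))"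
        using contour_integral_diff[OF int[OF holS[OF ycb]] int[OF holS[OF xr]]]
          contour_integral_diff[OF contour_integrable_diff[OF int[OF holS[OF ycb]] int[OF holS[OF xr]]] int[OF holS'[of "y - x"]]]
        by simp
      also have "norm \<dots> \<le> L * (norm (y - x) * (real DIM('a) * e'))"
        by (rule L(2)) (auto intro!: holomorphic_intros holS holS' ycb xr bd simp: less_imp_le[OF r])
      also have "\<dots> = e * norm (y - x)" using L by (simp add: e'_def)
      finally show "norm (contour_integral g (\<lambda>s. F s y) - contour_integral g (\<lambda>s. F s x) -
        contour_integral g (\<lambda>s. F' s x (y - x))) \<le> e * norm (y - x)" .
    qed
  qed
qed


section \<open>The integrals \<open>H_k\<close>, \<open>J_k\<close> and their first-order
  system\<close>

definition Q_slice :: "complex \<Rightarrow> 'n::finite point \<Rightarrow> complex" where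
  "Q_slice s x = (s - of_real (fst x))\<^sup>2 + of_real ((norm (snd x))\<^sup>2)"

definition H_int :: "(real \<Rightarrow> complex) set \<Rightarrow> (complex \<Rightarrow> complex) \<Rightarrow> nat \<Rightarrow> 'n::finite point \<Rightarrow> complex" where
  "H_int G \<phi> k x = cycle_integral G (\<lambda>s. \<phi> s / Q_slice s x ^ k)"

definition J_int :: "(real \<Rightarrow> complex) set \<Rightarrow> (complex \<Rightarrow> complex) \<Rightarrow> nat \<Rightarrow> 'n::finite point \<Rightarrow> complex" where
  "J_int G \<phi> k x = cycle_integral G (\<lambda>s. \<phi> s * (s - of_real (fst x)) / Q_slice s x ^ k)"

text \<open>\<open>Q_slice s x\<close> vanishes exactly where \<open>s\<close> belongs to the sphere
  of \<open>x\<close> in the slice plane, so these are the points whose sphere avoids the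
  cycle.\<close>

definition off_cycle :: "(real \<Rightarrow> complex) set \<Rightarrow> 'n::finite point set" where
  "off_cycle G = {x. \<forall>g\<in>G. \<forall>s\<in>path_image g. Q_slice s x \<noteq> 0}"

text \<open>The open set of pairs on which the integrands are jointly regular; it serves as
  \<open>D\<close> in \<open>has_derivative_contour_integral\<close>.\<close>

definition Q_dom :: "complex set \<Rightarrow> (complex \<times> 'n::finite point) set" where
  "Q_dom \<Omega> = {(s, y). s \<in> \<Omega> \<and> Q_slice s y \<noteq> 0}"

lemma Q_slice_has_derivative:
  "(Q_slice s has_derivative (\<lambda>h. of_real (2 * (snd x \<bullet> snd h)) - 2 * (s - of_real (fst x)) * of_real (fst h))) (at x)"
  unfolding Q_slice_def power2_norm_eq_inner
  by (auto intro!: derivative_eq_intros ext simp: inner_commute algebra_simps)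

lemma Q_slice_power_has_derivative:
  assumes "Q_slice s x \<noteq> 0"
  shows "((\<lambda>y. 1 / Q_slice s y ^ k) has_derivative (\<lambda>h. - of_nat k *
    (of_real (2 * (snd x \<bullet> snd h)) - 2 * (s - of_real (fst x)) * of_real (fst h)) / Q_slice s x ^ Suc k)) (at x)"
proof -
  have "((\<lambda>z. 1 / z ^ k) has_field_derivative - of_nat k / Q_slice s x ^ Suc k) (at (Q_slice s x))"
  proof (cases k)
    case (Suc m)
    have "((\<lambda>z. 1 / z ^ Suc m) has_field_derivative
        - (of_nat (Suc m) * Q_slice s x ^ m) / (Q_slice s x ^ Suc m * Q_slice s x ^ Suc m)) (at (Q_slice s x))"
      using assms by (auto intro!: derivative_eq_intros simp del: power_Suc of_nat_Suc)
    moreover have "(of_nat (Suc m) * Q_slice s x ^ m) / (Q_slice s x ^ Suc m * Q_slice s x ^ Suc m) =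
        of_nat k / Q_slice s x ^ Suc k"
      using assms Suc by (simp add: field_simps)
    ultimately show ?thesis
      using Suc by (simp only: minus_divide_left[symmetric])
  qed simp
  then show ?thesis
    using has_derivative_compose[OF Q_slice_has_derivative, of "\<lambda>z. 1 / z ^ k" "(*) (- of_nat k / Q_slice s x ^ Suc k)"]
    by (simp add: has_field_derivative_def mult_ac)
qed

lemma continuous_on_Q_slice: "continuous_on A (\<lambda>p. Q_slice (fst p) (snd p))"
  unfolding Q_slice_def by (intro continuous_intros)

lemma open_Q_dom:
  assumes "open \<Omega>" shows "open (Q_dom \<Omega> :: (complex \<times> 'n::finite point) set)"
proof -
  have "open (fst -` \<Omega> \<inter> (\<lambda>p :: complex \<times> 'n point. Q_slice (fst p) (snd p)) -` (- {0}))"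
    by (intro open_Int open_vimage assms continuous_on_Q_slice continuous_intros)
  also have "fst -` \<Omega> \<inter> (\<lambda>p :: complex \<times> 'n point. Q_slice (fst p) (snd p)) -` (- {0}) = Q_dom \<Omega>"
    by (auto simp: Q_dom_def)
  finally show ?thesis .
qed

lemma holomorphic_on_Q_slice [holomorphic_intros]: "(\<lambda>s. Q_slice s x) holomorphic_on A"
  unfolding Q_slice_def by (intro holomorphic_intros)

text \<open>The derivative of \<open>Q\<close> in a direction \<open>h\<close> is linear in
  \<open>s - x_0\<close>, which turns the integrand of \<open>H_k\<close> into those of
  \<open>J\<close> and \<open>H\<close> at index \<open>k + 1\<close>. In \<open>J_k\<close> it
  produces \<open>(s - x_0)^2\<close>, and writing this as \<open>Q - |x|^2\<close> leads back to
  \<open>H\<close> integrals, so the system closes.\<close>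

lemma
  fixes x :: "'n::finite point"
  assumes \<Omega>: "open \<Omega>" and \<phi>: "\<phi> holomorphic_on \<Omega>" and G: "cycle_in \<Omega> G" and x: "x \<in> off_cycle G"
  shows H_int_has_derivative: "(H_int G \<phi> k has_derivative
      (\<lambda>h. (2 * real k * fst h) *\<^sub>R J_int G \<phi> (Suc k) x -
        (2 * real k * (snd x \<bullet> snd h)) *\<^sub>R H_int G \<phi> (Suc k) x)) (at x)"
    and J_int_has_derivative: "(J_int G \<phi> k has_derivative
      (\<lambda>h. fst h *\<^sub>R ((2 * real k - 1) *\<^sub>R H_int G \<phi> k x -
          (2 * real k * (norm (snd x))\<^sup>2) *\<^sub>R H_int G \<phi> (Suc k) x) -
        (2 * real k * (snd x \<bullet> snd h)) *\<^sub>R J_int G \<phi> (Suc k) x)) (at x)"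
proof -
  let ?Q' = "\<lambda>s y h. of_real (2 * (snd y \<bullet> snd h)) - 2 * (s - of_real (fst y)) * of_real (fst h) :: complex"
  have D: "open (Q_dom \<Omega> :: (complex \<times> 'n point) set)" by (rule open_Q_dom[OF \<Omega>])
  have dom: "{s. (s, y) \<in> Q_dom \<Omega>} = {s\<in>\<Omega>. Q_slice s y \<noteq> 0}" for y :: "'n point"
    by (auto simp: Q_dom_def)
  have \<phi>': "\<phi> holomorphic_on {s\<in>\<Omega>. Q_slice s y \<noteq> 0}" for y :: "'n point"
    using \<phi> by (rule holomorphic_on_subset) auto
  have cont\<phi>: "continuous_on (Q_dom \<Omega> :: (complex \<times> 'n point) set) (\<lambda>p. \<phi> (fst p))"
    by (rule continuous_on_compose2[OF holomorphic_on_imp_continuous_on[OF \<phi>]])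
      (auto intro!: continuous_intros simp: Q_dom_def)
  have ne: "Q_slice (fst p) (snd p) \<noteq> 0" if "p \<in> Q_dom \<Omega>" for p :: "complex \<times> 'n point"
    using that by (auto simp: Q_dom_def)
  have G': "valid_path g" "\<And>s. s \<in> path_image g \<Longrightarrow> (s, x) \<in> Q_dom \<Omega>"
    "\<And>s. s \<in> path_image g \<Longrightarrow> Q_slice s x \<noteq> 0" if "g \<in> G" for g
    using G x that by (auto simp: cycle_in_def off_cycle_def Q_dom_def)
  have oS: "open {s\<in>\<Omega>. Q_slice s x \<noteq> 0}"
  proof -
    have "open (\<Omega> \<inter> (\<lambda>s. Q_slice s x) -` (- {0}))"
      by (intro open_Int open_vimage \<Omega> holomorphic_on_imp_continuous_on holomorphic_on_Q_slice) auto
    then show ?thesis by (simp add: Int_def vimage_def)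
  qed
  have int: "f contour_integrable_on g" if "f holomorphic_on {s\<in>\<Omega>. Q_slice s x \<noteq> 0}" "g \<in> G" for f g
    using contour_integrable_holomorphic_simple[OF that(1) oS] G that(2) x
    by (fastforce simp: cycle_in_def off_cycle_def)
  have intH: "(\<lambda>s. \<phi> s / Q_slice s x ^ k) contour_integrable_on g"
    and intJ: "(\<lambda>s. \<phi> s * (s - of_real (fst x)) / Q_slice s x ^ k) contour_integrable_on g" if "g \<in> G" for g k
    by (rule int[OF _ that]; intro holomorphic_intros \<phi>'; simp)+

  have "((\<lambda>y. contour_integral g (\<lambda>s. \<phi> s / Q_slice s y ^ k)) has_derivative
      (\<lambda>h. contour_integral g (\<lambda>s. - of_nat k * \<phi> s * ?Q' s x h / Q_slice s x ^ Suc k))) (at x)" if g: "g \<in> G" for g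
  proof (rule has_derivative_contour_integral[OF G'(1)[OF g] D G'(2)[OF g]])
    fix s :: complex and y :: "'n point"
    assume sy: "(s, y) \<in> Q_dom \<Omega>"
    show "((\<lambda>y. \<phi> s / Q_slice s y ^ k) has_derivative (\<lambda>h. - of_nat k * \<phi> s * ?Q' s y h / Q_slice s y ^ Suc k)) (at y)"
      using has_derivative_mult_right[OF Q_slice_power_has_derivative[of s y k], of "\<phi> s"] ne[OF sy]
      by (simp add: mult_ac)
  next
    fix b :: "'n point"
    show "continuous_on (Q_dom \<Omega>) (\<lambda>(s, y). - of_nat k * \<phi> s * ?Q' s y b / Q_slice s y ^ Suc k)"
      unfolding split_beta
      by (intro continuous_intros cont\<phi> continuous_on_Q_slice) (use ne in auto)
  qed (simp_all only: dom, (intro holomorphic_intros \<phi>'; simp)+)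
  moreover have "contour_integral g (\<lambda>s. - of_nat k * \<phi> s * ?Q' s x h / Q_slice s x ^ Suc k) =
      (2 * real k * fst h) *\<^sub>R contour_integral g (\<lambda>s. \<phi> s * (s - of_real (fst x)) / Q_slice s x ^ Suc k) -
      (2 * real k * (snd x \<bullet> snd h)) *\<^sub>R contour_integral g (\<lambda>s. \<phi> s / Q_slice s x ^ Suc k)" if g: "g \<in> G" for g h
  proof -
    have "(\<lambda>s. - of_nat k * \<phi> s * ?Q' s x h / Q_slice s x ^ Suc k) =
      (\<lambda>s. of_real (2 * real k * fst h) * (\<phi> s * (s - of_real (fst x)) / Q_slice s x ^ Suc k) -
        of_real (2 * real k * (snd x \<bullet> snd h)) * (\<phi> s / Q_slice s x ^ Suc k))"
      by (simp add: diff_divide_distrib add_divide_distrib algebra_simps)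
    then show ?thesis
      using intH[OF g, of "Suc k"] intJ[OF g, of "Suc k"]
      by (simp only: contour_integral_diff contour_integral_lmul contour_integrable_lmul scaleR_conv_of_real)
  qed
  ultimately have "((\<lambda>y. contour_integral g (\<lambda>s. \<phi> s / Q_slice s y ^ k)) has_derivative
      (\<lambda>h. (2 * real k * fst h) *\<^sub>R contour_integral g (\<lambda>s. \<phi> s * (s - of_real (fst x)) / Q_slice s x ^ Suc k) -
      (2 * real k * (snd x \<bullet> snd h)) *\<^sub>R contour_integral g (\<lambda>s. \<phi> s / Q_slice s x ^ Suc k))) (at x)" if "g \<in> G" for g
    using that by simp
  from has_derivative_sum[OF this, of G id] show "(H_int G \<phi> k has_derivative
      (\<lambda>h. (2 * real k * fst h) *\<^sub>R J_int G \<phi> (Suc k) x -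
        (2 * real k * (snd x \<bullet> snd h)) *\<^sub>R H_int G \<phi> (Suc k) x)) (at x)"
    by (simp add: H_int_def[abs_def] J_int_def cycle_integral_def sum_subtractf scaleR_sum_right)

  have "((\<lambda>y. contour_integral g (\<lambda>s. \<phi> s * (s - of_real (fst y)) / Q_slice s y ^ k)) has_derivative
      (\<lambda>h. contour_integral g (\<lambda>s. - \<phi> s * of_real (fst h) / Q_slice s x ^ k
        - of_nat k * \<phi> s * (s - of_real (fst x)) * ?Q' s x h / Q_slice s x ^ Suc k))) (at x)" if g: "g \<in> G" for g
  proof (rule has_derivative_contour_integral[OF G'(1)[OF g] D G'(2)[OF g]])
    fix s :: complex and y :: "'n point"
    assume sy: "(s, y) \<in> Q_dom \<Omega>"
    show "((\<lambda>y. \<phi> s * (s - of_real (fst y)) / Q_slice s y ^ k) has_derivative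
       (\<lambda>h. - \<phi> s * of_real (fst h) / Q_slice s y ^ k
        - of_nat k * \<phi> s * (s - of_real (fst y)) * ?Q' s y h / Q_slice s y ^ Suc k)) (at y)"
    proof -
      have "((\<lambda>y. \<phi> s * (s - of_real (fst y))) has_derivative (\<lambda>h. - \<phi> s * of_real (fst h))) (at y)"
        by (auto intro!: derivative_eq_intros)
      from has_derivative_mult[OF this Q_slice_power_has_derivative[of s y k]] show ?thesis
        using ne[OF sy] by (simp add: algebra_simps diff_divide_distrib add_divide_distrib)
    qed
  next
    fix b :: "'n point"
    show "continuous_on (Q_dom \<Omega>) (\<lambda>(s, y). - \<phi> s * of_real (fst b) / Q_slice s y ^ k
        - of_nat k * \<phi> s * (s - of_real (fst y)) * ?Q' s y b / Q_slice s y ^ Suc k)"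
      unfolding split_beta
      by (intro continuous_intros cont\<phi> continuous_on_Q_slice) (use ne in auto)
  qed (simp_all only: dom, (intro holomorphic_intros \<phi>'; simp)+)
  moreover have "contour_integral g (\<lambda>s. - \<phi> s * of_real (fst h) / Q_slice s x ^ k
        - of_nat k * \<phi> s * (s - of_real (fst x)) * ?Q' s x h / Q_slice s x ^ Suc k) =
      fst h *\<^sub>R ((2 * real k - 1) *\<^sub>R contour_integral g (\<lambda>s. \<phi> s / Q_slice s x ^ k) -
          (2 * real k * (norm (snd x))\<^sup>2) *\<^sub>R contour_integral g (\<lambda>s. \<phi> s / Q_slice s x ^ Suc k)) -
        (2 * real k * (snd x \<bullet> snd h)) *\<^sub>R contour_integral g (\<lambda>s. \<phi> s * (s - of_real (fst x)) / Q_slice s x ^ Suc k)" if g: "g \<in> G" for g h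
  proof -
    have "contour_integral g (\<lambda>s. - \<phi> s * of_real (fst h) / Q_slice s x ^ k
        - of_nat k * \<phi> s * (s - of_real (fst x)) * ?Q' s x h / Q_slice s x ^ Suc k) =
      contour_integral g (\<lambda>s. of_real (fst h) * (of_real (2 * real k - 1) * (\<phi> s / Q_slice s x ^ k) -
         of_real (2 * real k * (norm (snd x))\<^sup>2) * (\<phi> s / Q_slice s x ^ Suc k)) -
        of_real (2 * real k * (snd x \<bullet> snd h)) * (\<phi> s * (s - of_real (fst x)) / Q_slice s x ^ Suc k))"
    proof (intro contour_integral_cong refl)
      fix s assume "s \<in> path_image g"
      then have Q: "Q_slice s x \<noteq> 0" using G'(3)[OF g] by blast
      define u where "u = s - of_real (fst x)"
      \<comment> \<open>The identity behind the coefficient \<open>2k - 1\<close>: of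
        \<open>2k (s - x_0)^2 / Q^(k+1)\<close> the part \<open>2k / Q^k\<close> joins the
        \<open>-1 / Q^k\<close> that comes from differentiating \<open>s - x_0\<close>.\<close>
      have r: "of_real ((norm (snd x))\<^sup>2) = Q_slice s x - u\<^sup>2" by (simp add: Q_slice_def u_def)
      show "- \<phi> s * of_real (fst h) / Q_slice s x ^ k
        - of_nat k * \<phi> s * (s - of_real (fst x)) * ?Q' s x h / Q_slice s x ^ Suc k =
        of_real (fst h) * (of_real (2 * real k - 1) * (\<phi> s / Q_slice s x ^ k) -
         of_real (2 * real k * (norm (snd x))\<^sup>2) * (\<phi> s / Q_slice s x ^ Suc k)) -
        of_real (2 * real k * (snd x \<bullet> snd h)) * (\<phi> s * (s - of_real (fst x)) / Q_slice s x ^ Suc k)"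
        unfolding of_real_mult[of _ "(norm (snd x))\<^sup>2"] r u_def[symmetric]
        using Q by (simp add: divide_simps) (simp add: algebra_simps power2_eq_square)
    qed
    then show ?thesis
      using intH[OF g, of k] intH[OF g, of "Suc k"] intJ[OF g, of "Suc k"]
      by (simp only: contour_integral_diff contour_integral_lmul contour_integrable_lmul contour_integrable_diff scaleR_conv_of_real)
  qed
  ultimately have "((\<lambda>y. contour_integral g (\<lambda>s. \<phi> s * (s - of_real (fst y)) / Q_slice s y ^ k)) has_derivative
      (\<lambda>h. fst h *\<^sub>R ((2 * real k - 1) *\<^sub>R contour_integral g (\<lambda>s. \<phi> s / Q_slice s x ^ k) -
          (2 * real k * (norm (snd x))\<^sup>2) *\<^sub>R contour_integral g (\<lambda>s. \<phi> s / Q_slice s x ^ Suc k)) -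
        (2 * real k * (snd x \<bullet> snd h)) *\<^sub>R contour_integral g (\<lambda>s. \<phi> s * (s - of_real (fst x)) / Q_slice s x ^ Suc k))) (at x)" if "g \<in> G" for g
    using that by simp
  from has_derivative_sum[OF this, of G id] show "(J_int G \<phi> k has_derivative
      (\<lambda>h. fst h *\<^sub>R ((2 * real k - 1) *\<^sub>R H_int G \<phi> k x -
          (2 * real k * (norm (snd x))\<^sup>2) *\<^sub>R H_int G \<phi> (Suc k) x) -
        (2 * real k * (snd x \<bullet> snd h)) *\<^sub>R J_int G \<phi> (Suc k) x)) (at x)"
    by (simp add: H_int_def[abs_def] J_int_def[abs_def] cycle_integral_def sum_subtractf flip: scaleR_sum_right)
qed

section \<open>Partial derivatives and the classes \<open>C\<^sup>m\<close>\<close>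

lemma directional_derivative_eq:
  assumes "(f has_derivative f') (at x)"
  shows "directional_derivative d f x = f' d"
proof -
  have "((\<lambda>t. f (x + t *\<^sub>R d)) has_derivative (\<lambda>t. f' (t *\<^sub>R d))) (at 0)"
  proof (rule has_derivative_compose[where f = "\<lambda>t. x + t *\<^sub>R d"])
    show "((\<lambda>t. x + t *\<^sub>R d) has_derivative (\<lambda>t. t *\<^sub>R d)) (at 0)"
      by (auto intro!: derivative_eq_intros)
  qed (use assms in simp)
  then have "((\<lambda>t. f (x + t *\<^sub>R d)) has_vector_derivative f' d) (at 0)"
    by (simp add: has_vector_derivative_def linear_cmul[OF has_derivative_linear[OF assms]])
  then show ?thesis
    unfolding directional_derivative_def by (rule vector_derivative_at)
qed

lemma directional_derivative_cong:
  assumes "open W" "x \<in> W" "\<And>y. y \<in> W \<Longrightarrow> f y = g y"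
  shows "directional_derivative d f x = directional_derivative d g x"
  unfolding directional_derivative_def
proof (rule vector_derivative_cong_eq)
  have "((\<lambda>t. x + t *\<^sub>R d) \<longlongrightarrow> x + 0 *\<^sub>R d) (nhds 0)"
    by (intro tendsto_intros filterlim_ident)
  then have "\<forall>\<^sub>F t in nhds 0. x + t *\<^sub>R d \<in> W"
    using assms(1,2) by (auto simp: tendsto_def)
  then show "\<forall>\<^sub>F t in nhds 0. t \<in> UNIV \<longrightarrow> f (x + t *\<^sub>R d) = g (x + t *\<^sub>R d)"
    by eventually_elim (use assms(3) in auto)
qed auto

lemma laplacian_cong:
  assumes "open W" "x \<in> W" "\<And>y. y \<in> W \<Longrightarrow> f y = g y"
  shows "laplacian f x = laplacian g x"
  unfolding laplacian_def
proof (intro sum.cong refl directional_derivative_cong[OF assms(1,2)])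
  fix d y assume "y \<in> W"
  then show "directional_derivative d f y = directional_derivative d g y"
    using assms by (intro directional_derivative_cong[OF assms(1)])
qed

lemma laplacian_power_cong:
  assumes "open W" "x \<in> W" "\<And>y. y \<in> W \<Longrightarrow> f y = g y"
  shows "(laplacian ^^ k) f x = (laplacian ^^ k) g x"
  using assms(2)
proof (induction k arbitrary: x)
  case (Suc k)
  then show ?case
    unfolding funpow.simps o_apply by (intro laplacian_cong[OF assms(1)]) auto
qed (use assms in simp)

lemma class_C_cong:
  assumes "open W" "\<And>y. y \<in> W \<Longrightarrow> f y = g y"
  shows "class_C m W f = class_C m W g"
  using assms(2)
proof (induction m arbitrary: f g)
  case 0
  then show ?case by (simp cong: continuous_on_cong)
next
  case (Suc m)
  have "f differentiable (at x) \<longleftrightarrow> g differentiable (at x)" if "x \<in> W" for x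
    unfolding differentiable_def
    using has_derivative_transform_within_open[OF _ \<open>open W\<close> that, of f _ UNIV g]
      has_derivative_transform_within_open[OF _ \<open>open W\<close> that, of g _ UNIV f] Suc.prems by metis
  moreover have "class_C m W (directional_derivative d f) = class_C m W (directional_derivative d g)" for d
    using directional_derivative_cong[OF assms(1)] Suc.prems by (intro Suc.IH) blast
  ultimately show ?case by simp
qed

text \<open>Differentiability in \<open>class_C\<close> is meant at the point, not within the set,
  so it may be checked on neighbourhoods that vary with the point, as local cycles require.\<close>

lemma class_C_local:
  assumes "\<And>x. x \<in> V \<Longrightarrow> \<exists>W. open W \<and> x \<in> W \<and> class_C m W f"
  shows "class_C m V f"
  using assms
proof (induction m arbitrary: f)
  case 0
  show ?case
    unfolding class_C.simps
  proof (rule continuous_at_imp_continuous_on, rule ballI)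
    fix x assume "x \<in> V"
    then obtain W where "open W" "x \<in> W" "continuous_on W f" using 0 by auto
    then show "isCont f x" by (simp add: continuous_on_eq_continuous_at)
  qed
next
  case (Suc m)
  have "f differentiable (at x)" if "x \<in> V" for x
    using Suc.prems[OF that] by auto
  moreover have "class_C m V (directional_derivative d f)" if "d \<in> Basis" for d
    using Suc.prems that by (intro Suc.IH) (metis class_C.simps(2))
  ultimately show ?case by simp
qed

lemma class_C_Suc_imp: "class_C (Suc m) W f \<Longrightarrow> class_C m W f"
proof (induction m arbitrary: f)
  case 0
  then show ?case
    by (auto intro!: continuous_at_imp_continuous_on differentiable_imp_continuous_within)
qed auto

text \<open>The form in which a first-order system yields smoothness: on the open set
  \<open>W\<close> the directional derivatives may be replaced by the given formula.\<close>

lemma class_C_SucI: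
  assumes "open W" "\<And>x. x \<in> W \<Longrightarrow> (f has_derivative f' x) (at x)"
    and "\<And>d. d \<in> Basis \<Longrightarrow> class_C m W (\<lambda>x. f' x d)"
  shows "class_C (Suc m) W f"
proof -
  have "class_C m W (directional_derivative d f)" if "d \<in> Basis" for d
    using assms(3)[OF that] class_C_cong[OF assms(1), of "directional_derivative d f" "\<lambda>x. f' x d"]
      directional_derivative_eq[OF assms(2)] by blast
  then show ?thesis using assms(2) by (auto simp: differentiable_def)
qed

lemma class_C_const: "class_C m W (\<lambda>x. c)"
proof (induction m arbitrary: c)
  case (Suc m)
  have "directional_derivative d (\<lambda>x :: 'a. c) = (\<lambda>x. 0)" for d
    by (rule ext) (rule directional_derivative_eq[of _ "\<lambda>_. 0"], rule has_derivative_const)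
  then show ?case using Suc by simp
qed simp

lemma class_C_bounded_linear:
  assumes "open W" "bounded_linear L" shows "class_C m W L"
proof (cases m)
  case 0
  then show ?thesis using assms(2) linear_continuous_on by simp
next
  case (Suc n)
  show ?thesis unfolding Suc
    by (rule class_C_SucI[OF assms(1), of _ "\<lambda>_. L"]) (auto intro: bounded_linear_imp_has_derivative assms class_C_const)
qed

lemma class_C_add:
  assumes "open W" "class_C m W f" "class_C m W g"
  shows "class_C m W (\<lambda>x. f x + g x)"
  using assms(2,3)
proof (induction m arbitrary: f g)
  case (Suc m)
  have der: "(f has_derivative frechet_derivative f (at x)) (at x)"
    "(g has_derivative frechet_derivative g (at x)) (at x)" if "x \<in> W" for x
    using Suc.prems that by (auto simp flip: frechet_derivative_works)
  show ?case
  proof (rule class_C_SucI[OF \<open>open W\<close> has_derivative_add])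
    fix d :: 'a assume d: "d \<in> Basis"
    have "class_C m W (\<lambda>x. directional_derivative d f x + directional_derivative d g x)"
      using Suc d by auto
    then show "class_C m W (\<lambda>x. frechet_derivative f (at x) d + frechet_derivative g (at x) d)"
      by (subst class_C_cong[OF \<open>open W\<close>, symmetric]) (auto simp: directional_derivative_eq[OF der(1)] directional_derivative_eq[OF der(2)])
  qed (use der in auto)
qed (auto intro: continuous_intros)

lemma class_C_scaleR:
  fixes f :: "'a::euclidean_space \<Rightarrow> real"
  assumes "open W" "class_C m W f" "class_C m W g"
  shows "class_C m W (\<lambda>x. f x *\<^sub>R g x)"
  using assms(2,3)
proof (induction m arbitrary: f g)
  case (Suc m)
  have der: "(f has_derivative frechet_derivative f (at x)) (at x)"
    "(g has_derivative frechet_derivative g (at x)) (at x)" if "x \<in> W" for x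
    using Suc.prems that by (auto simp flip: frechet_derivative_works)
  show ?case
  proof (rule class_C_SucI[OF \<open>open W\<close> has_derivative_scaleR])
    fix d :: 'a assume d: "d \<in> Basis"
    have "class_C m W (\<lambda>x. f x *\<^sub>R directional_derivative d g x + directional_derivative d f x *\<^sub>R g x)"
      using Suc.prems d by (intro class_C_add[OF assms(1)] Suc.IH class_C_Suc_imp[OF Suc.prems(1)]
        class_C_Suc_imp[OF Suc.prems(2)]) auto
    then show "class_C m W (\<lambda>x. f x *\<^sub>R frechet_derivative g (at x) d + frechet_derivative f (at x) d *\<^sub>R g x)"
      by (subst class_C_cong[OF \<open>open W\<close>, symmetric]) (auto simp: directional_derivative_eq[OF der(1)] directional_derivative_eq[OF der(2)])
  qed (use der in auto)
qed (auto intro: continuous_intros)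

lemma class_C_linear_compose:
  assumes "open W" "class_C m W f" "bounded_linear L"
  shows "class_C m W (\<lambda>x. L (f x))"
  using assms(2)
proof (induction m arbitrary: f)
  case 0
  then show ?case by (simp add: bounded_linear.continuous_on[OF assms(3)])
next
  case (Suc m)
  have der: "(f has_derivative frechet_derivative f (at x)) (at x)" if "x \<in> W" for x
    using Suc.prems that by (auto simp flip: frechet_derivative_works)
  show ?case
  proof (rule class_C_SucI[OF \<open>open W\<close> bounded_linear.has_derivative[OF assms(3)]])
    fix d :: 'a assume d: "d \<in> Basis"
    have "class_C m W (\<lambda>x. L (directional_derivative d f x))"
      using Suc d by auto
    then show "class_C m W (\<lambda>x. L (frechet_derivative f (at x) d))"
      by (subst class_C_cong[OF \<open>open W\<close>, symmetric]) (auto simp: directional_derivative_eq[OF der])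
  qed (use der in auto)
qed

lemma class_C_diff:
  assumes "open W" "class_C m W f" "class_C m W g"
  shows "class_C m W (\<lambda>x. f x - g x)"
  using class_C_add[OF assms(1,2) class_C_linear_compose[OF assms(1,3), of uminus]]
  by (simp add: bounded_linear_minus bounded_linear_ident)

lemma class_C_sum:
  assumes "open W" "\<And>i. i \<in> I \<Longrightarrow> class_C m W (f i)"
  shows "class_C m W (\<lambda>x. \<Sum>i\<in>I. f i x)"
  using assms(2)
  by (induction I rule: infinite_finite_induct) (auto simp: class_C_const intro!: class_C_add assms(1))

lemma sum_Basis_point:
  fixes F :: "'n::finite point \<Rightarrow> 'b::comm_monoid_add"
  shows "(\<Sum>d\<in>Basis. F d) = F (1, 0) + (\<Sum>i\<in>UNIV. F (0, axis i 1))"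
proof -
  have B: "(Basis :: 'n point set) = {(1, 0)} \<union> (\<lambda>i. (0, axis i 1)) ` UNIV"
    by (auto simp: Basis_prod_def Basis_vec_def)
  have inj: "inj (\<lambda>i :: 'n. (0 :: real, axis i (1::real)))"
    by (auto simp: inj_on_def axis_eq_axis)
  show ?thesis
    unfolding B by (subst sum.union_disjoint) (auto simp: sum.reindex[OF inj] o_def)
qed

lemma norm_squared_snd: "(norm (snd x))\<^sup>2 = (\<Sum>i\<in>UNIV. (snd x $ i)\<^sup>2)" for x :: "'n::finite point"
  unfolding power2_norm_eq_inner inner_vec_def by (simp add: power2_eq_square)

lemma class_C_coordinate: "open W \<Longrightarrow> class_C m W (\<lambda>x :: 'n::finite point. snd x $ i)"
  by (rule class_C_bounded_linear) (auto intro: bounded_linear_compose[OF bounded_linear_vec_nth bounded_linear_snd])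

lemma class_C_norm_squared_snd: 
  assumes "open W" shows "class_C m W (\<lambda>x :: 'n::finite point. (norm (snd x))\<^sup>2)"
proof -
  have "class_C m W (\<lambda>x :: 'n point. \<Sum>i\<in>UNIV. (snd x $ i) *\<^sub>R (snd x $ i))"
    by (intro class_C_sum class_C_scaleR class_C_coordinate assms)
  then show ?thesis unfolding norm_squared_snd by (simp add: power2_eq_square)
qed

locale cauchy_transform =
  fixes \<Omega> :: "complex set" and \<phi> :: "complex \<Rightarrow> complex" and G :: "(real \<Rightarrow> complex) set"
    and W :: "'n::finite point set"
  assumes open_\<Omega>: "open \<Omega>" and hol: "\<phi> holomorphic_on \<Omega>" and cycle: "cycle_in \<Omega> G"
    and open_W: "open W" and off: "W \<subseteq> off_cycle G"
begin

abbreviation H :: "nat \<Rightarrow> 'n point \<Rightarrow> complex" where "H \<equiv> H_int G \<phi>"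
abbreviation J :: "nat \<Rightarrow> 'n point \<Rightarrow> complex" where "J \<equiv> J_int G \<phi>"

lemma H_deriv:
  "x \<in> W \<Longrightarrow> (H k has_derivative (\<lambda>h. (2 * real k * fst h) *\<^sub>R J (Suc k) x -
        (2 * real k * (snd x \<bullet> snd h)) *\<^sub>R H (Suc k) x)) (at x)"
  using H_int_has_derivative[OF open_\<Omega> hol cycle] off by blast

lemma J_deriv:
  "x \<in> W \<Longrightarrow> (J k has_derivative (\<lambda>h. fst h *\<^sub>R ((2 * real k - 1) *\<^sub>R H k x -
          (2 * real k * (norm (snd x))\<^sup>2) *\<^sub>R H (Suc k) x) -
        (2 * real k * (snd x \<bullet> snd h)) *\<^sub>R J (Suc k) x)) (at x)"
  using J_int_has_derivative[OF open_\<Omega> hol cycle] off by blast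

text \<open>Every derivative of \<open>H k\<close> or \<open>J k\<close> is a combination, with
  polynomial coefficients, of \<open>H\<close> and \<open>J\<close> at index \<open>k\<close> or
  \<open>k + 1\<close>. The index grows with differentiation, hence the induction on
  \<open>m\<close> for both families and all \<open>k\<close> at once.\<close>

lemma class_C_H_J: "class_C m W (H k) \<and> class_C m W (J k)"
proof (induction m arbitrary: k)
  case 0
  show ?case
    using H_deriv J_deriv by (auto intro!: continuous_at_imp_continuous_on has_derivative_continuous)
next
  case (Suc m)
  have inner: "class_C m W (\<lambda>x. 2 * real k * (snd x \<bullet> v))" for v :: "real ^ 'n" and k
    by (rule class_C_bounded_linear[OF open_W])
      (auto intro!: bounded_linear_intros bounded_linear_inner_left_comp)
  have nrm: "class_C m W (\<lambda>x :: 'n point. c * (norm (snd x))\<^sup>2)" for c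
    using class_C_scaleR[OF open_W class_C_const class_C_norm_squared_snd[OF open_W]] by simp
  have "class_C (Suc m) W (H k)"
    by (rule class_C_SucI[OF open_W H_deriv])
      (use Suc in \<open>auto intro!: class_C_diff class_C_scaleR class_C_const open_W inner\<close>)
  moreover have "class_C (Suc m) W (J k)"
    by (rule class_C_SucI[OF open_W J_deriv])
      (use Suc in \<open>auto intro!: class_C_diff class_C_scaleR class_C_const open_W inner nrm\<close>)
  ultimately show ?case by blast
qed

end

section \<open>Laplacians of axial Cauchy transforms\<close>

lemma laplacian_point:
  fixes f :: "'n::finite point \<Rightarrow> 'b::real_normed_vector"
  shows "laplacian f x = directional_derivative (1, 0) (directional_derivative (1, 0) f) x +
    (\<Sum>i\<in>UNIV. directional_derivative (0, axis i 1) (directional_derivative (0, axis i 1) f) x)"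
  unfolding laplacian_def by (rule sum_Basis_point)

lemma axis_component: "axis i (1 :: real) $ j = (if j = i then 1 else 0)"
  by (simp add: axis_def)

lemma sum_scaleR_snd_squared:
  fixes x :: "'n::finite point" and v :: "'b::real_vector"
  shows "(\<Sum>i\<in>UNIV. (c * (snd x $ i)\<^sup>2) *\<^sub>R v) = (c * (norm (snd x))\<^sup>2) *\<^sub>R v"
  by (simp only: norm_squared_snd sum_distrib_left scaleR_sum_left)

lemma directional_derivative_linear:
  assumes "f differentiable (at x)" "bounded_linear L"
  shows "directional_derivative d (\<lambda>x. L (f x)) x = L (directional_derivative d f x)"
proof -
  obtain f' where f: "(f has_derivative f') (at x)" using assms(1) by (auto simp: differentiable_def)
  show ?thesis
    using directional_derivative_eq[OF f] directional_derivative_eq[OF bounded_linear.has_derivative[OF assms(2) f]]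
    by simp
qed

lemma directional_derivative_sum:
  assumes "\<And>i. i \<in> I \<Longrightarrow> f i differentiable (at x)"
  shows "directional_derivative d (\<lambda>x. \<Sum>i\<in>I. f i x) x = (\<Sum>i\<in>I. directional_derivative d (f i) x)"
proof -
  have f: "(f i has_derivative frechet_derivative (f i) (at x)) (at x)" if "i \<in> I" for i
    using assms[OF that] by (simp flip: frechet_derivative_works)
  show ?thesis
    using directional_derivative_eq[OF has_derivative_sum[OF f]]
    by (simp add: directional_derivative_eq[OF f])
qed

lemma laplacian_linear:
  assumes "open W" "x \<in> W" "class_C 2 W f" "bounded_linear L"
  shows "laplacian (\<lambda>x. L (f x)) x = L (laplacian f x)"
proof -
  have 2: "2 = Suc (Suc 0)" by simp
  have "directional_derivative d (directional_derivative d (\<lambda>x. L (f x))) x =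
      L (directional_derivative d (directional_derivative d f) x)" if d: "d \<in> Basis" for d
  proof -
    have "directional_derivative d (directional_derivative d (\<lambda>x. L (f x))) x =
        directional_derivative d (\<lambda>x. L (directional_derivative d f x)) x"
      using assms(3) unfolding 2
      by (intro directional_derivative_cong[OF assms(1,2)] directional_derivative_linear[OF _ assms(4)]) simp
    also have "\<dots> = L (directional_derivative d (directional_derivative d f) x)"
      using assms d unfolding 2 by (intro directional_derivative_linear) auto
    finally show ?thesis .
  qed
  then show ?thesis
    by (simp add: laplacian_def linear_sum[OF bounded_linear.linear[OF assms(4)]])
qed

lemma laplacian_sum:
  assumes "open W" "x \<in> W" "\<And>i. i \<in> I \<Longrightarrow> class_C 2 W (f i)"
  shows "laplacian (\<lambda>x. \<Sum>i\<in>I. f i x) x = (\<Sum>i\<in>I. laplacian (f i) x)"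
proof -
  have 2: "2 = Suc (Suc 0)" by simp
  have "directional_derivative d (directional_derivative d (\<lambda>x. \<Sum>i\<in>I. f i x)) x =
      (\<Sum>i\<in>I. directional_derivative d (directional_derivative d (f i)) x)" if d: "d \<in> Basis" for d
  proof -
    have "directional_derivative d (directional_derivative d (\<lambda>x. \<Sum>i\<in>I. f i x)) x =
        directional_derivative d (\<lambda>x. \<Sum>i\<in>I. directional_derivative d (f i) x) x"
      using assms(3) unfolding 2
      by (intro directional_derivative_cong[OF assms(1,2)] directional_derivative_sum) auto
    also have "\<dots> = (\<Sum>i\<in>I. directional_derivative d (directional_derivative d (f i)) x)"
      using assms d unfolding 2 by (intro directional_derivative_sum) auto
    finally show ?thesis .
  qed
  then show ?thesis
    unfolding laplacian_def by (simp add: sum.swap[of _ I])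
qed

text \<open>\<open>R j w\<close> stands for \<open>e_j\<close> times \<open>P w\<close>, with the
  product taken on either side. The Laplacian computations rest on real linearity alone, so
  \<open>P\<close> and \<open>R\<close> are kept abstract here.\<close>

locale axial_transform = cauchy_transform \<Omega> \<phi> G W
  for \<Omega> \<phi> G and W :: "'n::finite point set" +
  fixes P :: "complex \<Rightarrow> 'b::real_normed_vector" and R :: "'n \<Rightarrow> complex \<Rightarrow> 'b"
  assumes P: "bounded_linear P" and R: "bounded_linear (R i)"
begin

sublocale P: bounded_linear P by (rule P)
sublocale R: bounded_linear "R i" for i by (rule R)

definition radial :: "('n point \<Rightarrow> complex) \<Rightarrow> 'n point \<Rightarrow> 'b" where
  "radial f x = (\<Sum>j\<in>UNIV. (snd x $ j) *\<^sub>R R j (f x))"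

definition axial :: "nat \<Rightarrow> 'n point \<Rightarrow> 'b" where
  "axial k x = P (J k x) + radial (H k) x"

lemmas lin = P.add P.diff P.scaleR P.neg P.zero R.add R.diff R.scaleR R.neg R.zero

lemma snd_nth_deriv: "((\<lambda>x :: 'n point. snd x $ j) has_derivative (\<lambda>h. snd h $ j)) (at x)"
  by (intro bounded_linear_imp_has_derivative bounded_linear_compose[OF bounded_linear_vec_nth bounded_linear_snd])

lemma radial_deriv:
  assumes "(f has_derivative f') (at x)"
  shows "(radial f has_derivative (\<lambda>h. (\<Sum>j\<in>UNIV. (snd h $ j) *\<^sub>R R j (f x)) +
    (\<Sum>j\<in>UNIV. (snd x $ j) *\<^sub>R R j (f' h)))) (at x)"
proof -
  from has_derivative_sum[OF has_derivative_scaleR[OF snd_nth_deriv R.has_derivative[OF assms]], where I = UNIV]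
  show ?thesis
    unfolding radial_def[abs_def] by (simp add: sum.distrib add.commute)
qed

lemma norm_sq_deriv: "((\<lambda>x :: 'n point. (norm (snd x))\<^sup>2) has_derivative (\<lambda>h. 2 * (snd x \<bullet> snd h))) (at x)"
  unfolding power2_norm_eq_inner by (auto intro!: derivative_eq_intros simp: inner_commute)

lemma axial_deriv:
  assumes "x \<in> W"
  shows "(axial k has_derivative (\<lambda>h. fst h *\<^sub>R ((2 * real k - 1) *\<^sub>R P (H k x) -
      (2 * real k * (norm (snd x))\<^sup>2) *\<^sub>R P (H (Suc k) x) + (2 * real k) *\<^sub>R radial (J (Suc k)) x) +
      (\<Sum>j\<in>UNIV. (snd h $ j) *\<^sub>R R j (H k x)) - (2 * real k * (snd x \<bullet> snd h)) *\<^sub>R axial (Suc k) x)) (at x)"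
  unfolding axial_def[abs_def]
  by (rule has_derivative_eq_rhs[OF has_derivative_add[OF P.has_derivative[OF J_deriv[OF assms]] radial_deriv[OF H_deriv[OF assms]]]])
    (auto simp: fun_eq_iff lin radial_def algebra_simps scaleR_sum_right sum.distrib sum_subtractf)

lemma axial_dd:
  assumes "x \<in> W"
  shows "directional_derivative (1, 0) (axial k) x = (2 * real k - 1) *\<^sub>R P (H k x) -
      (2 * real k * (norm (snd x))\<^sup>2) *\<^sub>R P (H (Suc k) x) + (2 * real k) *\<^sub>R radial (J (Suc k)) x"
    and "directional_derivative (0, axis i 1) (axial k) x =
      R i (H k x) - (2 * real k * (snd x $ i)) *\<^sub>R axial (Suc k) x"
  using directional_derivative_eq[OF axial_deriv[OF assms], of "(1, 0)" k]
    directional_derivative_eq[OF axial_deriv[OF assms], of "(0, axis i 1)" k]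
  by (auto simp: inner_axis axis_component if_distrib if_distribR cong: if_cong)

lemma axial_dd2:
  assumes x: "x \<in> W"
  shows "directional_derivative (1, 0) (directional_derivative (1, 0) (axial k)) x =
      (2 * real k) *\<^sub>R ((2 * real k - 1) *\<^sub>R P (J (Suc k) x) + (2 * real k + 1) *\<^sub>R radial (H (Suc k)) x -
        (2 * (real k + 1) * (norm (snd x))\<^sup>2) *\<^sub>R axial (Suc (Suc k)) x)" (is ?A)
    and "directional_derivative (0, axis i 1) (directional_derivative (0, axis i 1) (axial k)) x =
      - (4 * real k * (snd x $ i)) *\<^sub>R R i (H (Suc k) x) - (2 * real k) *\<^sub>R axial (Suc k) x +
      (4 * real k * (real k + 1) * (snd x $ i)\<^sup>2) *\<^sub>R axial (Suc (Suc k)) x" (is ?B)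
proof -
  have "((\<lambda>x. (2 * real k - 1) *\<^sub>R P (H k x) - (2 * real k * (norm (snd x))\<^sup>2) *\<^sub>R P (H (Suc k) x) +
      (2 * real k) *\<^sub>R radial (J (Suc k)) x) has_derivative
    (\<lambda>h. (2 * real k - 1) *\<^sub>R P ((2 * real k * fst h) *\<^sub>R J (Suc k) x -
        (2 * real k * (snd x \<bullet> snd h)) *\<^sub>R H (Suc k) x) -
      ((2 * real k * (norm (snd x))\<^sup>2) *\<^sub>R P ((2 * real (Suc k) * fst h) *\<^sub>R J (Suc (Suc k)) x -
        (2 * real (Suc k) * (snd x \<bullet> snd h)) *\<^sub>R H (Suc (Suc k)) x) +
       (2 * real k * (2 * (snd x \<bullet> snd h))) *\<^sub>R P (H (Suc k) x)) +
      (2 * real k) *\<^sub>R ((\<Sum>j\<in>UNIV. (snd h $ j) *\<^sub>R R j (J (Suc k) x)) +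
    (\<Sum>j\<in>UNIV. (snd x $ j) *\<^sub>R R j (fst h *\<^sub>R ((2 * real (Suc k) - 1) *\<^sub>R H (Suc k) x -
          (2 * real (Suc k) * (norm (snd x))\<^sup>2) *\<^sub>R H (Suc (Suc k)) x) -
        (2 * real (Suc k) * (snd x \<bullet> snd h)) *\<^sub>R J (Suc (Suc k)) x))))) (at x)"
    by (intro has_derivative_add has_derivative_diff has_derivative_scaleR_right has_derivative_scaleR
      has_derivative_mult_right P.has_derivative H_deriv radial_deriv J_deriv norm_sq_deriv x)
  from directional_derivative_eq[OF this, of "(1, 0)"]
  have "directional_derivative (1, 0) (\<lambda>x. (2 * real k - 1) *\<^sub>R P (H k x) - (2 * real k * (norm (snd x))\<^sup>2) *\<^sub>R P (H (Suc k) x) +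
      (2 * real k) *\<^sub>R radial (J (Suc k)) x) x =
      (2 * real k) *\<^sub>R ((2 * real k - 1) *\<^sub>R P (J (Suc k) x) + (2 * real k + 1) *\<^sub>R radial (H (Suc k)) x -
        (2 * (real k + 1) * (norm (snd x))\<^sup>2) *\<^sub>R axial (Suc (Suc k)) x)"
    by (simp add: axial_def lin radial_def algebra_simps scaleR_sum_right sum.distrib sum_subtractf)
  then show ?A
    using directional_derivative_cong[OF open_W x axial_dd(1)] by simp
  have "((\<lambda>x. R i (H k x) - (2 * real k * (snd x $ i)) *\<^sub>R axial (Suc k) x) has_derivative
    (\<lambda>h. R i ((2 * real k * fst h) *\<^sub>R J (Suc k) x - (2 * real k * (snd x \<bullet> snd h)) *\<^sub>R H (Suc k) x) -
      ((2 * real k * (snd x $ i)) *\<^sub>R (fst h *\<^sub>R ((2 * real (Suc k) - 1) *\<^sub>R P (H (Suc k) x) -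
      (2 * real (Suc k) * (norm (snd x))\<^sup>2) *\<^sub>R P (H (Suc (Suc k)) x) + (2 * real (Suc k)) *\<^sub>R radial (J (Suc (Suc k))) x) +
      (\<Sum>j\<in>UNIV. (snd h $ j) *\<^sub>R R j (H (Suc k) x)) - (2 * real (Suc k) * (snd x \<bullet> snd h)) *\<^sub>R axial (Suc (Suc k)) x) +
      (2 * real k * (snd h $ i)) *\<^sub>R axial (Suc k) x))) (at x)"
    by (intro has_derivative_diff has_derivative_scaleR
      has_derivative_mult_right R.has_derivative H_deriv axial_deriv snd_nth_deriv x)
  from directional_derivative_eq[OF this, of "(0, axis i 1)"]
  have "directional_derivative (0, axis i 1) (\<lambda>x. R i (H k x) - (2 * real k * (snd x $ i)) *\<^sub>R axial (Suc k) x) x =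
      - (4 * real k * (snd x $ i)) *\<^sub>R R i (H (Suc k) x) - (2 * real k) *\<^sub>R axial (Suc k) x +
      (4 * real k * (real k + 1) * (snd x $ i)\<^sup>2) *\<^sub>R axial (Suc (Suc k)) x"
    by (simp add: inner_axis axis_component lin if_distrib if_distribR cong: if_cong)
      (simp add: algebra_simps power2_eq_square flip: scaleR_left_distrib)
  then show ?B
    using directional_derivative_cong[OF open_W x axial_dd(2)] by simp
qed

text \<open>The terms with \<open>|x|^2\<close> at index \<open>k + 2\<close> from the
  \<open>x_0\<close> and the vector derivatives cancel. In the \<open>radial\<close> part the factor
  \<open>2k (2k + 1)\<close> is lowered by \<open>4k\<close>, from differentiating the coordinates
  in \<open>radial\<close>, to the \<open>2k (2k - 1)\<close> that the \<open>P\<close> part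
  carries, so both share one factor; the \<open>n\<close> diagonal terms add
  \<open>-2kn\<close>.\<close>

lemma laplacian_axial:
  assumes x: "x \<in> W"
  shows "laplacian (axial k) x = (2 * real k * (2 * real k - 1 - real CARD('n))) *\<^sub>R axial (Suc k) x"
proof -
  have sum: "(\<Sum>i\<in>UNIV. directional_derivative (0, axis i 1) (directional_derivative (0, axis i 1) (axial k)) x) =
     - (4 * real k) *\<^sub>R radial (H (Suc k)) x - (2 * real k * real CARD('n)) *\<^sub>R axial (Suc k) x +
      (4 * real k * (real k + 1) * (norm (snd x))\<^sup>2) *\<^sub>R axial (Suc (Suc k)) x"
    unfolding axial_dd2(2)[OF x] radial_def sum.distrib sum_subtractf sum_scaleR_snd_squared
    by (simp add: scaleR_sum_right sum_constant_scaleR sum_negf mult_ac)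
  have "(4 * real k) *\<^sub>R radial (H (Suc k)) x = (2 * real k) *\<^sub>R radial (H (Suc k)) x + (2 * real k) *\<^sub>R radial (H (Suc k)) x"
    by (simp flip: scaleR_left_distrib)
  then show ?thesis
    unfolding laplacian_point axial_dd2(1)[OF x] sum
    by (simp add: axial_def algebra_simps)
qed

text \<open>Without a \<open>radial\<close> part there is no cross term: the factor
  \<open>2k (2k + 1)\<close> of the \<open>x_0\<close> derivatives survives, and the terms at index
  \<open>k + 2\<close> cancel as before.\<close>

lemma laplacian_PH:
  assumes x: "x \<in> W"
  shows "laplacian (\<lambda>x. P (H k x)) x = (2 * real k * (2 * real k + 1 - real CARD('n))) *\<^sub>R P (H (Suc k) x)"
proof -
  have H': "((\<lambda>y. P (H k y)) has_derivative (\<lambda>h. (2 * real k * fst h) *\<^sub>R P (J (Suc k) y) -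
        (2 * real k * (snd y \<bullet> snd h)) *\<^sub>R P (H (Suc k) y))) (at y)" if "y \<in> W" for y k
    using P.has_derivative[OF H_deriv[OF that]] by (simp add: lin)
  have J': "((\<lambda>y. P (J k y)) has_derivative (\<lambda>h. fst h *\<^sub>R ((2 * real k - 1) *\<^sub>R P (H k y) -
          (2 * real k * (norm (snd y))\<^sup>2) *\<^sub>R P (H (Suc k) y)) -
        (2 * real k * (snd y \<bullet> snd h)) *\<^sub>R P (J (Suc k) y))) (at y)" if "y \<in> W" for y k
    using P.has_derivative[OF J_deriv[OF that]] by (simp add: lin)
  have 1: "directional_derivative (1, 0) (\<lambda>x. P (H k x)) y = (2 * real k) *\<^sub>R P (J (Suc k) y)"
    "directional_derivative (0, axis i 1) (\<lambda>x. P (H k x)) y = (- 2 * real k * (snd y $ i)) *\<^sub>R P (H (Suc k) y)"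
    if "y \<in> W" for y i
    using directional_derivative_eq[OF H'[OF that]] by (simp_all add: inner_axis)
  have "directional_derivative (1, 0) (directional_derivative (1, 0) (\<lambda>x. P (H k x))) x =
    (2 * real k) *\<^sub>R ((2 * real k + 1) *\<^sub>R P (H (Suc k) x) - (2 * (real k + 1) * (norm (snd x))\<^sup>2) *\<^sub>R P (H (Suc (Suc k)) x))"
    using directional_derivative_cong[OF open_W x 1(1)]
      directional_derivative_eq[OF has_derivative_scaleR_right[OF J'[OF x]], of "(1, 0)" "2 * real k" "Suc k"]
    by (simp add: algebra_simps)
  moreover have dd: "directional_derivative (0, axis i 1) (directional_derivative (0, axis i 1) (\<lambda>x. P (H k x))) x =
      - (2 * real k) *\<^sub>R P (H (Suc k) x) + (4 * real k * (real k + 1) * (snd x $ i)\<^sup>2) *\<^sub>R P (H (Suc (Suc k)) x)" for i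
    using directional_derivative_cong[OF open_W x 1(2)]
      directional_derivative_eq[OF has_derivative_scaleR[OF has_derivative_mult_right[OF snd_nth_deriv] H'[OF x]], of "(0, axis i 1)" "- 2 * real k" i "Suc k"]
    by (simp add: inner_axis axis_component algebra_simps power2_eq_square)
  ultimately show ?thesis
    unfolding laplacian_point dd sum.distrib sum_scaleR_snd_squared
    by (simp add: sum_constant_scaleR algebra_simps)
qed

lemma class_C_axial: "class_C m W (axial k)"
  unfolding axial_def[abs_def] radial_def
  by (intro class_C_add class_C_sum class_C_scaleR class_C_coordinate open_W class_C_linear_compose[OF _ _ P] class_C_linear_compose[OF _ _ R])
    (use class_C_H_J in auto)

lemma class_C_PH: "class_C m W (\<lambda>x. P (H k x))"
  by (intro class_C_linear_compose[OF _ _ P] open_W) (use class_C_H_J in auto)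

end

section \<open>Clifford algebra and slices\<close>

lemma bounded_bilinear_times_clifford:
  "bounded_bilinear ((*) :: 'n::{finite,linorder} clifford \<Rightarrow> 'n clifford \<Rightarrow> 'n clifford)"
  by (subst bilinear_conv_bounded_bilinear[symmetric])
    (auto simp: bilinear_def distrib_left distrib_right intro!: linearI)

lemma vector_part_eq: "vector_part v = (\<Sum>j\<in>UNIV. (v $ j) *\<^sub>R gen j)"
  by (simp add: paravector_def)

lemma linear_vector_part: "linear vector_part"
  by (rule linearI) (simp_all add: vector_part_eq scaleR_left_distrib sum.distrib scaleR_sum_right)

lemma paravector_eq: "paravector x = of_real (fst x) + vector_part (snd x)"
  by (simp add: paravector_def)

text \<open>Adding the double sum to its transpose leaves only the anticommutators of the
  generators, which vanish off the diagonal.\<close>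

lemma vector_part_mult_self:
  fixes v :: "real ^ ('n::{finite,linorder})"
  shows "vector_part v * vector_part v = of_real (- (norm v)\<^sup>2)"
proof -
  have eq: "vector_part v * vector_part v = (\<Sum>i\<in>UNIV. \<Sum>j\<in>UNIV. (v $ i * v $ j) *\<^sub>R (gen i * gen j))"
    by (simp add: vector_part_eq sum_product mult.commute)
  also have "\<dots> = (\<Sum>i\<in>UNIV. \<Sum>j\<in>UNIV. (v $ j * v $ i) *\<^sub>R (gen j * gen i))"
    by (rule sum.swap)
  finally have "2 *\<^sub>R (vector_part v * vector_part v) =
      (\<Sum>i\<in>UNIV. \<Sum>j\<in>UNIV. (v $ i * v $ j) *\<^sub>R (gen i * gen j)) + (\<Sum>i\<in>UNIV. \<Sum>j\<in>UNIV. (v $ j * v $ i) *\<^sub>R (gen j * gen i))"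
    using eq by (simp only: scaleR_2)
  also have "\<dots> = (\<Sum>i\<in>UNIV. \<Sum>j\<in>UNIV. (v $ i * v $ j) *\<^sub>R (gen i * gen j + gen j * gen i))"
    by (simp add: sum.distrib scaleR_right_distrib mult.commute)
  also have "\<dots> = (\<Sum>i\<in>UNIV. \<Sum>j\<in>UNIV. if i = j then of_real (- 2 * (v $ i)\<^sup>2) else 0)"
  proof (intro sum.cong refl)
    fix i j
    have "r *\<^sub>R (- 2 :: 'n clifford) = of_real (- 2 * r)" for r
      by (metis mult.commute of_real_mult of_real_neg_numeral scaleR_conv_of_real)
    then show "(v $ i * v $ j) *\<^sub>R (gen i * gen j + gen j * gen i :: 'n clifford) =
        (if i = j then of_real (- 2 * (v $ i)\<^sup>2) else 0)"
      unfolding clifford_relations by (cases "i = j") (simp_all only: if_True if_False power2_eq_square scaleR_zero_right simp_thms)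
  qed
  also have "\<dots> = of_real (\<Sum>i\<in>UNIV. - 2 * (v $ i)\<^sup>2)"
    by simp
  also have "(\<Sum>i\<in>UNIV. - 2 * (v $ i)\<^sup>2) = 2 * - (norm v)\<^sup>2"
    unfolding power2_norm_eq_inner inner_vec_def
    by (simp add: sum_distrib_left sum_negf power2_eq_square)
  also have "of_real (2 * - (norm v)\<^sup>2) = 2 *\<^sub>R (of_real (- (norm v)\<^sup>2) :: 'n clifford)"
    by (simp add: scaleR_conv_of_real)
  finally show ?thesis by (simp only: scaleR_cancel_left) simp
qed

text \<open>The embedding of the complex numbers onto the plane of \<open>I\<close>; for
  \<open>norm I = 1\<close> it is a homomorphism of real algebras.\<close>

definition emb :: "real ^ ('n::{finite,linorder}) \<Rightarrow> complex \<Rightarrow> 'n clifford" where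
  "emb I z = of_real (Re z) + Im z *\<^sub>R vector_part I"

lemma bounded_linear_emb: "bounded_linear (emb I)"
  by (simp add: linear_conv_bounded_linear[symmetric] emb_def[abs_def] linear_iff algebra_simps
      scaleR_conv_of_real)

lemma emb_of_real [simp]: "emb I (of_real r) = of_real r"
  by (simp add: emb_def)

lemma emb_1 [simp]: "emb I 1 = 1"
  using emb_of_real[of I 1] by simp

lemma emb_mult:
  assumes "norm I = 1" shows "emb I z * emb I w = emb I (z * w)"
proof -
  have "vector_part I * vector_part I = - 1" using vector_part_mult_self[of I] assms by simp
  then show ?thesis
    unfolding emb_def of_real_def
    by (simp add: distrib_left distrib_right scaleR_diff_left scaleR_add_left scaleR_add_right)
      (simp add: scaleR_diff_right mult.commute)
qed

lemma emb_power: "norm I = 1 \<Longrightarrow> emb I z ^ k = emb I (z ^ k)"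
  by (induction k) (simp_all add: emb_mult)

lemma paravector_slice: "paravector (slice I z) = emb I z"
  by (subst paravector_eq) (simp add: slice_def emb_def linear_cmul[OF linear_vector_part])

text \<open>Only \<open>x_0\<close> and \<open>|x|\<close> enter \<open>Q_c\<close>, so for
  \<open>s\<close> in the plane of \<open>I\<close> its value lies in that plane wherever
  \<open>x\<close> is, and its inverse powers become scalar complex ones.\<close>

lemma Q_c_slice:
  assumes "norm I = 1" shows "Q_c (slice I s) x = emb I (Q_slice s x)"
proof -
  have "Q_slice s x = s\<^sup>2 - (2 * fst x) *\<^sub>R s + of_real ((norm x)\<^sup>2)"
    by (simp add: Q_slice_def norm_prod_def power2_eq_square algebra_simps scaleR_conv_of_real)
  then show ?thesis
    using bounded_linear_emb[of I]
    by (simp add: Q_c_def paravector_slice emb_power[OF assms] bounded_linear.linear linear_add linear_diff linear_cmul del: of_real_power)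
qed

lemma cl_inverse_emb:
  assumes "norm I = 1" "w \<noteq> 0" shows "cl_inverse (emb I w) = emb I (1 / w)"
  unfolding cl_inverse_def
proof (rule the_equality)
  show 1: "emb I w * emb I (1 / w) = 1 \<and> emb I (1 / w) * emb I w = 1"
    using assms by (simp add: emb_mult)
  fix b assume b: "emb I w * b = 1 \<and> b * emb I w = 1"
  have "b = (emb I (1 / w) * emb I w) * b" using 1 by simp
  also have "\<dots> = emb I (1 / w)" using b by (simp add: mult.assoc)
  finally show "b = emb I (1 / w)" .
qed

section \<open>Complex slices of axially symmetric sets\<close>

lemma profile_iff:
  assumes "axially_symmetric V" "norm I = 1"
  shows "(u, v) \<in> profile V \<longleftrightarrow> (u, v *\<^sub>R I) \<in> V"
proof
  assume *: "(u, v *\<^sub>R I) \<in> V"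
  have "(u, v *\<^sub>R K) \<in> V" if "norm K = 1" for K
  proof -
    \<comment> \<open>\<open>sphere_of\<close> uses the nonnegative radius \<open>|v|\<close>, so
      the sign of \<open>v\<close> has to be moved into the unit vector.\<close>
    have "(u, v *\<^sub>R K) \<in> sphere_of (u, v *\<^sub>R I)"
      unfolding sphere_of_def using assms(2) that
      by (intro CollectI exI[of _ "if v < 0 then - K else K"]) (cases "v < 0"; simp)
    then show ?thesis using assms(1) * unfolding axially_symmetric_def by blast
  qed
  then show "(u, v) \<in> profile V" by (simp add: profile_def)
qed (use assms(2) in \<open>simp add: profile_def\<close>)

text \<open>For axially symmetric \<open>V\<close> this is the slice by every imaginary unit at
  once, so no unit occurs in the notation.\<close>

definition slice_domain :: "'n::finite point set \<Rightarrow> complex set" where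
  "slice_domain V = {z. (Re z, Im z) \<in> profile V}"

lemma slice_domain_eq:
  "axially_symmetric V \<Longrightarrow> norm I = 1 \<Longrightarrow> slice_domain V = slice I -` V"
  by (auto simp: slice_domain_def profile_iff slice_def)

lemma continuous_on_slice: "continuous_on A (slice I)"
  unfolding slice_def by (intro continuous_intros)

lemma unit_vector_exists: "\<exists>I :: real ^ 'n. norm I = 1"
  by (rule exI[of _ "axis undefined 1"]) simp

lemma open_slice_domain:
  assumes "open V" "axially_symmetric V" shows "open (slice_domain (V :: 'n::finite point set))"
proof -
  obtain I :: "real ^ 'n" where "norm I = 1" using unit_vector_exists by blast
  then show ?thesis
    using assms by (simp add: slice_domain_eq open_vimage continuous_on_slice)
qed

lemma cnj_slice_domain: "cnj z \<in> slice_domain V \<longleftrightarrow> z \<in> slice_domain V"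
proof -
  have "(u, - v) \<in> profile V" if "(u, v) \<in> profile V" for u v
  proof -
    have "(u, v *\<^sub>R (- K)) \<in> V" if "norm K = 1" for K
      using \<open>(u, v) \<in> profile V\<close> that unfolding profile_def by (auto simp del: scaleR_minus_right)
    then show ?thesis by (simp add: profile_def)
  qed
  from this[of "Re z" "Im z"] this[of "Re z" "- Im z"] show ?thesis
    by (auto simp: slice_domain_def)
qed

text \<open>The point of the closed upper half-plane that represents the sphere \<open>[x]\<close>;
  it and its conjugate are the zeros of \<open>Q_slice\<close> in \<open>s\<close>.\<close>

definition sphere_param :: "'n::finite point \<Rightarrow> complex" where
  "sphere_param x = Complex (fst x) (norm (snd x))"

lemma continuous_on_sphere_param: "continuous_on A sphere_param"
  unfolding sphere_param_def Complex_eq by (intro continuous_intros)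

lemma unit_direction: 
  obtains K :: "real ^ 'n" where "norm K = 1" "v = norm v *\<^sub>R K"
proof (cases "v = 0")
  case True
  then show ?thesis using unit_vector_exists that by auto
next
  case False
  then show ?thesis using that[of "v /\<^sub>R norm v"] by simp
qed

lemma sphere_param_in_slice_domain:
  assumes "axially_symmetric V" shows "sphere_param x \<in> slice_domain V \<longleftrightarrow> x \<in> V"
proof -
  obtain K where K: "norm K = 1" "snd x = norm (snd x) *\<^sub>R K" using unit_direction by blast
  have "(fst x, norm (snd x) *\<^sub>R K) = x" using K(2) by (simp only: prod_eq_iff fst_conv snd_conv simp_thms)
  with profile_iff[OF assms K(1), of "fst x" "norm (snd x)"] show ?thesis
    unfolding slice_domain_def sphere_param_def by (simp only: mem_Collect_eq complex.sel)
qed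

lemma Q_slice_factor: "Q_slice s x = (s - sphere_param x) * (s - cnj (sphere_param x))"
  by (simp add: Q_slice_def sphere_param_def complex_eq_iff power2_eq_square algebra_simps)

section \<open>The Cauchy formula on slices\<close>

text \<open>The usual notion of a cycle homologous to zero in \<open>\<Omega>\<close>.\<close>

definition null_cycle :: "complex set \<Rightarrow> (real \<Rightarrow> complex) set \<Rightarrow> bool" where
  "null_cycle \<Omega> G \<longleftrightarrow> cycle_in \<Omega> G \<and> (\<forall>z. z \<notin> \<Omega> \<longrightarrow> (\<Sum>g\<in>G. winding_number g z) = 0)"

definition encloses :: "(real \<Rightarrow> complex) set \<Rightarrow> complex \<Rightarrow> bool" where
  "encloses G z \<longleftrightarrow> (\<forall>g\<in>G. z \<notin> path_image g) \<and> (\<Sum>g\<in>G. winding_number g z) = 1"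

lemma encloses_in: "null_cycle \<Omega> G \<Longrightarrow> encloses G z \<Longrightarrow> z \<in> \<Omega>"
  unfolding null_cycle_def encloses_def by force

text \<open>With \<open>\<zeta> = x_0 + i |x|\<close>, the quotient \<open>(s - x_0) / Q\<close> is
  half the sum, and \<open>|x| / Q\<close> is \<open>1 / (2 i)\<close> times the difference, of
  \<open>1 / (s - \<zeta>)\<close> and \<open>1 / (s - cnj \<zeta>)\<close>; the symmetry of
  \<open>\<phi>\<close> turns sum and difference of its two values into real and imaginary part.
  Keeping the factor \<open>|x|\<close> makes the second formula valid on the real axis, where
  \<open>Q\<close> has a double zero.\<close>

lemma cauchy_representation:
  assumes \<Omega>: "open \<Omega>" and \<phi>: "\<phi> holomorphic_on \<Omega>" and G: "null_cycle \<Omega> G"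
    and enc: "encloses G (sphere_param x)" "encloses G (cnj (sphere_param x))"
    and cnj: "\<phi> (cnj (sphere_param x)) = cnj (\<phi> (sphere_param x))"
  shows "J_int G \<phi> 1 x = 2 * pi * \<i> * Re (\<phi> (sphere_param x))" (is ?J)
    and "of_real (norm (snd x)) * H_int G \<phi> 1 x = 2 * pi * \<i> * Im (\<phi> (sphere_param x))" (is ?H)
proof -
  define \<zeta> where "\<zeta> = sphere_param x"
  have cyc: "cycle_in \<Omega> G" using G by (simp add: null_cycle_def)
  have C: "cycle_integral G (\<lambda>w. \<phi> w / (w - z)) = 2 * pi * \<i> * \<phi> z" if "encloses G z" for z
  proof -
    have "cycle_integral G (\<lambda>w. \<phi> w / (w - z)) = 2 * pi * \<i> * (\<Sum>g\<in>G. winding_number g z) * \<phi> z"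
      using G that encloses_in[OF G that]
      by (intro Cauchy_integral_formula_cycle[OF \<Omega> \<phi> cyc]) (auto simp: null_cycle_def encloses_def)
    then show ?thesis using that by (simp add: encloses_def)
  qed
  have int: "(\<lambda>w. \<phi> w / (w - z)) contour_integrable_on g" if "g \<in> G" "encloses G z" for g z
  proof (rule contour_integrable_holomorphic_simple)
    show "(\<lambda>w. \<phi> w / (w - z)) holomorphic_on \<Omega> - {z}"
      by (intro holomorphic_intros holomorphic_on_subset[OF \<phi>]) auto
    show "open (\<Omega> - {z})" using \<Omega> by (rule open_delete)
    show "valid_path g" "path_image g \<subseteq> \<Omega> - {z}"
      using that cyc by (auto simp: cycle_in_def encloses_def)
  qed
  note enc = enc[folded \<zeta>_def]
  have ne: "w \<noteq> \<zeta>" "w \<noteq> cnj \<zeta>" if "w \<in> path_image g" "g \<in> G" for w g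
    using enc that by (auto simp: encloses_def)
  have re: "of_real (fst x) = (\<zeta> + cnj \<zeta>) / 2" and im: "of_real (norm (snd x)) = (\<zeta> - cnj \<zeta>) / (2 * \<i>)"
    by (simp_all add: \<zeta>_def sphere_param_def complex_eq_iff)
  have "J_int G \<phi> 1 x = (\<Sum>g\<in>G. contour_integral g (\<lambda>w. 1 / 2 * (\<phi> w / (w - \<zeta>)) + 1 / 2 * (\<phi> w / (w - cnj \<zeta>))))"
    unfolding J_int_def cycle_integral_def
  proof (intro sum.cong refl contour_integral_cong)
    fix g w assume "g \<in> G" "w \<in> path_image g"
    with ne show "\<phi> w * (w - of_real (fst x)) / Q_slice w x ^ 1 = 1 / 2 * (\<phi> w / (w - \<zeta>)) + 1 / 2 * (\<phi> w / (w - cnj \<zeta>))"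
      unfolding Q_slice_factor re \<zeta>_def[symmetric] by (simp add: divide_simps) (simp add: algebra_simps)
  qed
  also have "\<dots> = (\<Sum>g\<in>G. 1 / 2 * contour_integral g (\<lambda>w. \<phi> w / (w - \<zeta>)) + 1 / 2 * contour_integral g (\<lambda>w. \<phi> w / (w - cnj \<zeta>)))"
    by (intro sum.cong refl)
      (simp only: contour_integral_add contour_integral_lmul contour_integrable_lmul int enc)
  also have "\<dots> = 1 / 2 * (2 * pi * \<i> * \<phi> \<zeta>) + 1 / 2 * (2 * pi * \<i> * \<phi> (cnj \<zeta>))"
    unfolding C[OF enc(1), symmetric] C[OF enc(2), symmetric]
    by (simp add: cycle_integral_def sum.distrib sum_distrib_left sum_divide_distrib)
  also have "\<dots> = 2 * pi * \<i> * Re (\<phi> \<zeta>)"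
    using cnj by (simp add: \<zeta>_def complex_eq_iff)
  finally show ?J by (simp add: \<zeta>_def)
  have "of_real (norm (snd x)) * H_int G \<phi> 1 x =
      (\<Sum>g\<in>G. of_real (norm (snd x)) * contour_integral g (\<lambda>w. \<phi> w / Q_slice w x ^ 1))"
    by (simp add: H_int_def cycle_integral_def sum_distrib_left)
  also have "\<dots> = (\<Sum>g\<in>G. 1 / (2 * \<i>) * contour_integral g (\<lambda>w. \<phi> w / (w - \<zeta>)) - 1 / (2 * \<i>) * contour_integral g (\<lambda>w. \<phi> w / (w - cnj \<zeta>)))"
  proof (intro sum.cong refl)
    fix g assume g: "g \<in> G"
    have eq: "of_real (norm (snd x)) * (\<phi> w / Q_slice w x ^ 1) =
        1 / (2 * \<i>) * (\<phi> w / (w - \<zeta>)) - 1 / (2 * \<i>) * (\<phi> w / (w - cnj \<zeta>))" if "w \<in> path_image g" for w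
      using ne[OF that g]
      unfolding Q_slice_factor im \<zeta>_def[symmetric] by (simp add: divide_simps) (simp add: algebra_simps)
    have "of_real (norm (snd x)) * contour_integral g (\<lambda>w. \<phi> w / Q_slice w x ^ 1) =
        contour_integral g (\<lambda>w. of_real (norm (snd x)) * (\<phi> w / Q_slice w x ^ 1))"
    \<comment> \<open>Off the real axis, integrability of \<open>\<phi> / Q\<close> is obtained from
      the partial fractions by dividing by \<open>|x|\<close>; on the axis both sides are
      zero.\<close>
    proof (cases "norm (snd x) = 0")
      case False
      have "(\<lambda>w. of_real (norm (snd x)) * (\<phi> w / Q_slice w x ^ 1)) contour_integrable_on g"
        by (rule contour_integrable_eq[OF contour_integrable_diff[OF
            contour_integrable_lmul[OF int[OF g enc(1)]] contour_integrable_lmul[OF int[OF g enc(2)]]]])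
          (rule eq[symmetric])
      then have "(\<lambda>w. \<phi> w / Q_slice w x ^ 1) contour_integrable_on g"
        by (subst (asm) contour_integrable_lmul_iff) (use False in auto)
      then show ?thesis by (simp only: contour_integral_lmul)
    qed simp
    also have "\<dots> = contour_integral g (\<lambda>w. 1 / (2 * \<i>) * (\<phi> w / (w - \<zeta>)) - 1 / (2 * \<i>) * (\<phi> w / (w - cnj \<zeta>)))"
      using eq by (intro contour_integral_cong refl)
    also have "\<dots> = 1 / (2 * \<i>) * contour_integral g (\<lambda>w. \<phi> w / (w - \<zeta>)) - 1 / (2 * \<i>) * contour_integral g (\<lambda>w. \<phi> w / (w - cnj \<zeta>))"
      by (simp only: contour_integral_diff contour_integral_lmul contour_integrable_lmul int g enc)
    finally show "of_real (norm (snd x)) * contour_integral g (\<lambda>w. \<phi> w / Q_slice w x ^ 1) = \<dots>" .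
  qed
  also have "\<dots> = 1 / (2 * \<i>) * (2 * pi * \<i> * \<phi> \<zeta>) - 1 / (2 * \<i>) * (2 * pi * \<i> * \<phi> (cnj \<zeta>))"
    unfolding C[OF enc(1), symmetric] C[OF enc(2), symmetric]
    by (simp only: cycle_integral_def sum_subtractf sum_distrib_left)
  also have "\<dots> = 2 * pi * \<i> * Im (\<phi> \<zeta>)"
    using cnj by (simp add: \<zeta>_def complex_eq_iff)
  finally show ?H by (simp add: \<zeta>_def)
qed

lemma off_cycleI:
  assumes "\<And>x. x \<in> W \<Longrightarrow> encloses G (sphere_param x) \<and> encloses G (cnj (sphere_param x))"
  shows "W \<subseteq> off_cycle G"
  using assms unfolding off_cycle_def Q_slice_factor encloses_def by auto

text \<open>The complex unit stands for the imaginary unit in \<open>a + I b\<close>, so one scalar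
  function serves all \<open>I\<close>.\<close>

definition slice_component ::
    "(real \<times> real \<Rightarrow> 'n::{finite,linorder} clifford) \<Rightarrow> (real \<times> real \<Rightarrow> 'n clifford) \<Rightarrow> 'n clifford \<Rightarrow> complex \<Rightarrow> complex" where
  "slice_component a b e z = Complex (a (Re z, Im z) \<bullet> e) (b (Re z, Im z) \<bullet> e)"

text \<open>Taking the coordinate along \<open>e\<close> commutes with derivatives, so the system
  for \<open>a\<close> and \<open>b\<close> becomes the Cauchy-Riemann system of a scalar
  function.\<close>

lemma slice_component_holomorphic:
  fixes V :: "'n::finite point set" and a b :: "real \<times> real \<Rightarrow> 'm::{finite,linorder} clifford"
  assumes "open (slice_domain V)" "Cauchy_Riemann_on (profile V) a b"
  shows "slice_component a b e holomorphic_on slice_domain V"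
proof (rule holomorphic_on_open[THEN iffD2, OF assms(1)], rule ballI)
  fix z assume "z \<in> slice_domain V"
  define p where "p = (\<lambda>z :: complex. (Re z, Im z))"
  have "p z \<in> profile V" using \<open>z \<in> slice_domain V\<close> by (simp add: slice_domain_def p_def)
  then obtain a' b' where ab: "(a has_derivative a') (at (p z))" "(b has_derivative b') (at (p z))"
    and CR: "directional_derivative (1, 0) a (p z) = directional_derivative (0, 1) b (p z)"
      "directional_derivative (0, 1) a (p z) = - directional_derivative (1, 0) b (p z)"
    using assms(2) unfolding Cauchy_Riemann_on_def differentiable_def by blast
  have CR': "b' (0, 1) = a' (1, 0)" "a' (0, 1) = - b' (1, 0)"
    using CR by (simp_all add: directional_derivative_eq[OF ab(1)] directional_derivative_eq[OF ab(2)])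
  have split: "c (p h) = Re h *\<^sub>R c (1, 0) + Im h *\<^sub>R c (0, 1)" if "linear c"
    for c :: "real \<times> real \<Rightarrow> 'm clifford" and h
  proof -
    have "p h = Re h *\<^sub>R (1, 0) + Im h *\<^sub>R (0, 1)" by (simp add: p_def)
    then show ?thesis by (simp only: linear_add[OF that] linear_cmul[OF that])
  qed
  have dp: "(p has_derivative p) (at z)"
    unfolding p_def by (intro bounded_linear_imp_has_derivative bounded_linear_Pair bounded_linear_Re bounded_linear_Im)
  have "((\<lambda>z. of_real (a (p z) \<bullet> e) + \<i> * of_real (b (p z) \<bullet> e)) has_derivative
      (\<lambda>h. of_real (a' (p h) \<bullet> e) + \<i> * of_real (b' (p h) \<bullet> e))) (at z)"
    by (intro has_derivative_add has_derivative_mult_right has_derivative_of_real has_derivative_inner_left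
      has_derivative_compose[OF dp] ab)
  moreover have "(\<lambda>h. of_real (a' (p h) \<bullet> e) + \<i> * of_real (b' (p h) \<bullet> e)) =
      (*) (of_real (a' (1, 0) \<bullet> e) + \<i> * of_real (b' (1, 0) \<bullet> e))"
    by (auto simp: fun_eq_iff split[OF has_derivative_linear[OF ab(1)]] split[OF has_derivative_linear[OF ab(2)]] CR'
      inner_add_left complex_eq_iff algebra_simps)
  moreover have "slice_component a b e = (\<lambda>z. of_real (a (p z) \<bullet> e) + \<i> * of_real (b (p z) \<bullet> e))"
    by (auto simp: slice_component_def p_def fun_eq_iff complex_eq_iff)
  ultimately have "(slice_component a b e has_field_derivative
      (of_real (a' (1, 0) \<bullet> e) + \<i> * of_real (b' (1, 0) \<bullet> e))) (at z)"
    by (simp add: has_field_derivative_def)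
  then show "\<exists>f'. (slice_component a b e has_field_derivative f') (at z)" by blast
qed

lemma slice_component_cnj:
  assumes "even_odd_on (profile V) a b" "z \<in> slice_domain V"
  shows "slice_component a b e (cnj z) = cnj (slice_component a b e z)"
  using assms by (force simp: even_odd_on_def slice_domain_def slice_component_def complex_eq_iff)

text \<open>\<open>\<odot>\<close> is the product or the opposite product. Both are associative and
  real bilinear, commute on the plane of a unit \<open>I\<close> and have the same squares; these
  common properties let left and right be proved at once.\<close>

locale slice_mult =
  fixes mul :: "'n::{finite,linorder} clifford \<Rightarrow> 'n clifford \<Rightarrow> 'n clifford" (infixl "\<odot>" 70)
  assumes mul_cases: "(\<odot>) = (*) \<or> (\<odot>) = (\<lambda>a b. b * a)"
begin

sublocale mul: bounded_bilinear "(\<odot>)"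
  using mul_cases bounded_bilinear_times_clifford
    bounded_bilinear.flip[OF bounded_bilinear_times_clifford] by auto

lemma mul_assoc: "a \<odot> b \<odot> c = a \<odot> (b \<odot> c)"
  using mul_cases by (auto simp: mult.assoc)

lemma mul_of_real: "of_real r \<odot> a = r *\<^sub>R a" "a \<odot> of_real r = r *\<^sub>R a"
  using mul_cases by (auto simp: of_real_def)

lemma mul_self: "a \<odot> a = a * a"
  using mul_cases by auto

lemma mul_emb: "norm I = 1 \<Longrightarrow> emb I z \<odot> emb I w = emb I (z * w)"
  using mul_cases by (auto simp: emb_mult mult.commute)

text \<open>The factor \<open>-\<i>\<close> is that of \<open>ds_I\<close>; it sends the value
  \<open>2 * pi * \<i> * r\<close> of a Cauchy integral, with \<open>r\<close> real, to
  \<open>2 * pi * r\<close> times \<open>e\<close>.\<close>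

definition coef :: "real ^ ('n::{finite,linorder}) \<Rightarrow> 'n clifford \<Rightarrow> complex \<Rightarrow> 'n clifford" where
  "coef I e w = emb I (- \<i> * w) \<odot> e"

lemma bounded_linear_coef: "bounded_linear (coef I e)"
  unfolding coef_def[abs_def]
  by (intro bounded_linear_compose[OF mul.bounded_linear_left] bounded_linear_compose[OF bounded_linear_emb]
    bounded_linear_mult_right)

lemma vector_part_mul: "vector_part v \<odot> a = (\<Sum>j\<in>UNIV. (v $ j) *\<^sub>R (gen j \<odot> a))"
  by (simp add: vector_part_eq mul.sum_left mul.scaleR_left)

lemma emb_mul: "emb I w \<odot> a = Re w *\<^sub>R a + Im w *\<^sub>R (vector_part I \<odot> a)"
  by (simp add: emb_def mul.add_left mul.scaleR_left mul_of_real)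

definition slice_pair :: "'n::{finite,linorder} point set \<Rightarrow> ('n point \<Rightarrow> 'n clifford) \<Rightarrow> (real \<times> real \<Rightarrow> 'n clifford) \<Rightarrow>
    (real \<times> real \<Rightarrow> 'n clifford) \<Rightarrow> bool" where
  "slice_pair V f a b \<longleftrightarrow> even_odd_on (profile V) a b \<and> Cauchy_Riemann_on (profile V) a b \<and>
    (\<forall>I u v. norm I = 1 \<longrightarrow> (u, v) \<in> profile V \<longrightarrow> f (u, v *\<^sub>R I) = a (u, v) + vector_part I \<odot> b (u, v))"

lemma slice_pair_expansion:
  assumes "slice_pair V f a b" "norm I = 1" "z \<in> slice_domain V"
  shows "f (slice I z) = (\<Sum>e\<in>Basis. emb I (slice_component a b e z) \<odot> e)"
proof -
  have "f (slice I z) = a (Re z, Im z) + vector_part I \<odot> b (Re z, Im z)"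
    using assms by (auto simp: slice_pair_def slice_domain_def slice_def)
  also have "\<dots> = (\<Sum>e\<in>Basis. (a (Re z, Im z) \<bullet> e) *\<^sub>R e) + vector_part I \<odot> (\<Sum>e\<in>Basis. (b (Re z, Im z) \<bullet> e) *\<^sub>R e)"
    by (simp only: euclidean_representation)
  also have "\<dots> = (\<Sum>e\<in>Basis. emb I (slice_component a b e z) \<odot> e)"
    by (simp add: emb_mul slice_component_def sum.distrib mul.sum_right mul.scaleR_right)
  finally show ?thesis .
qed

definition dirac :: "('n::{finite,linorder} point \<Rightarrow> 'n clifford) \<Rightarrow> 'n point \<Rightarrow> 'n clifford" where
  "dirac g x = directional_derivative (1, 0) g x + (\<Sum>i\<in>UNIV. gen i \<odot> directional_derivative (0, axis i 1) g x)"

text \<open>For the opposite product this is the right kernel: powers are the same for both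
  products, and only the order of the two factors is reversed.\<close>

definition kernel :: "nat \<Rightarrow> 'n::{finite,linorder} point \<Rightarrow> 'n point \<Rightarrow> 'n clifford" where
  "kernel \<alpha> s x = kernel_const (sce_exponent TYPE('n)) \<alpha> *\<^sub>R
     ((paravector s - paravector (conj_point x)) \<odot> cl_inverse (Q_c s x) ^ (\<alpha> + 1))"

definition kernel_integral ::
    "nat \<Rightarrow> real ^ ('n::{finite,linorder}) \<Rightarrow> (real \<Rightarrow> complex) set \<Rightarrow> ('n point \<Rightarrow> 'n clifford) \<Rightarrow> 'n point \<Rightarrow> 'n clifford" where
  "kernel_integral \<alpha> I G f x = (\<Sum>g\<in>G. integral {0..1}
     (\<lambda>t. kernel \<alpha> (slice I (g t)) x \<odot> ds_I I g t \<odot> f (slice I (g t))))"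

end

lemma kernel_const_Suc: "kernel_const h (Suc k) = 4 * (real k + 1) * (real k - real h) * kernel_const h k"
  by (simp add: kernel_const_def pochhammer_Suc algebra_simps)

section \<open>Powers of the Laplacian of slice hyperholomorphic functions\<close>

lemma gen_mult_self: "gen i * gen i = (- 1 :: 'n::{finite,linorder} clifford)"
proof -
  have "vector_part (axis i 1) = (gen i :: 'n clifford)"
    by (simp add: vector_part_eq axis_component if_distrib if_distribR cong: if_cong)
  then show ?thesis using vector_part_mult_self[of "axis i 1 :: real ^ ('n::{finite,linorder})"] by simp
qed

text \<open>\<open>Z\<close> is an open set of points that the cycle encloses together with their
  conjugates. Two instances are used: small circles with a disc as \<open>Z\<close>, and the
  boundary of a slice of \<open>U\<close> with that slice as \<open>Z\<close>.\<close>

locale slice_cycle = slice_mult mul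
  for mul :: "'n::{finite,linorder} clifford \<Rightarrow> 'n clifford \<Rightarrow> 'n clifford" (infixl "\<odot>" 70) +
  fixes V :: "'n point set" and f :: "'n point \<Rightarrow> 'n clifford"
    and a b :: "real \<times> real \<Rightarrow> 'n clifford" and I :: "real ^ ('n::{finite,linorder})"
    and G :: "(real \<Rightarrow> complex) set" and Z :: "complex set"
  assumes open_V: "open V" and sym_V: "axially_symmetric V" and pair: "slice_pair V f a b"
    and unit: "norm I = 1" and null: "null_cycle (slice_domain V) G"
    and open_Z: "open Z" and enc: "z \<in> Z \<Longrightarrow> encloses G z \<and> encloses G (cnj z)"
begin

definition W :: "'n::{finite,linorder} point set" where "W = sphere_param -` Z"

abbreviation \<phi> :: "'n::{finite,linorder} clifford \<Rightarrow> complex \<Rightarrow> complex" where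
  "\<phi> e \<equiv> slice_component a b e"

lemma open_W: "open W"
  unfolding W_def by (intro open_vimage open_Z continuous_on_sphere_param)

lemma hol_\<phi>: "\<phi> e holomorphic_on slice_domain V"
  using pair by (intro slice_component_holomorphic open_slice_domain open_V sym_V) (simp add: slice_pair_def)

lemma cycle: "cycle_in (slice_domain V) G"
  using null by (simp add: null_cycle_def)

lemma enc_W: "x \<in> W \<Longrightarrow> encloses G (sphere_param x)" "x \<in> W \<Longrightarrow> encloses G (cnj (sphere_param x))"
  using enc by (auto simp: W_def)

lemma W_off: "W \<subseteq> off_cycle G"
  using enc_W by (intro off_cycleI) auto

lemma W_domain: "x \<in> W \<Longrightarrow> sphere_param x \<in> slice_domain V"
  using encloses_in[OF null] enc_W by blast

sublocale A: axial_transform "slice_domain V" "\<phi> e" G W "coef I e" "\<lambda>j w. gen j \<odot> coef I e w" for e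
  by (intro axial_transform.intro cauchy_transform.intro axial_transform_axioms.intro
      open_slice_domain open_V sym_V hol_\<phi> cycle open_W W_off bounded_linear_coef
      bounded_linear_compose[OF mul.bounded_linear_right])

lemma radial_eq: "A.radial e g x = vector_part (snd x) \<odot> coef I e (g x)"
  by (simp add: A.radial_def vector_part_mul)

lemma axial_eq: "A.axial e k x = coef I e (J_int G (\<phi> e) k x) + vector_part (snd x) \<odot> coef I e (H_int G (\<phi> e) k x)"
  by (simp add: A.axial_def radial_eq)

definition total :: "nat \<Rightarrow> 'n::{finite,linorder} point \<Rightarrow> 'n clifford" where
  "total k x = (\<Sum>e\<in>Basis. A.axial e k x)"

text \<open>The integrals are taken in the plane of \<open>I\<close>, while \<open>x\<close> points
  along another unit \<open>K\<close>. By Cauchy's formula \<open>coef\<close> maps \<open>J\<close>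
  and \<open>|x| H\<close> to real multiples of \<open>e\<close>, after which only \<open>K\<close>
  is left and the expansion of \<open>f\<close> in the plane of \<open>K\<close> appears.\<close>

lemma f_eq:
  assumes x: "x \<in> W" shows "f x = (1 / (2 * pi)) *\<^sub>R total 1 x"
proof -
  let ?\<zeta> = "sphere_param x"
  obtain K where K: "norm K = 1" "snd x = norm (snd x) *\<^sub>R K" using unit_direction by blast
  have xK: "x = slice K ?\<zeta>"
    using K(2) unfolding slice_def sphere_param_def complex.sel by (metis prod.collapse)
  have z: "?\<zeta> \<in> slice_domain V" using W_domain[OF x] .
  have "A.axial e 1 x = (2 * pi) *\<^sub>R (emb K (\<phi> e ?\<zeta>) \<odot> e)" for e
  proof -
    have sym: "\<phi> e (cnj ?\<zeta>) = cnj (\<phi> e ?\<zeta>)"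
      using pair z by (intro slice_component_cnj) (auto simp: slice_pair_def)
    note rep = cauchy_representation[OF open_slice_domain[OF open_V sym_V] hol_\<phi> null enc_W(1)[OF x] enc_W(2)[OF x] sym]
    have "vector_part (snd x) = norm (snd x) *\<^sub>R vector_part K"
      using linear_cmul[OF linear_vector_part, of "norm (snd x)" K] K(2) by simp
    then have "vector_part (snd x) \<odot> coef I e (H_int G (\<phi> e) 1 x) =
        vector_part K \<odot> coef I e (of_real (norm (snd x)) * H_int G (\<phi> e) 1 x)"
      by (simp add: mul.scaleR_left mul.scaleR_right linear_cmul[OF bounded_linear.linear[OF bounded_linear_coef]]
        flip: scaleR_conv_of_real)
    also have "\<dots> = (2 * pi) *\<^sub>R (Im (\<phi> e ?\<zeta>) *\<^sub>R (vector_part K \<odot> e))"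
    proof -
      have "coef I e (of_real (norm (snd x)) * H_int G (\<phi> e) 1 x) = emb I (of_real (2 * pi * Im (\<phi> e ?\<zeta>))) \<odot> e"
        unfolding rep(2) coef_def by (simp add: mult_ac)
      then show ?thesis by (simp only: emb_of_real mul_of_real mul.scaleR_right scaleR_scaleR)
    qed
    finally have 1: "vector_part (snd x) \<odot> coef I e (H_int G (\<phi> e) 1 x) = (2 * pi) *\<^sub>R (Im (\<phi> e ?\<zeta>) *\<^sub>R (vector_part K \<odot> e))" .
    have "coef I e (J_int G (\<phi> e) 1 x) = emb I (of_real (2 * pi * Re (\<phi> e ?\<zeta>))) \<odot> e"
      unfolding rep(1) coef_def by (simp add: mult_ac)
    then have 2: "coef I e (J_int G (\<phi> e) 1 x) = (2 * pi) *\<^sub>R (Re (\<phi> e ?\<zeta>) *\<^sub>R e)"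
      by (simp only: emb_of_real mul_of_real scaleR_scaleR)
    show ?thesis
      unfolding axial_eq 1 2 emb_mul by (simp only: scaleR_add_right)
  qed
  then have "total 1 x = (2 * pi) *\<^sub>R (\<Sum>e\<in>Basis. emb K (\<phi> e ?\<zeta>) \<odot> e)"
    by (simp add: total_def scaleR_sum_right)
  also have "\<dots> = (2 * pi) *\<^sub>R f (slice K ?\<zeta>)"
    by (simp only: slice_pair_expansion[OF pair K(1) z])
  finally show ?thesis using xK by simp
qed

lemma class_C_total: "class_C j W (\<lambda>x. c *\<^sub>R total k x)"
  unfolding total_def
  by (intro class_C_scaleR[OF open_W class_C_const] class_C_sum open_W A.class_C_axial)

lemma laplacian_total:
  assumes x: "x \<in> W"
  shows "laplacian (\<lambda>x. c *\<^sub>R total k x) x = (c * (2 * real k * (2 * real k - 1 - real CARD('n)))) *\<^sub>R total (Suc k) x"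
proof -
  have "laplacian (\<lambda>x. c *\<^sub>R total k x) x = c *\<^sub>R laplacian (total k) x"
    using class_C_total[of 2 1 k] by (intro laplacian_linear[OF open_W x] bounded_linear_scaleR_right) simp
  also have "laplacian (total k) x = (\<Sum>e\<in>Basis. laplacian (A.axial e k) x)"
    unfolding total_def[abs_def] by (intro laplacian_sum[OF open_W x] A.class_C_axial)
  finally show ?thesis
    by (simp add: A.laplacian_axial[OF x] total_def scaleR_sum_right)
qed

text \<open>The index is one ahead of the power. With \<open>n = 2 h + 1\<close> the factor of
  \<open>laplacian_axial\<close> at index \<open>k + 1\<close> is \<open>4 (k + 1) (k - h)\<close>,
  the factor in the recursion \<open>kernel_const_Suc\<close>.\<close>

lemma laplacian_power_f:
  assumes odd: "odd CARD('n)" and x: "x \<in> W"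
  shows "(laplacian ^^ k) f x = (kernel_const (sce_exponent TYPE('n)) k / (2 * pi)) *\<^sub>R total (Suc k) x"
  using x
proof (induction k arbitrary: x)
  case 0
  then show ?case using f_eq by (simp add: kernel_const_def)
next
  case (Suc k)
  let ?h = "sce_exponent TYPE('n)"
  have n: "real CARD('n) = 2 * real ?h + 1"
    using odd by (auto simp: sce_exponent_def elim!: oddE)
  have "(laplacian ^^ Suc k) f x = laplacian (\<lambda>x. (kernel_const ?h k / (2 * pi)) *\<^sub>R total (Suc k) x) x"
    unfolding funpow.simps o_apply by (rule laplacian_cong[OF open_W Suc.prems Suc.IH])
  also have "\<dots> = (kernel_const ?h (Suc k) / (2 * pi)) *\<^sub>R total (Suc (Suc k)) x"
    unfolding laplacian_total[OF Suc.prems] kernel_const_Suc n by (simp add: field_simps)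
  finally show ?case .
qed

lemma class_C_laplacian_power_f:
  assumes "odd CARD('n)" shows "class_C j W ((laplacian ^^ k) f)"
  by (subst class_C_cong[OF open_W laplacian_power_f[OF assms]]) (auto intro: class_C_total)

text \<open>Multiplying by \<open>gen i\<close> and summing turns the coordinates back into the
  vector part, whose square is \<open>-|x|^2\<close>: the terms at index \<open>k + 1\<close> cancel
  against those of the \<open>x_0\<close> derivative, and the squares of the generators contribute
  \<open>-n\<close>.\<close>

lemma dirac_axial:
  assumes x: "x \<in> W"
  shows "dirac (A.axial e k) x = (2 * real k - 1 - real CARD('n)) *\<^sub>R coef I e (H_int G (\<phi> e) k x)"
proof -
  let ?v = "vector_part (snd x)"
  have gg: "gen i \<odot> (gen i \<odot> c) = - c" for i c
    by (simp add: mul_assoc[symmetric] mul_self gen_mult_self)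
      (use mul_of_real(1)[of "-1" c] in simp)
  have vv: "?v \<odot> (?v \<odot> c) = - ((norm (snd x))\<^sup>2 *\<^sub>R c)" for c
    using mul_of_real(1)[of "- (norm (snd x))\<^sup>2" c]
    by (simp only: mul_assoc[symmetric] mul_self vector_part_mult_self scaleR_minus_left)
  have "(\<Sum>i\<in>UNIV. gen i \<odot> directional_derivative (0, axis i 1) (A.axial e k) x) =
      - (real CARD('n) *\<^sub>R coef I e (H_int G (\<phi> e) k x)) - (2 * real k) *\<^sub>R (?v \<odot> A.axial e (Suc k) x)"
    unfolding A.axial_dd(2)[OF x] vector_part_mul
    by (simp add: mul.diff_right mul.scaleR_right gg sum_subtractf sum_negf scaleR_sum_right sum_constant_scaleR del: sum_constant)
  then show ?thesis
    unfolding dirac_def A.axial_dd(1)[OF x] radial_eq axial_eq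
    by (simp add: mul.add_right vv algebra_simps)
qed

lemma dirac_total:
  assumes x: "x \<in> W"
  shows "dirac (\<lambda>x. c *\<^sub>R total k x) x =
    (c * (2 * real k - 1 - real CARD('n))) *\<^sub>R (\<Sum>e\<in>Basis. coef I e (H_int G (\<phi> e) k x))"
proof -
  have diff: "A.axial e k differentiable (at x)" for e
    using A.class_C_axial[of "Suc 0"] x by auto
  have "directional_derivative d (\<lambda>x. c *\<^sub>R total k x) x = c *\<^sub>R (\<Sum>e\<in>Basis. directional_derivative d (A.axial e k) x)" for d
    unfolding total_def using diff
    by (subst directional_derivative_linear[OF _ bounded_linear_scaleR_right])
      (auto simp: directional_derivative_sum intro!: differentiable_sum)
  then have "dirac (\<lambda>x. c *\<^sub>R total k x) x = c *\<^sub>R (\<Sum>e\<in>Basis. dirac (A.axial e k) x)"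
    unfolding dirac_def
    by (simp add: mul.scaleR_right mul.sum_right sum.distrib scaleR_add_right scaleR_sum_right sum.swap[of _ Basis])
  then show ?thesis
    unfolding dirac_axial[OF x] by (simp add: scaleR_sum_right)
qed

lemma dirac_cong:
  assumes "x \<in> W" "\<And>y. y \<in> W \<Longrightarrow> g y = h y" shows "dirac g x = dirac h x"
  unfolding dirac_def using directional_derivative_cong[OF open_W assms] by simp

lemma laplacian_power_H:
  assumes x: "x \<in> W"
  shows "(laplacian ^^ j) (\<lambda>x. c *\<^sub>R (\<Sum>e\<in>Basis. coef I e (H_int G (\<phi> e) p x))) x =
    (c * (\<Prod>i<j. 2 * real (p + i) * (2 * real (p + i) + 1 - real CARD('n)))) *\<^sub>R
      (\<Sum>e\<in>Basis. coef I e (H_int G (\<phi> e) (p + j) x))"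
  using x
proof (induction j arbitrary: x)
  case (Suc j)
  let ?c = "c * (\<Prod>i<j. 2 * real (p + i) * (2 * real (p + i) + 1 - real CARD('n)))"
  let ?S = "\<lambda>q x. \<Sum>e\<in>Basis. coef I e (H_int G (\<phi> e) q x)"
  have "(laplacian ^^ Suc j) (\<lambda>x. c *\<^sub>R ?S p x) x = laplacian (\<lambda>x. ?c *\<^sub>R ?S (p + j) x) x"
    unfolding funpow.simps o_apply by (rule laplacian_cong[OF open_W Suc.prems Suc.IH])
  also have "\<dots> = ?c *\<^sub>R laplacian (?S (p + j)) x"
    by (intro laplacian_linear[OF open_W Suc.prems] bounded_linear_scaleR_right class_C_sum open_W A.class_C_PH)
  also have "laplacian (?S (p + j)) x = (\<Sum>e\<in>Basis. laplacian (\<lambda>x. coef I e (H_int G (\<phi> e) (p + j) x)) x)"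
    by (intro laplacian_sum[OF open_W Suc.prems] A.class_C_PH)
  also have "\<dots> = (2 * real (p + j) * (2 * real (p + j) + 1 - real CARD('n))) *\<^sub>R ?S (p + Suc j) x"
    unfolding A.laplacian_PH[OF Suc.prems] by (simp add: scaleR_sum_right)
  finally show ?case by (simp add: mult_ac)
qed simp

lemma Cliffordian_equation:
  assumes odd: "odd CARD('n)" and \<alpha>: "\<alpha> < sce_exponent TYPE('n)" and x: "x \<in> W"
  shows "(laplacian ^^ (sce_exponent TYPE('n) - \<alpha>)) (dirac ((laplacian ^^ \<alpha>) f)) x = 0"
proof -
  let ?h = "sce_exponent TYPE('n)"
  have n: "real CARD('n) = 2 * real ?h + 1"
    using odd by (auto simp: sce_exponent_def elim!: oddE)
  let ?c = "kernel_const ?h \<alpha> / (2 * pi)"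
  have "dirac ((laplacian ^^ \<alpha>) f) y = (?c * (2 * real (Suc \<alpha>) - 1 - real CARD('n))) *\<^sub>R
      (\<Sum>e\<in>Basis. coef I e (H_int G (\<phi> e) (Suc \<alpha>) y))" if y: "y \<in> W" for y
    using dirac_cong[OF y laplacian_power_f[OF odd]] dirac_total[OF y] by simp
  then have "(laplacian ^^ (?h - \<alpha>)) (dirac ((laplacian ^^ \<alpha>) f)) x =
      (laplacian ^^ (?h - \<alpha>)) (\<lambda>y. (?c * (2 * real (Suc \<alpha>) - 1 - real CARD('n))) *\<^sub>R
      (\<Sum>e\<in>Basis. coef I e (H_int G (\<phi> e) (Suc \<alpha>) y))) x"
    by (intro laplacian_power_cong[OF open_W x])
  \<comment> \<open>The last factor, \<open>i = h - \<alpha> - 1\<close>, sits at index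
    \<open>h\<close>, where \<open>2 h + 1 - n = 0\<close>; it occurs because
    \<open>\<alpha> < h\<close>.\<close>
  moreover have "(\<Prod>i<?h - \<alpha>. 2 * real (Suc \<alpha> + i) * (2 * real (Suc \<alpha> + i) + 1 - real CARD('n))) = 0"
  proof (rule prod_zero)
    show "\<exists>i\<in>{..<?h - \<alpha>}. 2 * real (Suc \<alpha> + i) * (2 * real (Suc \<alpha> + i) + 1 - real CARD('n)) = 0"
      using \<alpha> n by (intro bexI[of _ "?h - \<alpha> - 1"]) (auto simp: of_nat_diff)
  qed simp
  ultimately show ?thesis
    unfolding laplacian_power_H[OF x] by simp
qed

text \<open>\<open>H\<close> and \<open>J\<close> are constant on the sphere of \<open>x\<close>,
  since \<open>x_0\<close> and \<open>Q_slice\<close> are; only the unit direction varies.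
  \<open>axial_decomposition\<close> assembles \<open>A\<close> and \<open>B\<close> from this
  statement about single spheres.\<close>

lemma axial_form:
  assumes odd: "odd CARD('n)" and x: "x \<in> W"
  shows "\<exists>X Y. \<forall>K. norm K = 1 \<longrightarrow> (laplacian ^^ k) f (fst x, norm (snd x) *\<^sub>R K) = X + vector_part K \<odot> Y"
proof -
  let ?c = "kernel_const (sce_exponent TYPE('n)) k / (2 * pi)"
  let ?S = "\<lambda>F. ?c *\<^sub>R (\<Sum>e\<in>Basis. coef I e (F G (\<phi> e) (Suc k) x))"
  have "(laplacian ^^ k) f (fst x, norm (snd x) *\<^sub>R K) = ?S J_int + vector_part K \<odot> (norm (snd x) *\<^sub>R ?S H_int)" if "norm K = 1" for K
  proof -
    let ?y = "(fst x, norm (snd x) *\<^sub>R K)"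
    have sp: "sphere_param ?y = sphere_param x" using that by (simp add: sphere_param_def)
    then have y: "?y \<in> W" using x by (simp add: W_def)
    have Q: "Q_slice s ?y = Q_slice s x" for s by (simp add: Q_slice_factor sp)
    have "H_int G (\<phi> e) j ?y = H_int G (\<phi> e) j x" "J_int G (\<phi> e) j ?y = J_int G (\<phi> e) j x" for e j
      by (simp_all add: H_int_def J_int_def Q)
    then show ?thesis
      unfolding laplacian_power_f[OF odd y] total_def axial_eq
      by (simp add: linear_cmul[OF linear_vector_part] mul.scaleR_left mul.scaleR_right mul.sum_right
        sum.distrib scaleR_add_right scaleR_sum_right mult_ac)
  qed
  then show ?thesis by blast
qed

text \<open>The difference of \<open>s\<close> and the conjugate of \<open>x\<close> splits into
  \<open>s - x_0\<close> and the vector part of \<open>x\<close>. Everything but this vector part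
  and the basis element \<open>e\<close> lies in the commutative plane of \<open>I\<close>, so the
  two summands give the integrands of \<open>J\<close> and \<open>H\<close>.\<close>

lemma kernel_integrand:
  assumes s: "s \<in> slice_domain V" "Q_slice s x \<noteq> 0"
  shows "kernel k (slice I s) x \<odot> (emb I w \<odot> - vector_part I) \<odot> f (slice I s) =
    kernel_const (sce_exponent TYPE('n)) k *\<^sub>R (\<Sum>e\<in>Basis.
      coef I e (\<phi> e s * (s - of_real (fst x)) / Q_slice s x ^ Suc k * w) +
      vector_part (snd x) \<odot> coef I e (\<phi> e s / Q_slice s x ^ Suc k * w))"
proof -
  have lin: "linear (emb I)" using bounded_linear_emb by (rule bounded_linear.linear)
  define q where "q = 1 / Q_slice s x ^ Suc k"
  have q: "cl_inverse (Q_c (slice I s) x) ^ (k + 1) = emb I q"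
    by (simp add: Q_c_slice[OF unit] cl_inverse_emb[OF unit s(2)] emb_power[OF unit] q_def power_divide
        del: power_Suc)
  have "vector_part (- snd x) = - vector_part (snd x)"
    by (rule linear_neg[OF linear_vector_part])
  then have u: "paravector (slice I s) - paravector (conj_point x) = emb I (s - of_real (fst x)) + vector_part (snd x)"
    unfolding paravector_slice paravector_eq[of "conj_point x"] linear_diff[OF lin]
    by (simp add: conj_point_def)
  have d: "emb I w \<odot> - vector_part I = emb I (w * - \<i>)"
  proof -
    have "- vector_part I = emb I (- \<i>)" by (simp add: emb_def)
    then show ?thesis using mul_emb[OF unit] by simp
  qed
  have e: "(emb I u + vector_part (snd x)) \<odot> emb I q \<odot> emb I (w * - \<i>) \<odot> (emb I c \<odot> e) =
      coef I e (c * u * q * w) + vector_part (snd x) \<odot> coef I e (c * q * w)" for u c e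
  proof -
    have "emb I u \<odot> emb I q \<odot> emb I (w * - \<i>) \<odot> (emb I c \<odot> e) = emb I (u * q * (w * - \<i>) * c) \<odot> e"
      by (simp only: mul_emb[OF unit] flip: mul_assoc)
    moreover have "vector_part (snd x) \<odot> emb I q \<odot> emb I (w * - \<i>) \<odot> (emb I c \<odot> e) =
        vector_part (snd x) \<odot> (emb I q \<odot> emb I (w * - \<i>) \<odot> emb I c \<odot> e)"
      by (simp only: mul_assoc)
    ultimately show ?thesis
      by (simp add: mul.add_left coef_def mul_emb[OF unit] mult_ac)
  qed
  show ?thesis
    unfolding kernel_def q u d slice_pair_expansion[OF pair unit s(1)] mul.scaleR_left mul.sum_right e
    by (simp add: q_def scaleR_sum_right)
qed

lemma kernel_integral_eq:
  assumes x: "x \<in> W"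
  shows "kernel_integral k I G f x = kernel_const (sce_exponent TYPE('n)) k *\<^sub>R total (Suc k) x"
proof -
  let ?c = "kernel_const (sce_exponent TYPE('n)) k"
  let ?h = "\<lambda>e s. \<phi> e s / Q_slice s x ^ Suc k" and ?j = "\<lambda>e s. \<phi> e s * (s - of_real (fst x)) / Q_slice s x ^ Suc k"
  have "integral {0..1} (\<lambda>t. kernel k (slice I (g t)) x \<odot> ds_I I g t \<odot> f (slice I (g t))) =
      ?c *\<^sub>R (\<Sum>e\<in>Basis. coef I e (contour_integral g (?j e)) + vector_part (snd x) \<odot> coef I e (contour_integral g (?h e)))"
    if g: "g \<in> G" for g
  proof (rule integral_unique)
    let ?D = "slice_domain V - {sphere_param x, cnj (sphere_param x)}"
    have g': "valid_path g" "path_image g \<subseteq> ?D"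
      using cycle g enc_W[OF x] by (auto simp: cycle_in_def encloses_def)
    have Q: "Q_slice s x \<noteq> 0" if "s \<in> ?D" for s using that by (simp add: Q_slice_factor)
    have oD: "open ?D" using open_slice_domain[OF open_V sym_V] by (intro open_Diff) auto
    have h\<phi>: "\<phi> e holomorphic_on ?D" for e by (rule holomorphic_on_subset[OF hol_\<phi>]) auto
    have Q': "Q_slice s x ^ Suc k \<noteq> 0" if "s \<in> ?D" for s using Q[OF that] by simp
    have hol: "?h e holomorphic_on ?D" "?j e holomorphic_on ?D" for e
      by (intro holomorphic_intros h\<phi> Q'; assumption)+
    have I: "((\<lambda>t. ?h e (g t) * vector_derivative g (at t within {0..1})) has_integral contour_integral g (?h e)) {0..1}"
      "((\<lambda>t. ?j e (g t) * vector_derivative g (at t within {0..1})) has_integral contour_integral g (?j e)) {0..1}" for e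
      using has_contour_integral_integral[OF contour_integrable_holomorphic_simple[OF hol(1) oD g']]
        has_contour_integral_integral[OF contour_integrable_holomorphic_simple[OF hol(2) oD g']]
      unfolding has_contour_integral_def by this+
    \<comment> \<open>Only bounded real-linear maps are applied to the complex integrals, so they
      may be taken outside.\<close>
    have "((\<lambda>t. ?c *\<^sub>R (\<Sum>e\<in>Basis. coef I e (?j e (g t) * vector_derivative g (at t within {0..1})) +
        vector_part (snd x) \<odot> coef I e (?h e (g t) * vector_derivative g (at t within {0..1})))) has_integral
      ?c *\<^sub>R (\<Sum>e\<in>Basis. coef I e (contour_integral g (?j e)) + vector_part (snd x) \<odot> coef I e (contour_integral g (?h e)))) {0..1}"
    proof (intro has_integral_cmul has_integral_sum has_integral_add finite_Basis)
      fix e :: "'n clifford"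
      show "((\<lambda>t. coef I e (?j e (g t) * vector_derivative g (at t within {0..1}))) has_integral coef I e (contour_integral g (?j e))) {0..1}"
        using has_integral_linear[OF I(2) bounded_linear_coef] by (simp add: o_def)
      show "((\<lambda>t. vector_part (snd x) \<odot> coef I e (?h e (g t) * vector_derivative g (at t within {0..1}))) has_integral
          vector_part (snd x) \<odot> coef I e (contour_integral g (?h e))) {0..1}"
        using has_integral_linear[OF I(1) bounded_linear_compose[OF mul.bounded_linear_right bounded_linear_coef]] by (simp add: o_def)
    qed
    moreover have "kernel k (slice I (g t)) x \<odot> ds_I I g t \<odot> f (slice I (g t)) =
        ?c *\<^sub>R (\<Sum>e\<in>Basis. coef I e (?j e (g t) * vector_derivative g (at t within {0..1})) +
        vector_part (snd x) \<odot> coef I e (?h e (g t) * vector_derivative g (at t within {0..1})))" if "t \<in> {0..1}" for t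
    proof -
      have "g t \<in> path_image g" using that by (simp add: path_image_def)
      then have "g t \<in> ?D" using g'(2) by blast
      \<comment> \<open>\<open>ds_I\<close> is defined with the Clifford product; its two factors
        lie in the plane of \<open>I\<close>, so either product gives the same.\<close>
      moreover have "ds_I I g t = emb I (vector_derivative g (at t within {0..1})) \<odot> - vector_part I"
        unfolding ds_I_def paravector_slice using mul_cases
        by (auto simp: emb_def distrib_left distrib_right of_real_def)
      ultimately show ?thesis using kernel_integrand[of "g t" x k] Q by simp
    qed
    ultimately show "((\<lambda>t. kernel k (slice I (g t)) x \<odot> ds_I I g t \<odot> f (slice I (g t))) has_integral
      ?c *\<^sub>R (\<Sum>e\<in>Basis. coef I e (contour_integral g (?j e)) + vector_part (snd x) \<odot> coef I e (contour_integral g (?h e)))) {0..1}"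
      by (subst has_integral_cong) auto
  qed
  then have "kernel_integral k I G f x = (\<Sum>g\<in>G. ?c *\<^sub>R (\<Sum>e\<in>Basis. coef I e (contour_integral g (?j e)) +
      vector_part (snd x) \<odot> coef I e (contour_integral g (?h e))))"
    unfolding kernel_integral_def by simp
  also have "\<dots> = ?c *\<^sub>R (\<Sum>e\<in>Basis. coef I e (\<Sum>g\<in>G. contour_integral g (?j e)) +
      vector_part (snd x) \<odot> coef I e (\<Sum>g\<in>G. contour_integral g (?h e)))"
    by (simp only: linear_sum[OF bounded_linear.linear[OF bounded_linear_coef]] mul.sum_right sum.distrib
        scaleR_sum_right scaleR_add_right sum.swap[of _ G])
  finally show ?thesis
    by (simp add: total_def axial_eq J_int_def H_int_def cycle_integral_def)
qed

lemma integral_representation: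
  assumes "odd CARD('n)" "x \<in> W"
  shows "(laplacian ^^ k) f x = (1 / (2 * pi)) *\<^sub>R kernel_integral k I G f x"
  unfolding laplacian_power_f[OF assms] kernel_integral_eq[OF assms(2)] by simp

end

section \<open>Local cycles and slice Cauchy domains\<close>

lemma winding_number_circlepath_outside:
  assumes "0 \<le> r" "w \<notin> cball c r" shows "winding_number (circlepath c r) w = 0"
  using assms by (intro winding_number_zero_outside[of _ "cball c r"]) auto

text \<open>Supplies a cycle near any point of \<open>V\<close>, where no boundary curve of
  \<open>U\<close> need be at hand.\<close>

lemma local_cycle_exists:
  assumes "open \<Omega>" "\<And>z. cnj z \<in> \<Omega> \<longleftrightarrow> z \<in> \<Omega>" "\<zeta> \<in> \<Omega>" "0 \<le> Im \<zeta>"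
  shows "\<exists>G r. r > 0 \<and> null_cycle \<Omega> G \<and> (\<forall>z\<in>ball \<zeta> r. encloses G z \<and> encloses G (cnj z))"
proof -
  obtain \<delta> where \<delta>: "\<delta> > 0" "cball \<zeta> \<delta> \<subseteq> \<Omega>"
    using assms(1,3) open_contains_cball by blast
  \<comment> \<open>On the real axis the two circles coincide and \<open>G\<close> has one element.
    Off it, a radius of at most \<open>Im \<zeta> / 2\<close> keeps the closed discs disjoint, so a
    point of one disc is not enclosed by the other circle.\<close>
  define r where "r = (if Im \<zeta> = 0 then \<delta> else min \<delta> (Im \<zeta> / 2))"
  have r: "r > 0" "r \<le> \<delta>" "Im \<zeta> \<noteq> 0 \<Longrightarrow> 2 * r \<le> Im \<zeta>"
    using \<delta> assms(4) by (auto simp: r_def)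
  have dist_cnj: "dist (cnj c) (cnj z) = dist c z" for c z
    unfolding dist_norm by (metis complex_cnj_diff complex_mod_cnj)
  define G where "G = {circlepath \<zeta> r, circlepath (cnj \<zeta>) r}"
  have sub: "cball c r \<subseteq> \<Omega>" if "c = \<zeta> \<or> c = cnj \<zeta>" for c
  proof
    fix z assume z: "z \<in> cball c r"
    then have "z \<in> cball \<zeta> \<delta> \<or> cnj z \<in> cball \<zeta> \<delta>"
      using that r(2) dist_cnj[of "cnj \<zeta>" z] by auto
    then show "z \<in> \<Omega>" using \<delta>(2) assms(2) by blast
  qed
  have "(\<Sum>g\<in>G. winding_number g z) = 0" if "z \<notin> \<Omega>" for z
  proof (intro sum.neutral ballI)
    fix g assume "g \<in> G"
    then show "winding_number g z = 0"
      using sub that r(1) unfolding G_def by (auto intro!: winding_number_circlepath_outside)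
  qed
  moreover have "cycle_in \<Omega> G"
    using sub r(1) by (fastforce simp: cycle_in_def G_def)
  ultimately have "null_cycle \<Omega> G" by (simp add: null_cycle_def)
  moreover have "encloses G z" if z: "z \<in> ball c r" and c: "c = \<zeta> \<or> c = cnj \<zeta>" for c z
  proof -
    have in1: "winding_number (circlepath c r) z = 1" "z \<notin> path_image (circlepath c r)"
      using z r(1) by (auto intro!: winding_number_circlepath simp: dist_norm norm_minus_commute)
    show ?thesis
    proof (cases "Im \<zeta> = 0")
      case True
      then have "cnj \<zeta> = \<zeta>" by (simp add: complex_eq_iff)
      then show ?thesis using in1 c by (auto simp: encloses_def G_def)
    next
      case False
      have G: "G = {circlepath c r, circlepath (cnj c) r}" using c by (auto simp: G_def)
      have "dist c (cnj c) = 2 * \<bar>Im c\<bar>"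
        by (simp add: dist_norm complex_diff_cnj norm_mult)
      also have "\<bar>Im c\<bar> = Im \<zeta>" using c assms(4) by auto
      finally have d: "4 * r \<le> dist c (cnj c)" using r(3)[OF False] by simp
      have out: "z \<notin> cball (cnj c) r"
        using d z r(1) dist_triangle[of c "cnj c" z] by (simp add: dist_commute)
      \<comment> \<open>Sums over \<open>G\<close> run over a set, so the two circles count
        separately only if they are distinct as functions.\<close>
      have "pathstart (circlepath c r) \<noteq> pathstart (circlepath (cnj c) r)"
        using d r(1) by auto
      then have ne: "circlepath c r \<noteq> circlepath (cnj c) r" by metis
      have "z \<notin> path_image (circlepath (cnj c) r)" using out r(1) by auto
      moreover have "winding_number (circlepath (cnj c) r) z = 0"
        using out r(1) by (intro winding_number_circlepath_outside) auto
      ultimately show ?thesis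
        using in1 ne unfolding encloses_def G by simp
    qed
  qed
  moreover have "cnj z \<in> ball (cnj \<zeta>) r" if "z \<in> ball \<zeta> r" for z
    using that dist_cnj[of \<zeta> z] by simp
  ultimately show ?thesis using r(1) by blast
qed

section \<open>Instances of the cycle computation and the two main conclusions\<close>

context slice_mult
begin

lemma local_slice_cycle:
  assumes "open V" "axially_symmetric V" "slice_pair V f a b" "norm I = 1" "x \<in> V"
  shows "\<exists>G Z. slice_cycle (\<odot>) V f a b I G Z \<and> x \<in> slice_cycle.W Z"
proof -
  have "sphere_param x \<in> slice_domain V" "0 \<le> Im (sphere_param x)"
    using assms(2,5) by (simp_all add: sphere_param_in_slice_domain) (simp add: sphere_param_def)
  then obtain G r where G: "r > 0" "null_cycle (slice_domain V) G"
      "\<And>z. z \<in> ball (sphere_param x) r \<Longrightarrow> encloses G z \<and> encloses G (cnj z)"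
    using local_cycle_exists[OF open_slice_domain[OF assms(1,2)] cnj_slice_domain] by metis
  have sc: "slice_cycle (\<odot>) V f a b I G (ball (sphere_param x) r)"
    using assms G by unfold_locales auto
  moreover have "x \<in> slice_cycle.W (ball (sphere_param x) r)"
    using G(1) by (simp add: slice_cycle.W_def[OF sc])
  ultimately show ?thesis by blast
qed

text \<open>\<open>positive_boundary\<close> gives winding number zero off the closure of the slice;
  this closure lies in the slice of \<open>closure U\<close>, hence in
  \<open>slice_domain V\<close>, so the boundary is a null cycle of the larger domain.\<close>

lemma boundary_slice_cycle:
  assumes V: "open V" "axially_symmetric V" "slice_pair V f a b" and I: "norm I = 1"
    and U: "slice_Cauchy_domain U" "closure U \<subseteq> V" and G: "positive_boundary (slice I -` U) G"
  shows "slice_cycle (\<odot>) V f a b I G (slice_domain U)" "slice_cycle.W (slice_domain U) = U"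
proof -
  have U': "open U" "axially_symmetric U" using U(1) by (simp_all add: slice_Cauchy_domain_def)
  have S: "slice I -` U = slice_domain U" using slice_domain_eq[OF U'(2) I] by simp
  have "closure (slice_domain U) \<subseteq> slice I -` closure U"
    unfolding S[symmetric]
    by (intro closure_minimal vimage_mono closure_subset closed_vimage closed_closure continuous_on_slice)
  also have "\<dots> \<subseteq> slice_domain V" using U(2) slice_domain_eq[OF V(2) I] by blast
  finally have cl: "closure (slice_domain U) \<subseteq> slice_domain V" .
  have oS: "open (slice_domain U)" by (rule open_slice_domain[OF U'])
  note G = G[unfolded S positive_boundary_def]
  have im: "path_image g \<subseteq> frontier (slice_domain U)" if "g \<in> G" for g
    using G that by blast
  have fr: "frontier (slice_domain U) = closure (slice_domain U) - slice_domain U"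
    using oS by (simp add: frontier_def interior_open)
  have "cycle_in (slice_domain V) G"
    using G im fr cl unfolding cycle_in_def by blast
  moreover have "(\<Sum>g\<in>G. winding_number g z) = 0" if "z \<notin> slice_domain V" for z
    using G cl that by blast
  ultimately have "null_cycle (slice_domain V) G" by (simp add: null_cycle_def)
  moreover have "encloses G z" if "z \<in> slice_domain U" for z
    using G im fr that unfolding encloses_def by blast
  ultimately show sc: "slice_cycle (\<odot>) V f a b I G (slice_domain U)"
    using V I oS cnj_slice_domain by unfold_locales auto
  show "slice_cycle.W (slice_domain U) = U"
    using sphere_param_in_slice_domain[OF U'(2)] by (auto simp: slice_cycle.W_def[OF sc])
qed

definition axially_holomorphic_Cliffordian ::
    "nat \<Rightarrow> 'n::{finite,linorder} point set \<Rightarrow> ('n point \<Rightarrow> 'n clifford) \<Rightarrow> bool" where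
  "axially_holomorphic_Cliffordian k U g \<longleftrightarrow>
     class_C (2 * k + 1) U g \<and> (\<forall>x\<in>U. (laplacian ^^ k) (dirac g) x = 0) \<and>
     (\<exists>A B. even_odd_on (profile U) A B \<and>
       (\<forall>x\<in>U. g x = A (fst x, norm (snd x)) +
          vector_part (snd x /\<^sub>R norm (snd x)) \<odot> B (fst x, norm (snd x))))"

text \<open>The axial components are recovered from the values at the two points of the sphere in a fixed plane \<open>\<complex>\<^sub>J\<close>.\<close>

lemma axial_decomposition:
  fixes g :: "'n point \<Rightarrow> 'n clifford"
  assumes form: "\<And>x. x \<in> V \<Longrightarrow> \<exists>X Y. \<forall>K. norm K = 1 \<longrightarrow> g (fst x, norm (snd x) *\<^sub>R K) = X + vector_part K \<odot> Y"
  shows "\<exists>A B. even_odd_on P A B \<and> (\<forall>x\<in>V. g x = A (fst x, norm (snd x)) +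
          vector_part (snd x /\<^sub>R norm (snd x)) \<odot> B (fst x, norm (snd x)))"
proof -
  obtain J :: "real ^ ('n::{finite,linorder})" where J: "norm J = 1" using unit_vector_exists by blast
  have neg: "vector_part (- K) = - vector_part K" for K :: "real ^ ('n::{finite,linorder})"
    by (rule linear_neg[OF linear_vector_part])
  have JJ: "vector_part J \<odot> (vector_part J \<odot> c) = - c" for c
    using mul_of_real(1)[of "-1" c] J
    by (simp add: mul_assoc[symmetric] mul_self vector_part_mult_self)
  \<comment> \<open>Half the sum, and \<open>-J / 2\<close> times the difference, of the values at
    \<open>u + J v\<close> and \<open>u - J v\<close>; as \<open>J\<close> squares to
    \<open>-1\<close>, the factor \<open>-J\<close> undoes the \<open>J\<close> in front of
    \<open>Y\<close>. Exchanging the two points shows parity on any set \<open>P\<close>.\<close>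
  define A where "A = (\<lambda>(u, v). (1 / 2) *\<^sub>R (g (u, v *\<^sub>R J) + g (u, - v *\<^sub>R J)))"
  define B where "B = (\<lambda>(u, v). vector_part J \<odot> ((- 1 / 2) *\<^sub>R (g (u, v *\<^sub>R J) - g (u, - v *\<^sub>R J))))"
  have "even_odd_on P A B"
    by (auto simp: even_odd_on_def A_def B_def add.commute mul.minus_right[symmetric] simp flip: scaleR_minus_right scaleR_right_diff_distrib)
  moreover have "g x = A (fst x, norm (snd x)) + vector_part (snd x /\<^sub>R norm (snd x)) \<odot> B (fst x, norm (snd x))" if x: "x \<in> V" for x
  proof -
    let ?r = "norm (snd x)"
    obtain X Y where XY: "\<And>K. norm K = 1 \<Longrightarrow> g (fst x, ?r *\<^sub>R K) = X + vector_part K \<odot> Y"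
      using form[OF x] by blast
    have gJ: "g (fst x, ?r *\<^sub>R J) = X + vector_part J \<odot> Y" using XY[OF J] .
    have gJ': "g (fst x, - ?r *\<^sub>R J) = X - vector_part J \<odot> Y"
      using XY[of "- J"] J by (simp add: neg mul.minus_left)
    have A: "A (fst x, ?r) = X"
      unfolding A_def prod.case gJ gJ' by (simp flip: scaleR_2)
    have B: "B (fst x, ?r) = Y"
    proof -
      have "(- 1 / 2) *\<^sub>R (X + vector_part J \<odot> Y - (X - vector_part J \<odot> Y)) = - (vector_part J \<odot> Y)"
        by (simp flip: scaleR_2)
      then show ?thesis unfolding B_def prod.case gJ gJ' by (simp only: mul.minus_right JJ minus_minus)
    qed
    show ?thesis
    proof (cases "snd x = 0")
      \<comment> \<open>On the real axis both points are \<open>x\<close> itself, so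
        \<open>A\<close> is already \<open>g x\<close>, and the quotient, which is zero there,
        removes the second term.\<close>
      case True
      then have "g x = A (fst x, ?r)"
        unfolding A_def by (cases x) (simp flip: scaleR_2)
      then show ?thesis using True by (simp add: linear_0[OF linear_vector_part] mul.zero_left)
    next
      case False
      then have "norm (snd x /\<^sub>R ?r) = 1" "(fst x, ?r *\<^sub>R (snd x /\<^sub>R ?r)) = x" by (auto simp: prod_eq_iff)
      with XY show ?thesis unfolding A B by metis
    qed
  qed
  ultimately show ?thesis by blast
qed

text \<open>All three conditions can be tested near single points or on single spheres, where the
  small cycles of \<open>local_slice_cycle\<close> apply.\<close>

theorem laplacian_power_Cliffordian:
  fixes f :: "'n point \<Rightarrow> 'n clifford"
  assumes odd: "odd CARD('n)" and \<alpha>: "\<alpha> < sce_exponent TYPE('n)"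
    and V: "open V" "axially_symmetric V" "slice_pair V f a b"
  shows "axially_holomorphic_Cliffordian (sce_exponent TYPE('n) - \<alpha>) V ((laplacian ^^ \<alpha>) f)"
proof -
  obtain I :: "real ^ ('n::{finite,linorder})" where I: "norm I = 1" using unit_vector_exists by blast
  note loc = local_slice_cycle[OF V I]
  have "class_C j V ((laplacian ^^ \<alpha>) f)" for j
    by (rule class_C_local) (metis loc slice_cycle.open_W slice_cycle.class_C_laplacian_power_f odd)
  moreover have "(laplacian ^^ (sce_exponent TYPE('n) - \<alpha>)) (dirac ((laplacian ^^ \<alpha>) f)) x = 0" if "x \<in> V" for x
    using loc[OF that] slice_cycle.Cliffordian_equation[OF _ odd \<alpha>] by metis
  moreover have "\<exists>X Y. \<forall>K. norm K = 1 \<longrightarrow>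
      (laplacian ^^ \<alpha>) f (fst x, norm (snd x) *\<^sub>R K) = X + vector_part K \<odot> Y" if "x \<in> V" for x
    using loc[OF that] slice_cycle.axial_form[OF _ odd] by metis
  ultimately show ?thesis
    unfolding axially_holomorphic_Cliffordian_def using axial_decomposition by blast
qed

theorem laplacian_power_integral:
  fixes f :: "'n point \<Rightarrow> 'n clifford"
  assumes "odd CARD('n)" "open V" "axially_symmetric V" "slice_pair V f a b" "norm I = 1"
    and "slice_Cauchy_domain U" "closure U \<subseteq> V" "positive_boundary (slice I -` U) G" "x \<in> U"
  shows "(laplacian ^^ \<alpha>) f x = (1 / (2 * pi)) *\<^sub>R kernel_integral \<alpha> I G f x"
  using slice_cycle.integral_representation[OF boundary_slice_cycle(1)[OF assms(2-8)] assms(1)]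
    boundary_slice_cycle(2)[OF assms(2-8)] assms(9) by simp

end

text \<open>The invariance claims follow from the representation itself: the integral is
  \<open>2 * pi\<close> times the value at \<open>x\<close> of a power of the Laplacian, which
  involves neither curve, domain nor imaginary unit and is the same for functions with the same
  image.\<close>

theorem theorem6p17:
  fixes \<alpha> :: nat and U V :: "'n::{finite,linorder} point set"
  assumes "odd CARD('n)"
    and "1 \<le> \<alpha>" and "\<alpha> \<le> sce_exponent TYPE('n) - 1"
    and "bounded U" and "slice_Cauchy_domain U"
    and "open V" and "axially_symmetric V" and "closure U \<subseteq> V"
  shows
    "(\<forall>f. left_slice_hyperholomorphic V f \<longrightarrow>
        left_axially_holomorphic_Cliffordian (sce_exponent TYPE('n) - \<alpha>) V ((laplacian ^^ \<alpha>) f) \<and>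
        (\<forall>I G. norm I = 1 \<longrightarrow> positive_boundary (slice I -` U) G \<longrightarrow> (\<forall>x\<in>U.
          (laplacian ^^ \<alpha>) f x = (1 / (2 * pi)) *\<^sub>R left_integral \<alpha> I G f x)) \<and>
        (\<forall>U' I G I' G'. bounded U' \<longrightarrow> slice_Cauchy_domain U' \<longrightarrow> closure U' \<subseteq> V \<longrightarrow>
          norm I = 1 \<longrightarrow> positive_boundary (slice I -` U) G \<longrightarrow>
          norm I' = 1 \<longrightarrow> positive_boundary (slice I' -` U') G' \<longrightarrow> (\<forall>x\<in>U \<inter> U'.
          left_integral \<alpha> I G f x = left_integral \<alpha> I' G' f x)) \<and>
        (\<forall>W f' I G. open W \<longrightarrow> axially_symmetric W \<longrightarrow> closure U \<subseteq> W \<longrightarrow>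
          left_slice_hyperholomorphic W f' \<longrightarrow>
          (\<forall>x\<in>U. (laplacian ^^ \<alpha>) f' x = (laplacian ^^ \<alpha>) f x) \<longrightarrow>
          norm I = 1 \<longrightarrow> positive_boundary (slice I -` U) G \<longrightarrow> (\<forall>x\<in>U.
          left_integral \<alpha> I G f' x = left_integral \<alpha> I G f x)))
   \<and> (\<forall>f. right_slice_hyperholomorphic V f \<longrightarrow>
        right_axially_holomorphic_Cliffordian (sce_exponent TYPE('n) - \<alpha>) V ((laplacian ^^ \<alpha>) f) \<and>
        (\<forall>I G. norm I = 1 \<longrightarrow> positive_boundary (slice I -` U) G \<longrightarrow> (\<forall>x\<in>U.
          (laplacian ^^ \<alpha>) f x = (1 / (2 * pi)) *\<^sub>R right_integral \<alpha> I G f x)) \<and>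
        (\<forall>U' I G I' G'. bounded U' \<longrightarrow> slice_Cauchy_domain U' \<longrightarrow> closure U' \<subseteq> V \<longrightarrow>
          norm I = 1 \<longrightarrow> positive_boundary (slice I -` U) G \<longrightarrow>
          norm I' = 1 \<longrightarrow> positive_boundary (slice I' -` U') G' \<longrightarrow> (\<forall>x\<in>U \<inter> U'.
          right_integral \<alpha> I G f x = right_integral \<alpha> I' G' f x)) \<and>
        (\<forall>W f' I G. open W \<longrightarrow> axially_symmetric W \<longrightarrow> closure U \<subseteq> W \<longrightarrow>
          right_slice_hyperholomorphic W f' \<longrightarrow>
          (\<forall>x\<in>U. (laplacian ^^ \<alpha>) f' x = (laplacian ^^ \<alpha>) f x) \<longrightarrow>
          norm I = 1 \<longrightarrow> positive_boundary (slice I -` U) G \<longrightarrow> (\<forall>x\<in>U.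
          right_integral \<alpha> I G f' x = right_integral \<alpha> I G f x)))"
proof -
  \<comment> \<open>The bound in the hypothesis uses truncated subtraction;
    \<open>1 \<le> \<alpha>\<close> rules out the exponent \<open>0\<close>, so the strict
    inequality follows.\<close>
  have \<alpha>: "\<alpha> < sce_exponent TYPE('n)" using assms(2,3) by linarith
  interpret L: slice_mult "(*) :: 'n clifford \<Rightarrow> 'n clifford \<Rightarrow> 'n clifford"
    by unfold_locales simp
  interpret R: slice_mult "\<lambda>a b :: 'n clifford. b * a"
    by unfold_locales simp
  have L: "left_slice_hyperholomorphic V f \<longleftrightarrow> (\<exists>a b. L.slice_pair V f a b)"
    "left_axially_holomorphic_Cliffordian k V g \<longleftrightarrow> L.axially_holomorphic_Cliffordian k V g"
    "left_integral \<alpha> I G f x = L.kernel_integral \<alpha> I G f x" for V f k g I G x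
  proof -
    have "dirac_left = (L.dirac :: ('n point \<Rightarrow> 'n clifford) \<Rightarrow> _)"
      by (simp add: fun_eq_iff dirac_left_def L.dirac_def)
    then show "left_slice_hyperholomorphic V f \<longleftrightarrow> (\<exists>a b. L.slice_pair V f a b)"
      "left_axially_holomorphic_Cliffordian k V g \<longleftrightarrow> L.axially_holomorphic_Cliffordian k V g"
      "left_integral \<alpha> I G f x = L.kernel_integral \<alpha> I G f x"
      by (simp_all add: left_slice_hyperholomorphic_def L.slice_pair_def left_axially_holomorphic_Cliffordian_def
          L.axially_holomorphic_Cliffordian_def left_integral_def L.kernel_integral_def kernel_left_def L.kernel_def)
  qed
  have R: "right_slice_hyperholomorphic V f \<longleftrightarrow> (\<exists>a b. R.slice_pair V f a b)"
    "right_axially_holomorphic_Cliffordian k V g \<longleftrightarrow> R.axially_holomorphic_Cliffordian k V g"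
    "right_integral \<alpha> I G f x = R.kernel_integral \<alpha> I G f x" for V f k g I G x
  proof -
    have "dirac_right = (R.dirac :: ('n point \<Rightarrow> 'n clifford) \<Rightarrow> _)"
      by (simp add: fun_eq_iff dirac_right_def R.dirac_def)
    then show "right_slice_hyperholomorphic V f \<longleftrightarrow> (\<exists>a b. R.slice_pair V f a b)"
      "right_axially_holomorphic_Cliffordian k V g \<longleftrightarrow> R.axially_holomorphic_Cliffordian k V g"
      "right_integral \<alpha> I G f x = R.kernel_integral \<alpha> I G f x"
      by (simp_all add: right_slice_hyperholomorphic_def R.slice_pair_def right_axially_holomorphic_Cliffordian_def
          R.axially_holomorphic_Cliffordian_def right_integral_def R.kernel_integral_def kernel_right_def R.kernel_def mult.assoc)
  qed
  \<comment> \<open>Stated for arbitrary domains, because the comparisons involve a second domain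
    \<open>U'\<close> and a function \<open>f'\<close> on another set \<open>W\<close>.\<close>
  have Lint: "left_integral \<alpha> I G f x = (2 * pi) *\<^sub>R (laplacian ^^ \<alpha>) f x"
    if "open V" "axially_symmetric V" "left_slice_hyperholomorphic V f" "norm I = 1"
      "slice_Cauchy_domain U" "closure U \<subseteq> V" "positive_boundary (slice I -` U) G" "x \<in> U"
    for V U :: "'n point set" and f I G x
  proof -
    from that(3) obtain a b where ab: "L.slice_pair V f a b" unfolding L(1) by blast
    show ?thesis
      unfolding L(3) L.laplacian_power_integral[OF assms(1) that(1,2) ab that(4-8)] by simp
  qed
  have Rint: "right_integral \<alpha> I G f x = (2 * pi) *\<^sub>R (laplacian ^^ \<alpha>) f x"
    if "open V" "axially_symmetric V" "right_slice_hyperholomorphic V f" "norm I = 1"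
      "slice_Cauchy_domain U" "closure U \<subseteq> V" "positive_boundary (slice I -` U) G" "x \<in> U"
    for V U :: "'n point set" and f I G x
  proof -
    from that(3) obtain a b where ab: "R.slice_pair V f a b" unfolding R(1) by blast
    show ?thesis
      unfolding R(3) R.laplacian_power_integral[OF assms(1) that(1,2) ab that(4-8)] by simp
  qed
  have LCliff: "left_axially_holomorphic_Cliffordian (sce_exponent TYPE('n) - \<alpha>) V ((laplacian ^^ \<alpha>) f)"
    if "left_slice_hyperholomorphic V f" for f
    using that L.laplacian_power_Cliffordian[OF assms(1) \<alpha> assms(6,7)] unfolding L(1,2) by blast
  have RCliff: "right_axially_holomorphic_Cliffordian (sce_exponent TYPE('n) - \<alpha>) V ((laplacian ^^ \<alpha>) f)"
    if "right_slice_hyperholomorphic V f" for f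
    using that R.laplacian_power_Cliffordian[OF assms(1) \<alpha> assms(6,7)] unfolding R(1,2) by blast
  show ?thesis
  proof (rule conjI)
    show "\<forall>f. left_slice_hyperholomorphic V f \<longrightarrow>
        left_axially_holomorphic_Cliffordian (sce_exponent TYPE('n) - \<alpha>) V ((laplacian ^^ \<alpha>) f) \<and>
        (\<forall>I G. norm I = 1 \<longrightarrow> positive_boundary (slice I -` U) G \<longrightarrow> (\<forall>x\<in>U.
          (laplacian ^^ \<alpha>) f x = (1 / (2 * pi)) *\<^sub>R left_integral \<alpha> I G f x)) \<and>
        (\<forall>U' I G I' G'. bounded U' \<longrightarrow> slice_Cauchy_domain U' \<longrightarrow> closure U' \<subseteq> V \<longrightarrow>
          norm I = 1 \<longrightarrow> positive_boundary (slice I -` U) G \<longrightarrow>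
          norm I' = 1 \<longrightarrow> positive_boundary (slice I' -` U') G' \<longrightarrow> (\<forall>x\<in>U \<inter> U'.
          left_integral \<alpha> I G f x = left_integral \<alpha> I' G' f x)) \<and>
        (\<forall>W f' I G. open W \<longrightarrow> axially_symmetric W \<longrightarrow> closure U \<subseteq> W \<longrightarrow>
          left_slice_hyperholomorphic W f' \<longrightarrow>
          (\<forall>x\<in>U. (laplacian ^^ \<alpha>) f' x = (laplacian ^^ \<alpha>) f x) \<longrightarrow>
          norm I = 1 \<longrightarrow> positive_boundary (slice I -` U) G \<longrightarrow> (\<forall>x\<in>U.
          left_integral \<alpha> I G f' x = left_integral \<alpha> I G f x))"
      using LCliff assms(5,8) by (auto simp: Lint[OF assms(6,7)] Lint)
  next
    show "\<forall>f. right_slice_hyperholomorphic V f \<longrightarrow>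
        right_axially_holomorphic_Cliffordian (sce_exponent TYPE('n) - \<alpha>) V ((laplacian ^^ \<alpha>) f) \<and>
        (\<forall>I G. norm I = 1 \<longrightarrow> positive_boundary (slice I -` U) G \<longrightarrow> (\<forall>x\<in>U.
          (laplacian ^^ \<alpha>) f x = (1 / (2 * pi)) *\<^sub>R right_integral \<alpha> I G f x)) \<and>
        (\<forall>U' I G I' G'. bounded U' \<longrightarrow> slice_Cauchy_domain U' \<longrightarrow> closure U' \<subseteq> V \<longrightarrow>
          norm I = 1 \<longrightarrow> positive_boundary (slice I -` U) G \<longrightarrow>
          norm I' = 1 \<longrightarrow> positive_boundary (slice I' -` U') G' \<longrightarrow> (\<forall>x\<in>U \<inter> U'.
          right_integral \<alpha> I G f x = right_integral \<alpha> I' G' f x)) \<and>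
        (\<forall>W f' I G. open W \<longrightarrow> axially_symmetric W \<longrightarrow> closure U \<subseteq> W \<longrightarrow>
          right_slice_hyperholomorphic W f' \<longrightarrow>
          (\<forall>x\<in>U. (laplacian ^^ \<alpha>) f' x = (laplacian ^^ \<alpha>) f x) \<longrightarrow>
          norm I = 1 \<longrightarrow> positive_boundary (slice I -` U) G \<longrightarrow> (\<forall>x\<in>U.
          right_integral \<alpha> I G f' x = right_integral \<alpha> I G f x))"
      using RCliff assms(5,8) by (auto simp: Rint[OF assms(6,7)] Rint)
  qed
qed

end
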